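(* Let $2\le\nu<5$, $R_0\ge2\xi_1(\nu)$, and let $(\Theta_\varepsilon)_{0<\varepsilon\le\varepsilon_1}$ be a family of distorted Lane-Emden functions (see context). Then, as $\varepsilon\to0+$, $$\Theta_\varepsilon(r,\zeta)=\theta(r)+\varepsilon\,\mathfrak{h}(r,\zeta)+O(\varepsilon^2)\quad\text{uniformly on }[0,R_0]\times[-1,1],\qquad \mathfrak{h}=(1-D\mathcal{G}(\theta))^{-1}\mathfrak{g},$$ and $$\mathfrak{h}(r,\zeta)=h_0(r)+A_2\psi_2(r)P_2(\zeta),\qquad A_2=-\frac56\,\frac{r^2}{3\psi_2(r)+r\psi_2'(r)}\Big|_{r=\xi_1}<0,$$ where $P_2(\zeta)=\frac12(3\zeta^2-1)$, $h_0$ is the solution of $-\frac1{r^2}(r^2y')'=\nu\theta_\sharp^{\nu-1}y-1$ that is continuous at $r=0$ with $y(0)=0$, and $\psi_2>0$ is the solution of $-\frac1{r^2}(r^2y')'+\frac6{r^2}y=\nu\theta_\sharp^{\nu-1}y$ with $y\sim r^2$ as $r\to0$. Furthermore, uniformly in $\zeta\in[-1,1]$, $$\Xi_1(\zeta;\varepsilon)=\xi_1+\frac{\xi_1^2}{\mu_1}\mathfrak{h}(\xi_1,\zeta)\,\varepsilon+O(\varepsilon^2),$$ and the oblateness $\sigma=\dfrac{\Xi_1(0;\varepsilon)-\Xi_1(\pm1;\varepsilon)}{\xi_1}$ of the surface satisfies $$\sigma=-\frac32\,\frac{\xi_1}{\mu_1}A_2\psi_2(\xi_1)\,\varepsilon+O(\varepsilon^2),$$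 which is positive for all sufficiently small $\varepsilon>0$.
   Context: For $1<\nu<5$, the Lane-Emden function $\theta=\theta(r;\nu)$ is the unique solution of $\theta''+\frac2r\theta'+\theta^\nu=0$ with $\theta=1+O(r^2)$ as $r\to0$, considered up to its first zero $\xi_1=\xi_1(\nu)\in(0,\infty)$ ($\theta>0$ and $\theta'<0$ on $(0,\xi_1)$). Put $\mu_1=\mu_1(\nu)=\int_0^{\xi_1}\theta^\nu r^2dr=-\xi_1^2\theta'(\xi_1)$, and extend $\theta$ to $[0,\infty)$ as a $C^2$ function by $\theta(r)=-\mu_1\left(\frac1{\xi_1}-\frac1r\right)$ for $r>\xi_1$. $\mathfrak{E}$ is the space of all $u\in C([0,R_0]\times[-1,1])$ with $u(0,\zeta)=u(0,0)$ and $u(r,\zeta)=u(r,-\zeta)$ for all $r,\zeta$, with the norm $\|u\|_{\mathfrak{E}}=\sup|u|$; a function of $r$ alone is regarded as a function of $(r,\zeta)$. Write $u_\sharp=\max\{0,u\}$, $$K(r,\zeta,r',\zeta')=\int_0^{2\pi}\frac{d\beta}{\sqrt{r^2+r'^2-2rr'(\sqrt{1-\zeta^2}\sqrt{1-\zeta'^2}\cos\beta+\zeta\zeta')}},$$ $\mathfrak{g}(r,\zeta)=\frac14(1-\zeta^2)r^2$, $$\mathcal{G}(u)(r,\zeta)=1+\frac1{4\pi}\int_{-1}^1\int_0^{R_0}K(r,\zeta,r',\zeta')u_\sharp(r',\zeta')^\nu r'^2dr'd\zeta'-\frac12\int_{-1}^1\int_0^{R_0}u_\sharp(r',\zeta')^\nu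 r'dr'd\zeta',$$ and let $D\mathcal{G}(\theta)$ be the bounded linear operator on $\mathfrak{E}$ $$(D\mathcal{G}(\theta)h)(r,\zeta)=\frac\nu{4\pi}\int_{-1}^1\int_0^{R_0}K(r,\zeta,r',\zeta')\theta_\sharp(r')^{\nu-1}h(r',\zeta')r'^2dr'd\zeta'-\frac\nu2\int_{-1}^1\int_0^{R_0}\theta_\sharp(r')^{\nu-1}h(r',\zeta')r'dr'd\zeta';$$ for $2\le\nu<5$ the operator $1-D\mathcal{G}(\theta)$ has a bounded inverse on $\mathfrak{E}$. A family of distorted Lane-Emden functions consists of constants $\varepsilon_1>0$, $C_1>0$ and, for each $0<\varepsilon\le\varepsilon_1$, a function $\Theta_\varepsilon\in\mathfrak{E}$ such that $\Theta_\varepsilon=\varepsilon\mathfrak{g}+\mathcal{G}(\Theta_\varepsilon)$ on $[0,R_0]\times[-1,1]$ and $\|\Theta_\varepsilon-\theta\|_{\mathfrak{E}}\le C_1\varepsilon$. For all sufficiently small $\varepsilon$ and each $\zeta\in[-1,1]$, $\Xi_1(\zeta;\varepsilon)$ denotes the unique number in $(0,2\xi_1)$ such that $\Theta_\varepsilon(r,\zeta)>0$ for $0\le r<\Xi_1(\zeta;\varepsilon)$, $\Theta_\varepsilon(\Xi_1(\zeta;\varepsilon),\zeta)=0$ and $\Theta_\varepsilon(r,\zeta)<0$ for $\Xi_1(\zeta;\varepsilon)<r\le2\xi_1$. *)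

theory Defs
  imports "HOL-Analysis.Analysis" "HOL-Library.Landau_Symbols"
begin

section \<open>The Lane-Emden function\<close>

definition lane_emden_mass :: "real \<Rightarrow> (real \<Rightarrow> real) \<Rightarrow> real \<Rightarrow> real" where
  "lane_emden_mass \<nu> \<theta> \<xi>\<^sub>1 = (LBINT r:{0..\<xi>\<^sub>1}. \<theta> r powr \<nu> * r\<^sup>2)"

text \<open>
  The conditions determine \<open>\<xi>\<^sub>1\<close> and the values of \<open>\<theta>\<close> on \<open>[0,\<infinity>)\<close>. The \<open>C\<^sup>2\<close> regularity of the
  extension across \<open>\<xi>\<^sub>1\<close> is a consequence: the equation gives \<open>r\<^sup>2 \<theta>' = -\<integral>\<^sub>0\<^sup>r \<theta>\<^sup>\<nu> s\<^sup>2 ds\<close> on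
  \<open>(0,\<xi>\<^sub>1)\<close>, so that \<open>\<theta>' \<rightarrow> -\<mu>\<^sub>1/\<xi>\<^sub>1\<^sup>2\<close> at \<open>\<xi>\<^sub>1\<close>.
\<close>

definition lane_emden :: "real \<Rightarrow> (real \<Rightarrow> real) \<Rightarrow> real \<Rightarrow> bool" where
  "lane_emden \<nu> \<theta> \<xi>\<^sub>1 \<longleftrightarrow>
     0 < \<xi>\<^sub>1 \<and>
     \<theta> 0 = 1 \<and> (\<lambda>r. \<theta> r - 1) \<in> O[at_right 0](\<lambda>r. r\<^sup>2) \<and>
     (\<forall>r\<in>{0<..<\<xi>\<^sub>1}.
        \<theta> differentiable (at r) \<and> deriv \<theta> differentiable (at r) \<and>
        deriv (deriv \<theta>) r + 2 / r * deriv \<theta> r + \<theta> r powr \<nu> = 0) \<and>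
     (\<forall>r\<in>{0<..<\<xi>\<^sub>1}. 0 < \<theta> r \<and> deriv \<theta> r < 0) \<and>
     continuous_on {0..\<xi>\<^sub>1} \<theta> \<and> \<theta> \<xi>\<^sub>1 = 0 \<and>
     (\<forall>r>\<xi>\<^sub>1. \<theta> r = - lane_emden_mass \<nu> \<theta> \<xi>\<^sub>1 * (1 / \<xi>\<^sub>1 - 1 / r))"


section \<open>The function space and its operators\<close>

abbreviation dom_E :: "real \<Rightarrow> (real \<times> real) set" where
  "dom_E R\<^sub>0 \<equiv> {0..R\<^sub>0} \<times> {-1..1}"

text \<open>
  Functions on \<open>[0,R\<^sub>0] \<times> [-1,1]\<close> are represented by total functions of \<open>(r,\<zeta>)\<close> that vanish
  outside this rectangle, so that equality in the space is equality of HOL functions.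
\<close>

definition on_dom :: "real \<Rightarrow> (real \<times> real \<Rightarrow> real) \<Rightarrow> (real \<times> real \<Rightarrow> real)" where
  "on_dom R\<^sub>0 u = (\<lambda>p. if p \<in> dom_E R\<^sub>0 then u p else 0)"

definition space_E :: "real \<Rightarrow> (real \<times> real \<Rightarrow> real) set" where
  "space_E R\<^sub>0 = {u. continuous_on (dom_E R\<^sub>0) u \<and>
     (\<forall>\<zeta>\<in>{-1..1}. u (0, \<zeta>) = u (0, 0)) \<and>
     (\<forall>r\<in>{0..R\<^sub>0}. \<forall>\<zeta>\<in>{-1..1}. u (r, \<zeta>) = u (r, -\<zeta>)) \<and>
     (\<forall>p. p \<notin> dom_E R\<^sub>0 \<longrightarrow> u p = 0)}"

definition norm_E :: "real \<Rightarrow> (real \<times> real \<Rightarrow> real) \<Rightarrow> real" where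
  "norm_E R\<^sub>0 u = (SUP p\<in>dom_E R\<^sub>0. \<bar>u p\<bar>)"

definition has_bounded_inverse_E ::
    "real \<Rightarrow> ((real \<times> real \<Rightarrow> real) \<Rightarrow> (real \<times> real \<Rightarrow> real)) \<Rightarrow> bool" where
  "has_bounded_inverse_E R\<^sub>0 T \<longleftrightarrow>
     bij_betw T (space_E R\<^sub>0) (space_E R\<^sub>0) \<and>
     (\<exists>C. \<forall>u\<in>space_E R\<^sub>0. norm_E R\<^sub>0 (inv_into (space_E R\<^sub>0) T u) \<le> C * norm_E R\<^sub>0 u)"

definition kernel_K :: "real \<Rightarrow> real \<Rightarrow> real \<Rightarrow> real \<Rightarrow> real" where
  "kernel_K r \<zeta> r' \<zeta>' =
     (LBINT \<beta>:{0..2 * pi}.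
        1 / sqrt (r\<^sup>2 + r'\<^sup>2 - 2 * r * r' * (sqrt (1 - \<zeta>\<^sup>2) * sqrt (1 - \<zeta>'\<^sup>2) * cos \<beta> + \<zeta> * \<zeta>')))"

definition frak_g :: "real \<Rightarrow> (real \<times> real \<Rightarrow> real)" where
  "frak_g R\<^sub>0 = on_dom R\<^sub>0 (\<lambda>(r, \<zeta>). 1/4 * (1 - \<zeta>\<^sup>2) * r\<^sup>2)"

definition op_G :: "real \<Rightarrow> real \<Rightarrow> (real \<times> real \<Rightarrow> real) \<Rightarrow> (real \<times> real \<Rightarrow> real)" where
  "op_G \<nu> R\<^sub>0 u = on_dom R\<^sub>0 (\<lambda>(r, \<zeta>).
     1 + 1 / (4 * pi) * (LBINT \<zeta>':{-1..1}. LBINT r':{0..R\<^sub>0}.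
           kernel_K r \<zeta> r' \<zeta>' * max 0 (u (r', \<zeta>')) powr \<nu> * r'\<^sup>2)
       - 1 / 2 * (LBINT \<zeta>':{-1..1}. LBINT r':{0..R\<^sub>0}.
           max 0 (u (r', \<zeta>')) powr \<nu> * r'))"

definition op_DG :: "real \<Rightarrow> real \<Rightarrow> (real \<Rightarrow> real) \<Rightarrow>
    (real \<times> real \<Rightarrow> real) \<Rightarrow> (real \<times> real \<Rightarrow> real)" where
  "op_DG \<nu> R\<^sub>0 \<theta> h = on_dom R\<^sub>0 (\<lambda>(r, \<zeta>).
     \<nu> / (4 * pi) * (LBINT \<zeta>':{-1..1}. LBINT r':{0..R\<^sub>0}.
           kernel_K r \<zeta> r' \<zeta>' * max 0 (\<theta> r') powr (\<nu> - 1) * h (r', \<zeta>') * r'\<^sup>2)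
       - \<nu> / 2 * (LBINT \<zeta>':{-1..1}. LBINT r':{0..R\<^sub>0}.
           max 0 (\<theta> r') powr (\<nu> - 1) * h (r', \<zeta>') * r'))"

definition one_minus_DG :: "real \<Rightarrow> real \<Rightarrow> (real \<Rightarrow> real) \<Rightarrow>
    (real \<times> real \<Rightarrow> real) \<Rightarrow> (real \<times> real \<Rightarrow> real)" where
  "one_minus_DG \<nu> R\<^sub>0 \<theta> h = (\<lambda>p. h p - op_DG \<nu> R\<^sub>0 \<theta> h p)"

definition frak_h :: "real \<Rightarrow> real \<Rightarrow> (real \<Rightarrow> real) \<Rightarrow> (real \<times> real \<Rightarrow> real)" where
  "frak_h \<nu> R\<^sub>0 \<theta> = inv_into (space_E R\<^sub>0) (one_minus_DG \<nu> R\<^sub>0 \<theta>) (frak_g R\<^sub>0)"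


section \<open>Distorted Lane-Emden functions\<close>

definition distorted_family :: "real \<Rightarrow> real \<Rightarrow> (real \<Rightarrow> real) \<Rightarrow> real \<Rightarrow> real \<Rightarrow>
    (real \<Rightarrow> real \<times> real \<Rightarrow> real) \<Rightarrow> bool" where
  "distorted_family \<nu> R\<^sub>0 \<theta> \<epsilon>\<^sub>1 C\<^sub>1 \<Theta> \<longleftrightarrow>
     0 < \<epsilon>\<^sub>1 \<and> 0 < C\<^sub>1 \<and>
     (\<forall>\<epsilon>. 0 < \<epsilon> \<and> \<epsilon> \<le> \<epsilon>\<^sub>1 \<longrightarrow>
        \<Theta> \<epsilon> \<in> space_E R\<^sub>0 \<and>
        (\<forall>p\<in>dom_E R\<^sub>0. \<Theta> \<epsilon> p = \<epsilon> * frak_g R\<^sub>0 p + op_G \<nu> R\<^sub>0 (\<Theta> \<epsilon>) p) \<and>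
        norm_E R\<^sub>0 (\<lambda>(r, \<zeta>). \<Theta> \<epsilon> (r, \<zeta>) - \<theta> r) \<le> C\<^sub>1 * \<epsilon>)"

definition surface_radius :: "real \<Rightarrow> (real \<times> real \<Rightarrow> real) \<Rightarrow> real \<Rightarrow> real" where
  "surface_radius \<xi>\<^sub>1 u \<zeta> = (THE x. 0 < x \<and> x < 2 * \<xi>\<^sub>1 \<and>
     (\<forall>r. 0 \<le> r \<and> r < x \<longrightarrow> 0 < u (r, \<zeta>)) \<and> u (x, \<zeta>) = 0 \<and>
     (\<forall>r. x < r \<and> r \<le> 2 * \<xi>\<^sub>1 \<longrightarrow> u (r, \<zeta>) < 0))"

definition oblateness :: "real \<Rightarrow> (real \<times> real \<Rightarrow> real) \<Rightarrow> real \<Rightarrow> real" where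
  "oblateness \<xi>\<^sub>1 u s = (surface_radius \<xi>\<^sub>1 u 0 - surface_radius \<xi>\<^sub>1 u s) / \<xi>\<^sub>1"
  \<comment> \<open>\<open>s\<close> is the pole \<open>1\<close> or \<open>-1\<close>\<close>


section \<open>The radial factors of the first-order term\<close>

definition legendre_P2 :: "real \<Rightarrow> real" where
  "legendre_P2 \<zeta> = 1/2 * (3 * \<zeta>\<^sup>2 - 1)"

definition radial_laplacian :: "(real \<Rightarrow> real) \<Rightarrow> real \<Rightarrow> real" where
  "radial_laplacian y r = 1 / r\<^sup>2 * deriv (\<lambda>s. s\<^sup>2 * deriv y s) r"

definition radial_twice_diff :: "(real \<Rightarrow> real) \<Rightarrow> real \<Rightarrow> bool" where
  "radial_twice_diff y r \<longleftrightarrow> y differentiable (at r) \<and> (\<lambda>s. s\<^sup>2 * deriv y s) differentiable (at r)"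

definition is_h0 :: "real \<Rightarrow> (real \<Rightarrow> real) \<Rightarrow> (real \<Rightarrow> real) \<Rightarrow> bool" where
  "is_h0 \<nu> \<theta> y \<longleftrightarrow>
     (\<forall>r>0. radial_twice_diff y r \<and>
        - radial_laplacian y r = \<nu> * max 0 (\<theta> r) powr (\<nu> - 1) * y r - 1) \<and>
     continuous (at 0 within {0..}) y \<and> y 0 = 0"

text \<open>
  The condition \<open>y 0 = 0\<close> only fixes the value at the origin that \<open>y \<sim> r\<^sup>2\<close> dictates by continuity.
\<close>

definition is_psi2 :: "real \<Rightarrow> (real \<Rightarrow> real) \<Rightarrow> (real \<Rightarrow> real) \<Rightarrow> bool" where
  "is_psi2 \<nu> \<theta> y \<longleftrightarrow>
     (\<forall>r>0. radial_twice_diff y r \<and>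
        - radial_laplacian y r + 6 / r\<^sup>2 * y r = \<nu> * max 0 (\<theta> r) powr (\<nu> - 1) * y r) \<and>
     y \<sim>[at_right 0] (\<lambda>r. r\<^sup>2) \<and> y 0 = 0"

definition coeff_A2 :: "real \<Rightarrow> (real \<Rightarrow> real) \<Rightarrow> real" where
  "coeff_A2 \<xi>\<^sub>1 \<psi>\<^sub>2 = - (5/6) * (\<xi>\<^sub>1\<^sup>2 / (3 * \<psi>\<^sub>2 \<xi>\<^sub>1 + \<xi>\<^sub>1 * deriv \<psi>\<^sub>2 \<xi>\<^sub>1))"

end

(*
  For fixed radii the kernel K depends on the angle between two points of the sphere only, so
  rotation invariance of the surface measure gives its integrals against 1 and P2 in closed form.
  Hence the potential of a radial source and of a source f(r) P2(zeta) are one-dimensional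
  integrals, and theta, h0 and psi2 satisfy integral equations that are equivalent to their
  differential equations; these turn theta = G(theta) and (1 - DG(theta)) h = g into identities.
  The sign of A2 comes from Sturm comparison of psi2 with -theta'.

  Since nu >= 2, the Taylor remainder of G at theta is quadratic, and the bounded inverse turns
  this into Theta = theta + eps h + O(eps^2). The potential is Lipschitz along rays, so
  Theta - theta has an O(eps) Lipschitz constant there and Theta is strictly decreasing
  near xi1; hence the surface is well defined, and its radius is expanded from Theta = 0.
*)
theory Submission
  imports Defs
begin

section \<open>Rotation invariance and zonal integrals\<close>

text \<open>The rotation term \<open>frak_g\<close> is
  \<open>r\<^sup>2 / 6 - r\<^sup>2 / 6 * legendre_P2 \<zeta>\<close>, and this dictates the form of
  the first-order term. The linearized operator keeps the two degrees apart,
  \<open>h\<^sub>0\<close> answers the radial half, and \<open>\<psi>\<^sub>2\<close> times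
  \<open>legendre_P2\<close> solves the homogeneous linearized equation up to a multiple of the
  solid harmonic r^2 P2, which \<open>coeff_A2\<close> scales to the other half. The preimage of
  \<open>frak_g\<close> is thus written down explicitly; the assumed inverse identifies it and
  bounds the remainder.

  The obstacle at the surface is that sup-norm closeness of \<Theta> and \<theta> does not exclude
  several sign changes along a ray. Radial differences of the kernel are as singular as an inverse
  squared distance, but averaged over a sphere of radius s they keep only a logarithmic singularity
  at s = r, integrable in s. Potentials are therefore Lipschitz along rays, with a constant
  proportional to the sup norm of the density. This bound degenerates at the origin, whence the
  interval from \<xi>/2 to 2\<xi>.\<close>

lemma DERIV_chain_pair:
  fixes H :: "real \<times> real \<Rightarrow> real"
  assumes "(H has_derivative (\<lambda>q. a * fst q + b * snd q)) (at (X t, Z t))"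
    and "(X has_real_derivative X') (at t)" "(Z has_real_derivative Z') (at t)"
  shows "((\<lambda>t. H (X t, Z t)) has_real_derivative (a * X' + b * Z')) (at t)"
proof -
  have "((\<lambda>t. (X t, Z t)) has_derivative (\<lambda>h. (h * X', h * Z'))) (at t)"
    using assms(2,3) by (auto simp: has_field_derivative_def mult.commute[of X'] mult.commute[of Z']
      intro!: has_derivative_Pair elim!: has_derivative_eq_rhs)
  from has_derivative_compose[OF this assms(1)]
  show ?thesis
    unfolding has_field_derivative_def
    by (rule has_derivative_eq_rhs) (auto simp: algebra_simps)
qed

text \<open>
  The infinitesimal rotation \<open>x \<partial>\<^sub>z - z \<partial>\<^sub>x\<close> is divergence free on the sphere: in the coordinates
  \<open>x = cos \<phi> cos \<beta>\<close>, \<open>z = sin \<phi>\<close> it reads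
  \<open>cos \<phi> \<partial>\<^sub>s G = \<partial>\<^sub>\<phi> (cos \<phi> cos \<beta> G) + \<partial>\<^sub>\<beta> (sin \<phi> sin \<beta> G)\<close>, and both boundary terms vanish.
\<close>

lemma sphere_integral_rotation_invariant:
  fixes H Hx Hz :: "real \<times> real \<Rightarrow> real"
  assumes D: "\<And>x z. x\<^sup>2 + z\<^sup>2 \<le> 1 \<Longrightarrow>
      (H has_derivative (\<lambda>q. Hx (x, z) * fst q + Hz (x, z) * snd q)) (at (x, z))"
    and cx: "continuous_on {p. (fst p)\<^sup>2 + (snd p)\<^sup>2 \<le> 1} Hx"
    and cz: "continuous_on {p. (fst p)\<^sup>2 + (snd p)\<^sup>2 \<le> 1} Hz"
  defines "X \<equiv> \<lambda>s \<phi> \<beta>. cos s * (cos \<phi> * cos \<beta>) - sin s * sin \<phi>"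
    and "Z \<equiv> \<lambda>s \<phi> \<beta>. sin s * (cos \<phi> * cos \<beta>) + cos s * sin \<phi>"
  defines "J \<equiv> \<lambda>s. integral {-pi/2..pi/2} (\<lambda>\<phi>. integral {0..2*pi} (\<lambda>\<beta>. H (X s \<phi> \<beta>, Z s \<phi> \<beta>) * cos \<phi>))"
  shows "J s = J 0"
proof -
  let ?D = "{p::real \<times> real. (fst p)\<^sup>2 + (snd p)\<^sup>2 \<le> 1}"
  \<comment> \<open>The pair is the projection of a rotated unit vector whose third coordinate
    \<open>cos \<phi> * sin \<beta>\<close> is dropped, so it never leaves the disc on which
    \<open>H\<close> is C^1.\<close>
  have disc: "(X s \<phi> \<beta>)\<^sup>2 + (Z s \<phi> \<beta>)\<^sup>2 \<le> 1" for s \<phi> \<beta>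
  proof -
    have "(X s \<phi> \<beta>)\<^sup>2 + (Z s \<phi> \<beta>)\<^sup>2 = ((sin s)\<^sup>2 + (cos s)\<^sup>2) * ((cos \<phi> * cos \<beta>)\<^sup>2 + (sin \<phi>)\<^sup>2)"
      unfolding X_def Z_def by algebra
    also have "\<dots> = (cos \<phi>)\<^sup>2 * (cos \<beta>)\<^sup>2 + (sin \<phi>)\<^sup>2" by (simp add: power_mult_distrib)
    also have "\<dots> \<le> (cos \<phi>)\<^sup>2 * 1 + (sin \<phi>)\<^sup>2"
      by (intro add_mono mult_left_mono) (auto simp: abs_square_le_1)
    finally show ?thesis by simp
  qed
  have cH: "continuous_on ?D H"
    by (rule has_derivative_continuous_on[where f' = "\<lambda>p q. Hx p * fst q + Hz p * snd q"])
       (auto intro!: has_derivative_at_withinI[OF D])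
  have cXZ: "continuous_on UNIV (\<lambda>(s, \<phi>, \<beta>). (X s \<phi> \<beta>, Z s \<phi> \<beta>))"
    unfolding X_def Z_def split_beta by (intro continuous_intros)
  have comp: "continuous_on UNIV (\<lambda>(s, \<phi>, \<beta>). g (X s \<phi> \<beta>, Z s \<phi> \<beta>))" if "continuous_on ?D g" for g :: "real \<times> real \<Rightarrow> real"
  proof -
    have "continuous_on UNIV (\<lambda>p. g ((\<lambda>(s, \<phi>, \<beta>). (X s \<phi> \<beta>, Z s \<phi> \<beta>)) p))"
      by (rule continuous_on_compose2[OF that cXZ]) (use disc in auto)
    then show ?thesis by (simp add: split_beta)
  qed
  define G where "G = (\<lambda>s \<phi> \<beta>. H (X s \<phi> \<beta>, Z s \<phi> \<beta>))"
  define A where "A = (\<lambda>s \<phi> \<beta>. Hx (X s \<phi> \<beta>, Z s \<phi> \<beta>))"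
  define B where "B = (\<lambda>s \<phi> \<beta>. Hz (X s \<phi> \<beta>, Z s \<phi> \<beta>))"
  have cG: "continuous_on UNIV (\<lambda>(s, \<phi>, \<beta>). G s \<phi> \<beta>)"
    and cA: "continuous_on UNIV (\<lambda>(s, \<phi>, \<beta>). A s \<phi> \<beta>)"
    and cB: "continuous_on UNIV (\<lambda>(s, \<phi>, \<beta>). B s \<phi> \<beta>)"
    unfolding G_def A_def B_def using comp cH cx cz by auto
  have cont[continuous_intros]: "continuous_on S (\<lambda>w. G (f w) (g w) (h w))"
      "continuous_on S (\<lambda>w. A (f w) (g w) (h w))" "continuous_on S (\<lambda>w. B (f w) (g w) (h w))"
      "continuous_on S (\<lambda>w. X (f w) (g w) (h w))" "continuous_on S (\<lambda>w. Z (f w) (g w) (h w))"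
    if "continuous_on S f" "continuous_on S g" "continuous_on S h"
    for S :: "'b::t2_space set" and f g h :: "'b \<Rightarrow> real"
  proof -
    have p: "continuous_on S (\<lambda>w. (f w, g w, h w))" using that by (intro continuous_intros)
    from continuous_on_compose2[OF cG p] continuous_on_compose2[OF cA p] continuous_on_compose2[OF cB p]
    show "continuous_on S (\<lambda>w. G (f w) (g w) (h w))"
      "continuous_on S (\<lambda>w. A (f w) (g w) (h w))" "continuous_on S (\<lambda>w. B (f w) (g w) (h w))" by auto
    show "continuous_on S (\<lambda>w. X (f w) (g w) (h w))" "continuous_on S (\<lambda>w. Z (f w) (g w) (h w))"
      unfolding X_def Z_def using that by (auto intro!: continuous_intros)
  qed
  have G_s: "((\<lambda>s. G s \<phi> \<beta>) has_real_derivative (- A s \<phi> \<beta> * Z s \<phi> \<beta> + B s \<phi> \<beta> * X s \<phi> \<beta>)) (at s)" for s \<phi> \<beta>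
    unfolding G_def
    by (rule DERIV_cong, rule DERIV_chain_pair[where H = H and X = "\<lambda>s. X s \<phi> \<beta>" and Z = "\<lambda>s. Z s \<phi> \<beta>" and t = s, OF D[OF disc], where X' = "- Z s \<phi> \<beta>" and Z' = "X s \<phi> \<beta>"])
       (auto simp: X_def Z_def A_def B_def intro!: derivative_eq_intros, simp add: algebra_simps)
  have G_p: "((\<lambda>\<phi>. G s \<phi> \<beta>) has_real_derivative
      (A s \<phi> \<beta> * (- cos s * (sin \<phi> * cos \<beta>) - sin s * cos \<phi>) + B s \<phi> \<beta> * (- sin s * (sin \<phi> * cos \<beta>) + cos s * cos \<phi>))) (at \<phi>)" for s \<phi> \<beta>
    unfolding G_def
    by (rule DERIV_cong, rule DERIV_chain_pair[where H = H and X = "\<lambda>\<phi>. X s \<phi> \<beta>" and Z = "\<lambda>\<phi>. Z s \<phi> \<beta>" and t = \<phi>, OF D[OF disc], where X' = "- cos s * (sin \<phi> * cos \<beta>) - sin s * cos \<phi>" and Z' = "- sin s * (sin \<phi> * cos \<beta>) + cos s * cos \<phi>"])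
       (auto simp: X_def Z_def A_def B_def intro!: derivative_eq_intros)
  have G_b: "((\<lambda>\<beta>. G s \<phi> \<beta>) has_real_derivative
      (A s \<phi> \<beta> * (- cos s * (cos \<phi> * sin \<beta>)) + B s \<phi> \<beta> * (- sin s * (cos \<phi> * sin \<beta>)))) (at \<beta>)" for s \<phi> \<beta>
    unfolding G_def
    by (rule DERIV_cong, rule DERIV_chain_pair[where H = H and X = "\<lambda>\<beta>. X s \<phi> \<beta>" and Z = "\<lambda>\<beta>. Z s \<phi> \<beta>" and t = \<beta>, OF D[OF disc], where X' = "- cos s * (cos \<phi> * sin \<beta>)" and Z' = "- sin s * (cos \<phi> * sin \<beta>)"])
       (auto simp: X_def Z_def A_def B_def intro!: derivative_eq_intros)
  define G' where "G' = (\<lambda>s \<phi> \<beta>. - A s \<phi> \<beta> * Z s \<phi> \<beta> + B s \<phi> \<beta> * X s \<phi> \<beta>)"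
  \<comment> \<open>\<open>P\<close> and \<open>Q\<close> are the two derivatives of the divergence
    form with the product rule carried out, which makes the identity below polynomial in sines and
    cosines.\<close>
  define P where "P = (\<lambda>s \<phi> \<beta>. - sin \<phi> * cos \<beta> * G s \<phi> \<beta> + cos \<phi> * cos \<beta> *
       (A s \<phi> \<beta> * (- cos s * (sin \<phi> * cos \<beta>) - sin s * cos \<phi>) + B s \<phi> \<beta> * (- sin s * (sin \<phi> * cos \<beta>) + cos s * cos \<phi>)))"
  define Q where "Q = (\<lambda>s \<phi> \<beta>. sin \<phi> * cos \<beta> * G s \<phi> \<beta> + sin \<phi> * sin \<beta> *
       (A s \<phi> \<beta> * (- cos s * (cos \<phi> * sin \<beta>)) + B s \<phi> \<beta> * (- sin s * (cos \<phi> * sin \<beta>))))"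
  have div: "G' s \<phi> \<beta> * cos \<phi> = P s \<phi> \<beta> + Q s \<phi> \<beta>" for s \<phi> \<beta>
  proof -
    have "(sin \<phi>)\<^sup>2 + (cos \<phi>)\<^sup>2 = 1" "(sin \<beta>)\<^sup>2 + (cos \<beta>)\<^sup>2 = 1" by simp_all
    then show ?thesis unfolding G'_def P_def Q_def X_def Z_def by algebra
  qed
  have cP: "continuous_on S (\<lambda>w. P (f w) (g w) (h w))" and cQ: "continuous_on S (\<lambda>w. Q (f w) (g w) (h w))"
    if "continuous_on S f" "continuous_on S g" "continuous_on S h"
    for S :: "'b::t2_space set" and f g h :: "'b \<Rightarrow> real"
    unfolding P_def Q_def using that by (auto intro!: continuous_intros)
  let ?C = "cbox (-pi/2, 0) (pi/2, 2*pi) :: (real \<times> real) set"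
  have J_eq: "J s = integral ?C (\<lambda>(\<phi>, \<beta>). G s \<phi> \<beta> * cos \<phi>)" for s
  proof -
    have "J s = integral {-pi/2..pi/2} (\<lambda>\<phi>. integral {0..2*pi} (\<lambda>\<beta>. G s \<phi> \<beta> * cos \<phi>))"
      by (simp add: J_def G_def)
    also have "\<dots> = integral ?C (\<lambda>(\<phi>, \<beta>). G s \<phi> \<beta> * cos \<phi>)"
      by (subst integral_prod_continuous) (auto simp: split_beta box_real intro!: continuous_intros)
    finally show ?thesis .
  qed
  have P0: "integral ?C (\<lambda>(\<phi>, \<beta>). P s \<phi> \<beta>) = 0" for s
  proof -
    have "integral {-pi/2..pi/2} (\<lambda>\<phi>. P s \<phi> \<beta>) = 0" for \<beta>
    proof -
      have "((\<lambda>\<phi>. P s \<phi> \<beta>) has_integral (cos (pi/2) * cos \<beta> * G s (pi/2) \<beta> - cos (-pi/2) * cos \<beta> * G s (-pi/2) \<beta>)) {-pi/2..pi/2}"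
        by (rule fundamental_theorem_of_calculus)
           (auto simp: P_def has_real_derivative_iff_has_vector_derivative[symmetric]
             intro!: derivative_eq_intros DERIV_subset[OF G_p])
      then show ?thesis by (simp add: integral_unique)
    qed
    moreover have "integral ?C (\<lambda>(\<phi>, \<beta>). P s \<phi> \<beta>) = integral (cbox (-pi/2) (pi/2)) (\<lambda>\<phi>. integral (cbox 0 (2*pi)) (P s \<phi>))"
      by (subst integral_prod_continuous) (auto simp: split_beta box_real intro!: cP continuous_intros)
    \<comment> \<open>The \<phi>-integral has to become the inner one before its boundary values can
      be used.\<close>
    moreover have "\<dots> = integral (cbox 0 (2*pi)) (\<lambda>\<beta>. integral (cbox (-pi/2) (pi/2)) (\<lambda>\<phi>. P s \<phi> \<beta>))"
      by (rule integral_swap_continuous) (auto simp: split_beta intro!: cP continuous_intros)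
    ultimately show ?thesis by (simp add: box_real)
  qed
  have Q0: "integral ?C (\<lambda>(\<phi>, \<beta>). Q s \<phi> \<beta>) = 0" for s
  proof -
    have "integral {0..2*pi} (\<lambda>\<beta>. Q s \<phi> \<beta>) = 0" for \<phi>
    proof -
      have "((\<lambda>\<beta>. Q s \<phi> \<beta>) has_integral (sin \<phi> * sin (2*pi) * G s \<phi> (2*pi) - sin \<phi> * sin 0 * G s \<phi> 0)) {0..2*pi}"
        by (rule fundamental_theorem_of_calculus)
           (auto simp: Q_def has_real_derivative_iff_has_vector_derivative[symmetric]
             intro!: derivative_eq_intros DERIV_subset[OF G_b])
      then show ?thesis by (simp add: integral_unique)
    qed
    moreover have "integral ?C (\<lambda>(\<phi>, \<beta>). Q s \<phi> \<beta>) = integral (cbox (-pi/2) (pi/2)) (\<lambda>\<phi>. integral (cbox 0 (2*pi)) (Q s \<phi>))"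
      by (subst integral_prod_continuous) (auto simp: split_beta box_real intro!: cQ continuous_intros)
    ultimately show ?thesis by (simp add: box_real)
  qed
  have "(J has_real_derivative 0) (at s)" for s
  proof -
    have "((\<lambda>s. integral ?C ((\<lambda>s (\<phi>, \<beta>). G s \<phi> \<beta> * cos \<phi>) s)) has_real_derivative integral ?C ((\<lambda>s (\<phi>, \<beta>). G' s \<phi> \<beta> * cos \<phi>) s)) (at s within UNIV)"
      by (rule leibniz_rule_field_derivative)
         (auto simp: split_beta G'_def intro!: derivative_eq_intros DERIV_subset[OF G_s] integrable_continuous continuous_intros)
    moreover have "integral ?C ((\<lambda>s (\<phi>, \<beta>). G' s \<phi> \<beta> * cos \<phi>) s) = 0"
    proof -
      have "integral ?C (\<lambda>(\<phi>, \<beta>). G' s \<phi> \<beta> * cos \<phi>) = integral ?C (\<lambda>w. (\<lambda>(\<phi>, \<beta>). P s \<phi> \<beta>) w + (\<lambda>(\<phi>, \<beta>). Q s \<phi> \<beta>) w)"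
        by (rule arg_cong[where f = "integral ?C"]) (auto simp: div fun_eq_iff)
      also have "\<dots> = integral ?C (\<lambda>(\<phi>, \<beta>). P s \<phi> \<beta>) + integral ?C (\<lambda>(\<phi>, \<beta>). Q s \<phi> \<beta>)"
        by (rule Henstock_Kurzweil_Integration.integral_add)
           (auto simp: split_beta intro!: integrable_continuous cP cQ continuous_intros)
      finally show ?thesis using P0 Q0 by simp
    qed
    ultimately show ?thesis by (simp add: J_eq[abs_def])
  qed
  then show ?thesis by (intro DERIV_isconst_all) auto
qed

text \<open>Archimedes: the height z = sin \<phi> turns the area element \<open>cos \<phi>\<close>
  of the sphere into dz.\<close>

lemma integral_sin_substitution:
  fixes g :: "real \<Rightarrow> real"
  assumes "continuous_on {-1..1} g"
  shows "integral {-pi/2..pi/2} (\<lambda>\<phi>. g (sin \<phi>) * cos \<phi>) = integral {-1..1} g"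
proof -
  have "((\<lambda>\<phi>. cos \<phi> *\<^sub>R g (sin \<phi>)) has_integral (integral {sin (-pi/2)..sin (pi/2)} g)) {-pi/2..pi/2}"
    by (rule has_integral_substitution[OF _ _ _ assms])
       (auto intro!: derivative_eq_intros DERIV_subset[OF DERIV_sin])
  then show ?thesis by (simp add: integral_unique mult.commute)
qed

text \<open>Scalar product of two unit vectors at heights \<zeta> and z whose longitudes differ by
  \<beta>.\<close>

definition zonal_arg :: "real \<Rightarrow> real \<Rightarrow> real \<Rightarrow> real" where
  "zonal_arg \<zeta> z \<beta> = sqrt (1 - \<zeta>\<^sup>2) * sqrt (1 - z\<^sup>2) * cos \<beta> + \<zeta> * z"

lemma zonal_arg_mem:
  assumes "\<zeta> \<in> {-1..1}" "z \<in> {-1..1}"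
  shows "zonal_arg \<zeta> z \<beta> \<in> {-1..1}"
proof -
  define a where "a = sqrt (1 - \<zeta>\<^sup>2)"
  define b where "b = sqrt (1 - z\<^sup>2)"
  have a: "a\<^sup>2 + \<zeta>\<^sup>2 = 1" "a \<ge> 0" and b: "b\<^sup>2 + z\<^sup>2 = 1" "b \<ge> 0"
    using assms by (auto simp: a_def b_def abs_square_le_1 abs_le_iff)
  have "\<bar>zonal_arg \<zeta> z \<beta>\<bar> \<le> a * b * \<bar>cos \<beta>\<bar> + \<bar>\<zeta> * z\<bar>"
    unfolding zonal_arg_def a_def[symmetric] b_def[symmetric]
    using a b by (intro order_trans[OF abs_triangle_ineq]) (simp add: abs_mult)
  also have "\<dots> \<le> a * b * 1 + \<bar>\<zeta> * z\<bar>"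
    using a b by (intro add_mono mult_left_mono) auto
  \<comment> \<open>Cauchy-Schwarz by hand: the two squares add up to
    \<open>2 * (1 - a * b - \<bar>\<zeta> * z\<bar>)\<close>.\<close>
  also have "\<dots> \<le> 1"
    using sum_squares_ge_zero[of "a - b" "\<bar>\<zeta>\<bar> - \<bar>z\<bar>"] a b
    by (simp add: power2_eq_square algebra_simps abs_mult)
  finally show ?thesis by (simp add: abs_le_iff)
qed

lemma continuous_on_zonal_arg [continuous_intros]:
  fixes S :: "'a::t2_space set"
  shows "continuous_on S f \<Longrightarrow> continuous_on S g \<Longrightarrow> continuous_on S h \<Longrightarrow>
    continuous_on S (\<lambda>w. zonal_arg (f w) (g w) (h w))"
  unfolding zonal_arg_def by (intro continuous_intros)

lemma continuous_on_zonal_integral: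
  assumes "continuous_on {-1..1} F" "\<zeta> \<in> {-1..1}"
  shows "continuous_on {-1..1} (\<lambda>z. integral {0..2*pi} (\<lambda>\<beta>. F (zonal_arg \<zeta> z \<beta>) :: real))"
proof -
  have "continuous_on ({-1..1} \<times> cbox 0 (2*pi)) (\<lambda>(z, \<beta>). F (zonal_arg \<zeta> z \<beta>))"
    unfolding split_beta
    by (rule continuous_on_compose2[OF assms(1)])
       (use assms(2) in \<open>auto intro!: continuous_intros zonal_arg_mem simp del: atLeastAtMost_iff\<close>)
  from integral_continuous_on_param[OF this] show ?thesis by (simp add: box_real)
qed

text \<open>Both sides integrate over the unit sphere a function of the angle to one axis times a
  function of the angle to another, the axes enclosing the angle \<open>arccos \<zeta>\<close>. On
  the left the axis of \<open>P\<close> is the pole, on the right that of \<open>F\<close>, and a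
  rotation passes from one to the other. A longitude average of a general \<open>F\<close> is
  thereby traded for one of \<open>P\<close>, which is explicit for a polynomial.\<close>

lemma zonal_integral_exchange:
  fixes F F' P P' :: "real \<Rightarrow> real"
  assumes F: "\<And>t. t \<in> {-1..1} \<Longrightarrow> (F has_real_derivative F' t) (at t)" and cF': "continuous_on {-1..1} F'"
    and P: "\<And>t. (P has_real_derivative P' t) (at t)" and cP': "continuous_on UNIV P'"
    and \<zeta>: "\<zeta> \<in> {-1..1}"
  shows "integral {-1..1} (\<lambda>z. integral {0..2*pi} (\<lambda>\<beta>. F (zonal_arg \<zeta> z \<beta>)) * P z) =
    integral {-1..1} (\<lambda>z. F z * integral {0..2*pi} (\<lambda>\<beta>. P (\<zeta> * z - sqrt (1 - \<zeta>\<^sup>2) * sqrt (1 - z\<^sup>2) * cos \<beta>)))"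
    (is "?L = ?R")
proof -
  define s where "s = arccos \<zeta>"
  have s: "cos s = \<zeta>" "sin s = sqrt (1 - \<zeta>\<^sup>2)"
    using \<zeta> by (auto simp: s_def sin_arccos)
  have cF: "continuous_on {-1..1} F"
    by (rule DERIV_continuous_on[OF DERIV_subset[OF F]]) auto
  have cP[continuous_intros]: "continuous_on S (\<lambda>w. P (f w))" if "continuous_on S f" for S :: "'b::t2_space set" and f
    using continuous_on_compose2[OF DERIV_continuous_on[of UNIV P P'] that] P by auto
  have cPd[continuous_intros]: "continuous_on S (\<lambda>w. P' (f w))" if "continuous_on S f" for S :: "'b::t2_space set" and f
    using continuous_on_compose2[OF cP' that] by auto
  let ?D = "{p::real \<times> real. (fst p)\<^sup>2 + (snd p)\<^sup>2 \<le> 1}"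
  have z1: "snd p \<in> {-1..1}" if "p \<in> ?D" for p
  proof -
    from that have "(fst p)\<^sup>2 + (snd p)\<^sup>2 \<le> 1" by simp
    then have "(snd p)\<^sup>2 \<le> 1" using zero_le_power2[of "fst p"] by linarith
    then show ?thesis by (simp add: abs_square_le_1 abs_le_iff)
  qed
  have cFD[continuous_intros]: "continuous_on ?D (\<lambda>p. F (snd p))" "continuous_on ?D (\<lambda>p. F' (snd p))"
    by (rule continuous_on_compose2[OF cF] continuous_on_compose2[OF cF'];
        use z1 in \<open>auto intro!: continuous_intros simp del: atLeastAtMost_iff\<close>)+
  define H where "H = (\<lambda>p. F (snd p) * P (cos s * snd p - sin s * fst p))"
  define Hx where "Hx = (\<lambda>p. - F (snd p) * P' (cos s * snd p - sin s * fst p) * sin s)"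
  define Hz where "Hz = (\<lambda>p. F' (snd p) * P (cos s * snd p - sin s * fst p) + F (snd p) * P' (cos s * snd p - sin s * fst p) * cos s)"
  have inv: "integral {-pi/2..pi/2} (\<lambda>\<phi>. integral {0..2*pi} (\<lambda>\<beta>.
        H (cos s * (cos \<phi> * cos \<beta>) - sin s * sin \<phi>, sin s * (cos \<phi> * cos \<beta>) + cos s * sin \<phi>) * cos \<phi>)) =
      integral {-pi/2..pi/2} (\<lambda>\<phi>. integral {0..2*pi} (\<lambda>\<beta>.
        H (cos 0 * (cos \<phi> * cos \<beta>) - sin 0 * sin \<phi>, sin 0 * (cos \<phi> * cos \<beta>) + cos 0 * sin \<phi>) * cos \<phi>))"
  proof (rule sphere_integral_rotation_invariant)
    fix x z :: real assume xz: "x\<^sup>2 + z\<^sup>2 \<le> 1"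
    then have "z \<in> {-1..1}" using z1[of "(x, z)"] by auto
    then have "((\<lambda>p. F (snd p)) has_derivative (\<lambda>q. F' z * snd q)) (at (x, z))"
      using has_derivative_compose[OF has_derivative_snd[OF has_derivative_ident], of F "\<lambda>h. F' z * h" "(x, z)" UNIV] F[of z]
      by (auto simp: has_field_derivative_def)
    moreover have "((\<lambda>p. P (cos s * snd p - sin s * fst p)) has_derivative (\<lambda>q. P' (cos s * z - sin s * x) * (cos s * snd q - sin s * fst q))) (at (x, z))"
      by (rule has_derivative_compose[where g = P and f = "\<lambda>p. cos s * snd p - sin s * fst p" and f' = "\<lambda>q. cos s * snd q - sin s * fst q"])
         (use P in \<open>auto simp: has_field_derivative_def intro!: derivative_eq_intros\<close>)
    ultimately show "(H has_derivative (\<lambda>q. Hx (x, z) * fst q + Hz (x, z) * snd q)) (at (x, z))"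
      unfolding H_def Hx_def Hz_def
      by (auto intro!: derivative_eq_intros simp: algebra_simps)
  next
    show "continuous_on ?D Hx" "continuous_on ?D Hz" unfolding Hx_def Hz_def
      by (intro continuous_intros)+
  qed
  have sq: "sqrt (1 - (sin \<phi>)\<^sup>2) = cos \<phi>" if "\<phi> \<in> {-pi/2..pi/2}" for \<phi>
    using that by (simp add: cos_squared_eq[symmetric] cos_ge_zero)
  \<comment> \<open>Rotating back returns the height \<open>sin \<phi>\<close>, so the factor
    \<open>P\<close> does not depend on \<beta> and leaves the inner integral.\<close>
  have id: "cos s * (sin s * (cos \<phi> * cos \<beta>) + cos s * sin \<phi>) - sin s * (cos s * (cos \<phi> * cos \<beta>) - sin s * sin \<phi>) = sin \<phi>" for \<phi> \<beta>
    using sin_cos_squared_add[of s] by algebra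
  have "?L = integral {-pi/2..pi/2} (\<lambda>\<phi>. (\<lambda>z. integral {0..2*pi} (\<lambda>\<beta>. F (zonal_arg \<zeta> z \<beta>)) * P z) (sin \<phi>) * cos \<phi>)"
    by (rule integral_sin_substitution[symmetric])
       (auto intro!: continuous_intros continuous_on_zonal_integral cF \<zeta> simp del: atLeastAtMost_iff)
  also have "\<dots> = integral {-pi/2..pi/2} (\<lambda>\<phi>. integral {0..2*pi} (\<lambda>\<beta>.
        H (cos s * (cos \<phi> * cos \<beta>) - sin s * sin \<phi>, sin s * (cos \<phi> * cos \<beta>) + cos s * sin \<phi>) * cos \<phi>))"
    by (rule Henstock_Kurzweil_Integration.integral_cong)
       (auto simp: zonal_arg_def s sq H_def id[unfolded s] mult.assoc Henstock_Kurzweil_Integration.integral_mult_left)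
  also note inv
  also have "integral {-pi/2..pi/2} (\<lambda>\<phi>. integral {0..2*pi} (\<lambda>\<beta>.
        H (cos 0 * (cos \<phi> * cos \<beta>) - sin 0 * sin \<phi>, sin 0 * (cos \<phi> * cos \<beta>) + cos 0 * sin \<phi>) * cos \<phi>)) =
      integral {-pi/2..pi/2} (\<lambda>\<phi>. (\<lambda>z. F z * integral {0..2*pi} (\<lambda>\<beta>. P (\<zeta> * z - sqrt (1 - \<zeta>\<^sup>2) * sqrt (1 - z\<^sup>2) * cos \<beta>))) (sin \<phi>) * cos \<phi>)"
    by (rule Henstock_Kurzweil_Integration.integral_cong)
       (auto simp: s sq H_def mult.assoc Henstock_Kurzweil_Integration.integral_mult_left)
  also have "\<dots> = ?R"
  proof (rule integral_sin_substitution)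
    have "continuous_on ({-1..1} \<times> cbox 0 (2*pi)) (\<lambda>(z, \<beta>). P (\<zeta> * z - sqrt (1 - \<zeta>\<^sup>2) * sqrt (1 - z\<^sup>2) * cos \<beta>))"
      unfolding split_beta by (intro continuous_intros)
    from integral_continuous_on_param[OF this]
    show "continuous_on {-1..1} (\<lambda>z. F z * integral {0..2*pi} (\<lambda>\<beta>. P (\<zeta> * z - sqrt (1 - \<zeta>\<^sup>2) * sqrt (1 - z\<^sup>2) * cos \<beta>)))"
      by (auto simp: box_real intro!: continuous_intros cF)
  qed
  finally show ?thesis .
qed

section \<open>Zonal averages of degree zero and two\<close>

lemma integral_cos_period: "((\<lambda>\<beta>. a + b * cos \<beta> + c * (cos \<beta>)\<^sup>2) has_integral (2 * pi * a + pi * c)) {0..2*pi}"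
proof -
  have "((\<lambda>\<beta>. a + b * cos \<beta> + c * (cos \<beta>)\<^sup>2) has_integral
      ((a * (2*pi) + b * sin (2*pi) + c * (2*pi + sin (2*pi) * cos (2*pi)) / 2) - (a * 0 + b * sin 0 + c * (0 + sin 0 * cos 0) / 2))) {0..2*pi}"
  proof (rule fundamental_theorem_of_calculus)
    fix x :: real
    have "c + (c * (cos x * cos x) - c * (sin x * sin x)) = 2 * (c * (cos x * cos x))"
      using sin_cos_squared_add[of x] by algebra
    then show "((\<lambda>\<beta>. a * \<beta> + b * sin \<beta> + c * (\<beta> + sin \<beta> * cos \<beta>) / 2) has_vector_derivative a + b * cos x + c * (cos x)\<^sup>2) (at x within {0..2*pi})"
      unfolding has_real_derivative_iff_has_vector_derivative[symmetric]
      by (auto intro!: derivative_eq_intros simp: power2_eq_square algebra_simps)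
  qed auto
  then show ?thesis by (simp add: algebra_simps)
qed

lemma zonal_integral:
  assumes "\<And>t. t \<in> {-1..1} \<Longrightarrow> (F has_real_derivative F' t) (at t)" "continuous_on {-1..1} F'"
    and "\<zeta> \<in> {-1..1}"
  shows "integral {-1..1} (\<lambda>z. integral {0..2*pi} (\<lambda>\<beta>. F (zonal_arg \<zeta> z \<beta>))) = 2 * pi * integral {-1..1} F"
  using zonal_integral_exchange[OF assms(1,2), of "\<lambda>_. 1" "\<lambda>_. 0" \<zeta>] assms(3) by (simp add: mult.commute)

text \<open>Funk-Hecke formula in degree two. After the exchange only \<open>legendre_P2\<close> is
  averaged over longitudes, and the addition theorem gives
  \<open>legendre_P2 \<zeta> * legendre_P2 z\<close> for its mean.\<close>

lemma zonal_integral_P2: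
  assumes "\<And>t. t \<in> {-1..1} \<Longrightarrow> (F has_real_derivative F' t) (at t)" "continuous_on {-1..1} F'"
    and \<zeta>: "\<zeta> \<in> {-1..1}"
  shows "integral {-1..1} (\<lambda>z. integral {0..2*pi} (\<lambda>\<beta>. F (zonal_arg \<zeta> z \<beta>)) * legendre_P2 z) =
    2 * pi * legendre_P2 \<zeta> * integral {-1..1} (\<lambda>t. F t * legendre_P2 t)"
proof -
  have "integral {-1..1} (\<lambda>z. integral {0..2*pi} (\<lambda>\<beta>. F (zonal_arg \<zeta> z \<beta>)) * legendre_P2 z) =
    integral {-1..1} (\<lambda>z. F z * integral {0..2*pi} (\<lambda>\<beta>. legendre_P2 (\<zeta> * z - sqrt (1 - \<zeta>\<^sup>2) * sqrt (1 - z\<^sup>2) * cos \<beta>)))"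
    by (rule zonal_integral_exchange[OF assms(1,2), where P' = "\<lambda>t. 3 * t"])
       (auto simp: legendre_P2_def[abs_def] \<zeta>[simplified] intro!: derivative_eq_intros continuous_intros)
  also have "\<dots> = integral {-1..1} (\<lambda>z. (2 * pi * legendre_P2 \<zeta>) * (F z * legendre_P2 z))"
  proof (rule Henstock_Kurzweil_Integration.integral_cong)
    fix z :: real assume z: "z \<in> {-1..1}"
    define a where "a = sqrt (1 - \<zeta>\<^sup>2)"
    define b where "b = sqrt (1 - z\<^sup>2)"
    have a: "a\<^sup>2 = 1 - \<zeta>\<^sup>2" and b: "b\<^sup>2 = 1 - z\<^sup>2"
      using z \<zeta> by (auto simp: a_def b_def abs_square_le_1 abs_le_iff)
    have "integral {0..2*pi} (\<lambda>\<beta>. legendre_P2 (\<zeta> * z - a * b * cos \<beta>)) =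
        integral {0..2*pi} (\<lambda>\<beta>. (3/2 * \<zeta>\<^sup>2 * z\<^sup>2 - 1/2) + (- 3 * \<zeta> * z * a * b) * cos \<beta> + (3/2 * a\<^sup>2 * b\<^sup>2) * (cos \<beta>)\<^sup>2)"
      by (rule arg_cong[where f = "integral _"]) (auto simp: legendre_P2_def power2_eq_square algebra_simps fun_eq_iff)
    also have "\<dots> = 2 * pi * (3/2 * \<zeta>\<^sup>2 * z\<^sup>2 - 1/2) + pi * (3/2 * a\<^sup>2 * b\<^sup>2)"
      by (rule integral_unique[OF integral_cos_period])
    also have "\<dots> = 2 * pi * legendre_P2 \<zeta> * legendre_P2 z"
      unfolding a b legendre_P2_def by algebra
    finally show "F z * integral {0..2*pi} (\<lambda>\<beta>. legendre_P2 (\<zeta> * z - sqrt (1 - \<zeta>\<^sup>2) * sqrt (1 - z\<^sup>2) * cos \<beta>)) =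
       2 * pi * legendre_P2 \<zeta> * (F z * legendre_P2 z)"
      by (simp add: a_def b_def)
  qed
  finally show ?thesis by simp
qed

section \<open>The Newtonian kernel\<close>

text \<open>Law of cosines for points at radii r and s, seen from the origin under an angle with
  cosine t.\<close>

definition dist_sq :: "real \<Rightarrow> real \<Rightarrow> real \<Rightarrow> real" where
  "dist_sq r s t = r\<^sup>2 + s\<^sup>2 - 2 * r * s * t"

lemma dist_sq_ge:
  assumes "0 \<le> r" "0 \<le> s" "t \<in> {-1..1}"
  shows "(r - s)\<^sup>2 \<le> dist_sq r s t"
proof -
  have "r * s * t \<le> r * s * 1" using assms by (intro mult_left_mono) auto
  then show ?thesis by (simp add: dist_sq_def power2_eq_square algebra_simps)
qed

lemma dist_sq_pos:
  assumes "0 \<le> r" "0 \<le> s" "r \<noteq> s" "t \<in> {-1..1}"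
  shows "0 < dist_sq r s t"
  using dist_sq_ge[OF assms(1,2,4)] assms(3) by (smt (verit) zero_less_power2)

lemma DERIV_inverse_sqrt_dist_sq:
  assumes "0 < dist_sq r s t"
  shows "((\<lambda>t. 1 / sqrt (dist_sq r s t)) has_real_derivative (r * s / (dist_sq r s t * sqrt (dist_sq r s t)))) (at t)"
proof -
  have "((\<lambda>t. dist_sq r s t) has_real_derivative (- 2 * r * s)) (at t)"
    unfolding dist_sq_def by (auto intro!: derivative_eq_intros)
  note [derivative_intros] = this
  show ?thesis using assms
    by (auto intro!: derivative_eq_intros simp: field_simps)
qed

lemma DERIV_inverse_dist_sq:
  assumes "0 < dist_sq r s t"
  shows "((\<lambda>t. 1 / dist_sq r s t) has_real_derivative (2 * r * s / (dist_sq r s t)\<^sup>2)) (at t)"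
proof -
  have "((\<lambda>t. dist_sq r s t) has_real_derivative (- 2 * r * s)) (at t)"
    unfolding dist_sq_def by (auto intro!: derivative_eq_intros)
  note [derivative_intros] = this
  show ?thesis using assms
    by (auto intro!: derivative_eq_intros simp: field_simps power2_eq_square)
qed

lemma sqrt_dist_sq_ends:
  assumes "0 \<le> r" "0 \<le> s"
  shows "sqrt (dist_sq r s 1) = \<bar>r - s\<bar>" "sqrt (dist_sq r s (-1)) = r + s"
proof -
  have "dist_sq r s 1 = (r - s)\<^sup>2" "dist_sq r s (-1) = (r + s)\<^sup>2"
    by (simp_all add: dist_sq_def power2_eq_square algebra_simps)
  then show "sqrt (dist_sq r s 1) = \<bar>r - s\<bar>" "sqrt (dist_sq r s (-1)) = r + s"
    using assms by simp_all
qed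

text \<open>Newton's shell theorem. The antiderivative is
  \<open>- sqrt (dist_sq r s t) / (r * s)\<close>; the distances at the ends are \<bar>r - s\<bar>
  and r + s, and they differ by twice the smaller radius.\<close>

lemma integral_inverse_sqrt_dist_sq:
  assumes "0 \<le> r" "0 < s" "r \<noteq> s"
  shows "integral {-1..1} (\<lambda>t. 1 / sqrt (dist_sq r s t)) = 2 / max r s"
proof (cases "r = 0")
  case True
  then show ?thesis using assms by (simp add: dist_sq_def)
next
  case False
  have "((\<lambda>t. 1 / sqrt (dist_sq r s t)) has_integral
     (- sqrt (dist_sq r s 1) / (r * s) - - sqrt (dist_sq r s (-1)) / (r * s))) {-1..1}"
  proof (rule fundamental_theorem_of_calculus)
    fix t :: real assume t: "t \<in> {-1..1}"
    have "dist_sq r s t > 0" using dist_sq_pos[OF _ _ _ t, of r s] assms by auto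
    moreover have "((\<lambda>t. dist_sq r s t) has_real_derivative (- 2 * r * s)) (at t)"
      unfolding dist_sq_def by (auto intro!: derivative_eq_intros)
    note [derivative_intros] = this
    ultimately have "((\<lambda>t. - sqrt (dist_sq r s t) / (r * s)) has_real_derivative 1 / sqrt (dist_sq r s t)) (at t)"
      using assms False by (auto intro!: derivative_eq_intros simp: field_simps)
    then show "((\<lambda>t. - sqrt (dist_sq r s t) / (r * s)) has_vector_derivative 1 / sqrt (dist_sq r s t)) (at t within {-1..1})"
      by (simp add: has_real_derivative_iff_has_vector_derivative has_vector_derivative_at_within)
  qed auto
  from integral_unique[OF this]
  have "integral {-1..1} (\<lambda>t. 1 / sqrt (dist_sq r s t)) = - \<bar>r - s\<bar> / (r * s) - - (r + s) / (r * s)"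
    using assms by (simp only: sqrt_dist_sq_ends less_imp_le)
  also have "\<dots> = 2 / max r s"
    using assms False by (auto simp: max_def field_simps)
  finally show ?thesis .
qed

text \<open>Degree-two coefficient of the Legendre expansion of the inverse distance. The distance q
  itself serves as integration variable: t is a quadratic polynomial in q and the factor 1/q cancels
  against dt, so a polynomial in q remains.\<close>

lemma integral_inverse_sqrt_dist_sq_P2:
  assumes "0 \<le> r" "0 < s" "r \<noteq> s"
  shows "integral {-1..1} (\<lambda>t. 1 / sqrt (dist_sq r s t) * legendre_P2 t) = 2/5 * (min r s)\<^sup>2 / (max r s) ^ 3"
proof (cases "r = 0")
  case True
  have "((\<lambda>t. legendre_P2 t / s) has_integral ((1 ^ 3 - 1) / (2 * s) - ((-1) ^ 3 - (-1)) / (2 * s))) {-1..1}"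
    by (rule fundamental_theorem_of_calculus)
       (use assms in \<open>auto simp: legendre_P2_def has_real_derivative_iff_has_vector_derivative[symmetric] field_simps intro!: derivative_eq_intros\<close>)
  from integral_unique[OF this] show ?thesis using True assms by (simp add: dist_sq_def)
next
  case False
  define A where "A = r\<^sup>2 + s\<^sup>2"
  define B where "B = 2 * r * s"
  have B: "B > 0" using False assms by (auto simp: B_def)
  \<comment> \<open>Antiderivative in the variable \<open>q = sqrt (dist_sq r s t)\<close>, with
    \<open>t = (A - q\<^sup>2) / B\<close> inserted into \<open>legendre_P2\<close>.\<close>
  define \<Phi> where "\<Phi> = (\<lambda>q. - 2 / B * (3/2 * (A\<^sup>2 * q - 2 * A * q ^ 3 / 3 + q ^ 5 / 5) / B\<^sup>2 - q / 2))"
  have "((\<lambda>t. 1 / sqrt (dist_sq r s t) * legendre_P2 t) has_integral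
     (\<Phi> (sqrt (dist_sq r s 1)) - \<Phi> (sqrt (dist_sq r s (-1))))) {-1..1}"
  proof (rule fundamental_theorem_of_calculus)
    fix t :: real assume t: "t \<in> {-1..1}"
    define q where "q = sqrt (dist_sq r s t)"
    have d: "dist_sq r s t > 0" using dist_sq_pos[OF _ _ _ t, of r s] assms by auto
    then have q: "q > 0" "q\<^sup>2 = A - B * t" by (auto simp: q_def A_def B_def dist_sq_def)
    then have t_eq: "t = (A - q\<^sup>2) / B" using B by (simp add: field_simps)
    have "((\<lambda>t. dist_sq r s t) has_real_derivative - B) (at t)"
      unfolding dist_sq_def B_def by (auto intro!: derivative_eq_intros)
    then have 1: "((\<lambda>t. sqrt (dist_sq r s t)) has_real_derivative (- B / (2 * q))) (at t)"
      using d by (auto simp: q_def field_simps intro!: derivative_eq_intros)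
    have 2: "(\<Phi> has_real_derivative (- 2 / B * (3/2 * (A\<^sup>2 - 2 * A * q\<^sup>2 + q ^ 4) / B\<^sup>2 - 1 / 2))) (at (sqrt (dist_sq r s t)))"
      unfolding \<Phi>_def q_def[symmetric] using B
      by (auto intro!: derivative_eq_intros simp: field_simps power2_eq_square)
    have "(- 2 / B * (3/2 * (A\<^sup>2 - 2 * A * q\<^sup>2 + q ^ 4) / B\<^sup>2 - 1 / 2)) * (- B / (2 * q)) = 1 / q * legendre_P2 t"
      unfolding t_eq legendre_P2_def using B q(1) by (simp add: field_simps power2_eq_square power4_eq_xxxx)
    with DERIV_chain2[OF 2 1]
    have "((\<lambda>t. \<Phi> (sqrt (dist_sq r s t))) has_real_derivative 1 / q * legendre_P2 t) (at t)" by simp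
    then show "((\<lambda>t. \<Phi> (sqrt (dist_sq r s t))) has_vector_derivative 1 / sqrt (dist_sq r s t) * legendre_P2 t) (at t within {-1..1})"
      by (simp add: has_real_derivative_iff_has_vector_derivative has_vector_derivative_at_within q_def)
  qed auto
  then have "integral {-1..1} (\<lambda>t. 1 / sqrt (dist_sq r s t) * legendre_P2 t) = \<Phi> \<bar>r - s\<bar> - \<Phi> (r + s)"
    using assms by (simp only: integral_unique sqrt_dist_sq_ends less_imp_le)
  also have "\<dots> = 2/5 * (min r s)\<^sup>2 / (max r s) ^ 3"
  proof -
    define N where "N = (\<lambda>q. 15 * A\<^sup>2 * q - 10 * A * q ^ 3 + 3 * q ^ 5 - 5 * B\<^sup>2 * q)"
    have \<Phi>: "\<Phi> q = - N q / (5 * B ^ 3)" for q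
      using B by (simp add: \<Phi>_def N_def field_simps power2_eq_square power3_eq_cube)
    show ?thesis
    proof (cases "r < s")
      case True
      have "N (r + s) - N (s - r) = 16 * r ^ 5"
        unfolding N_def A_def B_def by algebra
      then have "\<Phi> (s - r) - \<Phi> (r + s) = 16 * r ^ 5 / (5 * (2 * r * s) ^ 3)"
        unfolding \<Phi> B_def by (simp add: diff_divide_distrib[symmetric])
      also have "\<dots> = 2/5 * r\<^sup>2 / s ^ 3"
        using False assms by (simp add: power_mult_distrib field_simps eval_nat_numeral)
      finally show ?thesis using True by (simp add: min_def max_def abs_if)
    next
      case F: False
      have "N (r + s) - N (r - s) = 16 * s ^ 5"
        unfolding N_def A_def B_def by algebra
      then have "\<Phi> (r - s) - \<Phi> (r + s) = 16 * s ^ 5 / (5 * (2 * r * s) ^ 3)"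
        unfolding \<Phi> B_def by (simp add: diff_divide_distrib[symmetric])
      also have "\<dots> = 2/5 * s\<^sup>2 / r ^ 3"
        using False assms by (simp add: power_mult_distrib field_simps eval_nat_numeral)
      finally show ?thesis using F assms by (simp add: min_def max_def abs_if)
    qed
  qed
  finally show ?thesis .
qed

text \<open>Averaging the inverse square leaves only a logarithmic singularity at r = s; its
  integrability in s is what makes potentials Lipschitz in the radius.\<close>

lemma integral_inverse_dist_sq:
  assumes "0 < r" "0 < s" "r \<noteq> s"
  shows "integral {-1..1} (\<lambda>t. 1 / dist_sq r s t) = ln ((r + s) / \<bar>r - s\<bar>) / (r * s)"
proof -
  have "((\<lambda>t. 1 / dist_sq r s t) has_integral
     (- ln (dist_sq r s 1) / (2 * r * s) - - ln (dist_sq r s (-1)) / (2 * r * s))) {-1..1}"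
  proof (rule fundamental_theorem_of_calculus)
    fix t :: real assume t: "t \<in> {-1..1}"
    have "dist_sq r s t > 0" using dist_sq_pos[OF _ _ _ t, of r s] assms by auto
    moreover have "((\<lambda>t. dist_sq r s t) has_real_derivative (- 2 * r * s)) (at t)"
      unfolding dist_sq_def by (auto intro!: derivative_eq_intros)
    note [derivative_intros] = this
    ultimately have "((\<lambda>t. - ln (dist_sq r s t) / (2 * r * s)) has_real_derivative 1 / dist_sq r s t) (at t)"
      using assms by (auto intro!: derivative_eq_intros simp: field_simps)
    then show "((\<lambda>t. - ln (dist_sq r s t) / (2 * r * s)) has_vector_derivative 1 / dist_sq r s t) (at t within {-1..1})"
      by (simp add: has_real_derivative_iff_has_vector_derivative has_vector_derivative_at_within)
  qed auto
  moreover have "dist_sq r s 1 = \<bar>r - s\<bar>\<^sup>2" "dist_sq r s (-1) = (r + s)\<^sup>2"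
    by (simp_all add: dist_sq_def power2_eq_square algebra_simps)
  then have "ln (dist_sq r s 1) = 2 * ln \<bar>r - s\<bar>" "ln (dist_sq r s (-1)) = 2 * ln (r + s)"
    using assms by (simp_all only: ln_realpow)
  ultimately have "integral {-1..1} (\<lambda>t. 1 / dist_sq r s t) = - (2 * ln \<bar>r - s\<bar>) / (2 * r * s) - - (2 * ln (r + s)) / (2 * r * s)"
    by (simp only: integral_unique)
  also have "\<dots> = (ln (r + s) - ln \<bar>r - s\<bar>) / (r * s)" using assms by (simp add: field_simps)
  also have "\<dots> = ln ((r + s) / \<bar>r - s\<bar>) / (r * s)" using assms by (simp add: ln_div)
  finally show ?thesis .
qed

text \<open>Longitude integral of the inverse squared distance, the majorant for differences of
  \<open>kernel_K\<close> between two radii.\<close>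

definition kernel_sq :: "real \<Rightarrow> real \<Rightarrow> real \<Rightarrow> real \<Rightarrow> real" where
  "kernel_sq r \<zeta> s z = integral {0..2*pi} (\<lambda>\<beta>. 1 / dist_sq r s (zonal_arg \<zeta> z \<beta>))"

section \<open>Kernel averages over a sphere not passing through the field point\<close>

context
  fixes r s \<zeta> :: real
  assumes r: "0 \<le> r" and s: "0 < s" and rs: "r \<noteq> s" and \<zeta>: "\<zeta> \<in> {-1..1}"
begin

lemma dist_sq_pos': "t \<in> {-1..1} \<Longrightarrow> 0 < dist_sq r s t"
  using dist_sq_pos r s rs by auto

lemma continuous_on_dist_sq: "continuous_on S f \<Longrightarrow> continuous_on S (\<lambda>w. dist_sq r s (f w))"
  unfolding dist_sq_def by (intro continuous_intros)

lemma continuous_on_inverse_sqrt_dist_sq: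
  "continuous_on {-1..1} (\<lambda>t. 1 / sqrt (dist_sq r s t))"
  "continuous_on {-1..1} (\<lambda>t. r * s / (dist_sq r s t * sqrt (dist_sq r s t)))"
  "continuous_on {-1..1} (\<lambda>t. 1 / dist_sq r s t)"
  "continuous_on {-1..1} (\<lambda>t. 2 * r * s / (dist_sq r s t)\<^sup>2)"
  by (intro continuous_intros continuous_on_dist_sq; use dist_sq_pos' in \<open>force simp del: atLeastAtMost_iff\<close>)+

lemma kernel_K_eq_integral:
  assumes "z \<in> {-1..1}"
  shows "kernel_K r \<zeta> s z = integral {0..2*pi} (\<lambda>\<beta>. 1 / sqrt (dist_sq r s (zonal_arg \<zeta> z \<beta>)))"
  unfolding kernel_K_def zonal_arg_def[symmetric] dist_sq_def[symmetric]
proof (rule set_borel_integral_eq_integral, rule borel_integrable_atLeastAtMost')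
  show "continuous_on {0..2*pi} (\<lambda>\<beta>. 1 / sqrt (dist_sq r s (zonal_arg \<zeta> z \<beta>)))"
    by (rule continuous_on_compose2[OF continuous_on_inverse_sqrt_dist_sq(1)])
       (use assms \<zeta> in \<open>auto intro!: continuous_intros zonal_arg_mem simp del: atLeastAtMost_iff\<close>)
qed

lemma continuous_on_kernel: "continuous_on {-1..1} (kernel_K r \<zeta> s)" "continuous_on {-1..1} (kernel_sq r \<zeta> s)"
proof -
  show "continuous_on {-1..1} (kernel_K r \<zeta> s)"
    by (rule iffD2[OF continuous_on_cong[OF refl kernel_K_eq_integral]
        continuous_on_zonal_integral[OF continuous_on_inverse_sqrt_dist_sq(1) \<zeta>]])
  show "continuous_on {-1..1} (kernel_sq r \<zeta> s)"
    unfolding kernel_sq_def[abs_def]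
    by (rule continuous_on_zonal_integral[OF continuous_on_inverse_sqrt_dist_sq(3) \<zeta>])
qed

lemma integral_kernel_K: "integral {-1..1} (kernel_K r \<zeta> s) = 4 * pi / max r s"
proof -
  have "integral {-1..1} (kernel_K r \<zeta> s) = integral {-1..1} (\<lambda>z. integral {0..2*pi} (\<lambda>\<beta>. 1 / sqrt (dist_sq r s (zonal_arg \<zeta> z \<beta>))))"
    by (rule Henstock_Kurzweil_Integration.integral_cong) (simp add: kernel_K_eq_integral)
  also have "\<dots> = 2 * pi * integral {-1..1} (\<lambda>t. 1 / sqrt (dist_sq r s t))"
    by (rule zonal_integral[OF DERIV_inverse_sqrt_dist_sq[OF dist_sq_pos'] continuous_on_inverse_sqrt_dist_sq(2) \<zeta>])
  finally show ?thesis using integral_inverse_sqrt_dist_sq[OF r s rs] by simp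
qed

lemma integral_kernel_K_P2: "integral {-1..1} (\<lambda>z. kernel_K r \<zeta> s z * legendre_P2 z) =
    4 * pi / 5 * ((min r s)\<^sup>2 / (max r s) ^ 3) * legendre_P2 \<zeta>"
proof -
  have "integral {-1..1} (\<lambda>z. kernel_K r \<zeta> s z * legendre_P2 z) =
     integral {-1..1} (\<lambda>z. integral {0..2*pi} (\<lambda>\<beta>. 1 / sqrt (dist_sq r s (zonal_arg \<zeta> z \<beta>))) * legendre_P2 z)"
    by (rule Henstock_Kurzweil_Integration.integral_cong) (simp add: kernel_K_eq_integral)
  also have "\<dots> = 2 * pi * legendre_P2 \<zeta> * integral {-1..1} (\<lambda>t. 1 / sqrt (dist_sq r s t) * legendre_P2 t)"
    by (rule zonal_integral_P2[OF DERIV_inverse_sqrt_dist_sq[OF dist_sq_pos'] continuous_on_inverse_sqrt_dist_sq(2) \<zeta>])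
  finally show ?thesis unfolding integral_inverse_sqrt_dist_sq_P2[OF r s rs] by simp
qed

lemma integral_kernel_sq:
  assumes "0 < r"
  shows "integral {-1..1} (kernel_sq r \<zeta> s) = 2 * pi * ln ((r + s) / \<bar>r - s\<bar>) / (r * s)"
proof -
  have "integral {-1..1} (kernel_sq r \<zeta> s) = 2 * pi * integral {-1..1} (\<lambda>t. 1 / dist_sq r s t)"
    unfolding kernel_sq_def[abs_def]
    by (rule zonal_integral[OF DERIV_inverse_dist_sq[OF dist_sq_pos'] continuous_on_inverse_sqrt_dist_sq(4) \<zeta>])
  then show ?thesis using integral_inverse_dist_sq[OF assms s rs] by simp
qed

end

section \<open>Integrals against singular kernels\<close>

lemma kernel_K_measurable:
  "(\<lambda>p. kernel_K r \<zeta> (fst p) (snd p)) \<in> borel_measurable (lborel \<Otimes>\<^sub>M lborel)"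
  unfolding kernel_K_def set_lebesgue_integral_def by measurable

text \<open>One L1 bound of the kernel, area weight included, serves both Fubini and the sup-norm
  estimates for continuous densities. Pairs are ordered (s, z), radius first.\<close>

definition kernel_integral_le :: "real \<Rightarrow> (real \<Rightarrow> real \<Rightarrow> real) \<Rightarrow> real \<Rightarrow> bool" where
  "kernel_integral_le R k c \<longleftrightarrow>
     integrable (lborel \<Otimes>\<^sub>M lborel) (\<lambda>p. indicator (dom_E R) p * k (fst p) (snd p)) \<and>
     (LINT p|(lborel \<Otimes>\<^sub>M lborel). \<bar>indicator (dom_E R) p * k (fst p) (snd p)\<bar>) \<le> c"

text \<open>Tonelli with z integrated first, since the integrals over spheres are the ones under
  control; the exceptional radii \<open>N\<close>, where the kernel may be singular, form a null
  set.\<close>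

lemma kernel_integral_leI:
  assumes [measurable]: "(\<lambda>p. k (fst p) (snd p)) \<in> borel_measurable (lborel \<Otimes>\<^sub>M lborel)"
    and N: "finite N"
    and cont: "\<And>s. s \<in> {0..R} - N \<Longrightarrow> continuous_on {-1..1} (k s)"
    and bd: "\<And>s. s \<in> {0..R} - N \<Longrightarrow> integral {-1..1} (\<lambda>z. \<bar>k s z\<bar>) \<le> b s"
    and b: "(b has_integral c) {0..R}" "\<And>s. s \<in> {0..R} \<Longrightarrow> 0 \<le> b s"
  shows "kernel_integral_le R k c"
proof -
  let ?M = "lborel \<Otimes>\<^sub>M lborel :: (real \<times> real) measure"
  let ?f = "\<lambda>p. indicator (dom_E R) p * k (fst p) (snd p)"
  have [measurable]: "dom_E R \<in> sets ?M" by measurable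
  have [measurable]: "?f \<in> borel_measurable ?M" by measurable
  have "(\<integral>\<^sup>+p. ennreal \<bar>?f p\<bar> \<partial>?M) = (\<integral>\<^sup>+s. \<integral>\<^sup>+z. ennreal \<bar>?f (s, z)\<bar> \<partial>lborel \<partial>lborel)"
    by (rule lborel.nn_integral_fst[symmetric]) measurable
  also have "\<dots> \<le> (\<integral>\<^sup>+s. ennreal (b s) * indicator {0..R} s \<partial>lborel)"
  proof (rule nn_integral_mono_AE)
    have "AE s in lborel. s \<notin> N"
      by (rule AE_not_in) (use N in \<open>auto intro: finite_imp_null_set_lborel\<close>)
    then show "AE s in lborel. (\<integral>\<^sup>+z. ennreal \<bar>?f (s, z)\<bar> \<partial>lborel) \<le> ennreal (b s) * indicator {0..R} s"
    proof eventually_elim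
      case (elim s)
      show ?case
      proof (cases "s \<in> {0..R}")
        case True
        have "((\<lambda>z. \<bar>k s z\<bar>) has_integral integral {-1..1} (\<lambda>z. \<bar>k s z\<bar>)) {-1..1}"
          using cont[of s] True elim
          by (intro integrable_integral integrable_continuous_interval continuous_intros) auto
        from nn_integral_has_integral_lebesgue'[OF _ this]
        have "(\<integral>\<^sup>+z. ennreal \<bar>k s z\<bar> * indicator {-1..1} z \<partial>lborel) = ennreal (integral {-1..1} (\<lambda>z. \<bar>k s z\<bar>))"
          by simp
        moreover have "(\<integral>\<^sup>+z. ennreal \<bar>?f (s, z)\<bar> \<partial>lborel) = (\<integral>\<^sup>+z. ennreal \<bar>k s z\<bar> * indicator {-1..1} z \<partial>lborel)"
          using True by (intro nn_integral_cong) (auto split: split_indicator)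
        ultimately show ?thesis using bd[of s] True elim by (auto intro!: ennreal_leI)
      qed (auto simp: indicator_def)
    qed
  qed
  also have "\<dots> = ennreal c" by (rule nn_integral_has_integral_lebesgue'[OF b(2,1)])
  finally have le: "(\<integral>\<^sup>+p. ennreal \<bar>?f p\<bar> \<partial>?M) \<le> ennreal c" .
  have c0: "0 \<le> c" by (rule has_integral_nonneg[OF b])
  have "integrable ?M ?f"
    by (rule integrableI_bounded) (use le in \<open>auto simp: le_less_trans\<close>)
  moreover have "(LINT p|?M. \<bar>?f p\<bar>) = enn2real (\<integral>\<^sup>+p. ennreal \<bar>?f p\<bar> \<partial>?M)"
    by (rule integral_eq_nn_integral) auto
  moreover have "\<dots> \<le> c" using le c0 by (metis enn2real_leI)
  ultimately show ?thesis by (simp add: kernel_integral_le_def)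
qed

text \<open>A single integral over the product measure, for which linearity and bounds are
  immediate; the iterated integrals of \<open>op_G\<close> are compared with it in
  \<open>wint_iterated\<close>.\<close>

definition wint :: "real \<Rightarrow> (real \<Rightarrow> real \<Rightarrow> real) \<Rightarrow> (real \<times> real \<Rightarrow> real) \<Rightarrow> real" where
  "wint R k v = (LINT p|(lborel \<Otimes>\<^sub>M lborel). indicator (dom_E R) p * k (fst p) (snd p) * v p)"

lemma continuous_on_dom_bounded:
  assumes "continuous_on (dom_E R) v" "0 \<le> R"
  obtains V where "0 \<le> V" "\<And>p. p \<in> dom_E R \<Longrightarrow> \<bar>v p :: real\<bar> \<le> V"
proof -
  have "compact (dom_E R)" by (intro compact_Times compact_Icc)
  then have "bounded (v ` dom_E R)" by (intro compact_imp_bounded compact_continuous_image assms)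
  then obtain V where "\<And>p. p \<in> dom_E R \<Longrightarrow> \<bar>v p\<bar> \<le> V" by (auto simp: bounded_iff)
  with that[of "max 0 V"] show thesis by force
qed

lemma wint_integrable:
  assumes k: "kernel_integral_le R k c" and v: "continuous_on (dom_E R) v" and R: "0 \<le> R"
  shows "integrable (lborel \<Otimes>\<^sub>M lborel) (\<lambda>p. indicator (dom_E R) p * k (fst p) (snd p) * v p)"
proof -
  obtain V where V: "0 \<le> V" "\<And>p. p \<in> dom_E R \<Longrightarrow> \<bar>v p\<bar> \<le> V"
    using continuous_on_dom_bounded[OF v R] by blast
  have [measurable]: "(\<lambda>p. indicator (dom_E R) p *\<^sub>R v p) \<in> borel_measurable (lborel \<Otimes>\<^sub>M lborel)"
    unfolding lborel_prod
    using borel_measurable_continuous_on_indicator[OF borel_closed v] by (simp add: closed_Times)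
  have [measurable]: "(\<lambda>p. indicator (dom_E R) p * k (fst p) (snd p)) \<in> borel_measurable (lborel \<Otimes>\<^sub>M lborel)"
    using k by (auto simp: kernel_integral_le_def)
  \<comment> \<open>The indicator is idempotent; its second copy turns \<open>v\<close>, continuous
    on the rectangle only, into a globally measurable function.\<close>
  have eq: "indicator (dom_E R) p * k (fst p) (snd p) * v p =
      (indicator (dom_E R) p * k (fst p) (snd p)) * (indicator (dom_E R) p *\<^sub>R v p)" for p
    by (auto split: split_indicator)
  have "integrable (lborel \<Otimes>\<^sub>M lborel) (\<lambda>p. V * (indicator (dom_E R) p * k (fst p) (snd p)))"
    using k by (auto simp: kernel_integral_le_def)
  then show ?thesis
  proof (rule Bochner_Integration.integrable_bound)
    show "AE p in lborel \<Otimes>\<^sub>M lborel. norm (indicator (dom_E R) p * k (fst p) (snd p) * v p)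
        \<le> norm (V * (indicator (dom_E R) p * k (fst p) (snd p)))"
      using V by (intro AE_I2) (auto simp: abs_mult mult.commute[of V] intro!: mult_left_mono split: split_indicator)
  qed (unfold eq, measurable)
qed

text \<open>The first order of integration is that of \<open>op_G\<close> and \<open>op_DG\<close>;
  the second has the angular integral inside, where the shell formulas apply.\<close>

lemma wint_iterated:
  assumes k: "kernel_integral_le R k c" and v: "continuous_on (dom_E R) v" and R: "0 \<le> R"
  shows "(LBINT z:{-1..1}. LBINT s:{0..R}. k s z * v (s, z)) = wint R k v"
    and "(LBINT s:{0..R}. LBINT z:{-1..1}. k s z * v (s, z)) = wint R k v"
proof -
  let ?f = "\<lambda>s z. indicator (dom_E R) (s, z) * k s z * v (s, z)"
  have int: "integrable (lborel \<Otimes>\<^sub>M lborel) (case_prod ?f)"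
    using wint_integrable[OF assms] by (simp add: case_prod_unfold)
  have eq: "wint R k v = integral\<^sup>L (lborel \<Otimes>\<^sub>M lborel) (case_prod ?f)"
    by (simp add: wint_def case_prod_unfold)
  have "(LBINT z:{-1..1}. LBINT s:{0..R}. k s z * v (s, z)) = (LBINT z. LBINT s. ?f s z)"
    unfolding set_lebesgue_integral_def
    by (intro Bochner_Integration.integral_cong refl)
       (auto split: split_indicator simp: indicator_times intro!: Bochner_Integration.integral_cong)
  then show "(LBINT z:{-1..1}. LBINT s:{0..R}. k s z * v (s, z)) = wint R k v"
    unfolding eq lborel_pair.integral_snd[OF int, symmetric] .
  have "(LBINT s:{0..R}. LBINT z:{-1..1}. k s z * v (s, z)) = (LBINT s. LBINT z. ?f s z)"
    unfolding set_lebesgue_integral_def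
    by (intro Bochner_Integration.integral_cong refl)
       (auto split: split_indicator simp: indicator_times intro!: Bochner_Integration.integral_cong)
  then show "(LBINT s:{0..R}. LBINT z:{-1..1}. k s z * v (s, z)) = wint R k v"
    unfolding eq lborel_pair.integral_fst[OF int, symmetric] .
qed

lemma wint_add:
  assumes "kernel_integral_le R k c" "continuous_on (dom_E R) v" "continuous_on (dom_E R) w" "0 \<le> R"
  shows "wint R k (\<lambda>p. v p + w p) = wint R k v + wint R k w"
  unfolding wint_def distrib_left
  by (intro Bochner_Integration.integral_add wint_integrable[OF assms(1)] assms)

lemma wint_scale: "wint R k (\<lambda>p. a * v p) = a * wint R k v"
proof -
  have "wint R k (\<lambda>p. a * v p) = (LINT p|(lborel \<Otimes>\<^sub>M lborel). a * (indicator (dom_E R) p * k (fst p) (snd p) * v p))"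
    unfolding wint_def by (rule arg_cong[where f = "integral\<^sup>L _"]) auto
  then show ?thesis by (simp add: wint_def)
qed

lemma wint_cong:
  assumes "\<And>p. p \<in> dom_E R \<Longrightarrow> v p = w p"
  shows "wint R k v = wint R k w"
  unfolding wint_def using assms
  by (intro Bochner_Integration.integral_cong refl) (auto split: split_indicator)

lemma wint_kernel_diff:
  assumes "kernel_integral_le R k c" "kernel_integral_le R k' c'" "continuous_on (dom_E R) v" "0 \<le> R"
  shows "wint R (\<lambda>s z. k s z - k' s z) v = wint R k v - wint R k' v"
  unfolding wint_def right_diff_distrib left_diff_distrib
  by (intro Bochner_Integration.integral_diff wint_integrable[OF assms(1)] wint_integrable[OF assms(2)] assms)

lemma wint_bound:
  assumes k: "kernel_integral_le R k c" and v: "continuous_on (dom_E R) v" and R: "0 \<le> R"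
    and V: "\<And>p. p \<in> dom_E R \<Longrightarrow> \<bar>v p\<bar> \<le> V" "0 \<le> V"
  shows "\<bar>wint R k v\<bar> \<le> c * V"
proof -
  have ki: "integrable (lborel \<Otimes>\<^sub>M lborel) (\<lambda>p. \<bar>indicator (dom_E R) p * k (fst p) (snd p)\<bar>)"
    using k by (auto simp: kernel_integral_le_def)
  have "\<bar>wint R k v\<bar> \<le> (LINT p|(lborel \<Otimes>\<^sub>M lborel). \<bar>indicator (dom_E R) p * k (fst p) (snd p) * v p\<bar>)"
    unfolding wint_def by (rule integral_abs_bound)
  also have "\<dots> \<le> (LINT p|(lborel \<Otimes>\<^sub>M lborel). \<bar>indicator (dom_E R) p * k (fst p) (snd p)\<bar> * V)"
    using V by (intro integral_mono integrable_abs wint_integrable[OF k v R] integrable_mult_left ki)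
       (auto simp: abs_mult intro!: mult_left_mono split: split_indicator)
  also have "\<dots> = (LINT p|(lborel \<Otimes>\<^sub>M lborel). \<bar>indicator (dom_E R) p * k (fst p) (snd p)\<bar>) * V" by simp
  also have "\<dots> \<le> c * V" using k V by (intro mult_right_mono) (auto simp: kernel_integral_le_def)
  finally show ?thesis .
qed

text \<open>Reduction to one dimension: with the angle integrated first, the angular factor turns
  into the multiplier \<open>m\<close> for every radius outside the null set \<open>N\<close>.
  Continuity of \<open>m\<close> across \<open>N\<close> allows the remaining Lebesgue integral to
  be read as a gauge integral.\<close>

lemma wint_separated:
  assumes k: "kernel_integral_le R k c" and R: "0 \<le> R"
    and f: "continuous_on {0..R} f" and g: "continuous_on {-1..1} g"
    and N: "finite N"
    and cont: "\<And>s. s \<in> {0..R} - N \<Longrightarrow> continuous_on {-1..1} (k s)"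
    and int: "\<And>s. s \<in> {0..R} - N \<Longrightarrow> integral {-1..1} (\<lambda>z. k s z * g z) = m s"
    and m: "continuous_on {0..R} m"
  shows "wint R k (\<lambda>(s, z). f s * g z) = integral {0..R} (\<lambda>s. f s * m s)"
proof -
  have c: "continuous_on (dom_E R) (\<lambda>(s, z). f s * g z)"
    unfolding split_beta
    by (intro continuous_intros continuous_on_compose2[OF f] continuous_on_compose2[OF g]) auto
  have "wint R k (\<lambda>(s, z). f s * g z) = (LBINT s:{0..R}. LBINT z:{-1..1}. k s z * (f s * g z))"
    using wint_iterated(2)[OF k c R] by simp
  also have "\<dots> = (LBINT s:{0..R}. f s * m s)"
  proof -
    have AE: "AE s in lborel. s \<notin> N"
      by (rule AE_not_in) (use N in \<open>auto intro: finite_imp_null_set_lborel\<close>)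
    have eq: "(LBINT z:{-1..1}. k s z * (f s * g z)) = f s * m s" if "s \<in> {0..R} - N" for s
    proof -
      have "(LBINT z:{-1..1}. k s z * (f s * g z)) = integral {-1..1} (\<lambda>z. k s z * (f s * g z))"
        by (intro set_borel_integral_eq_integral borel_integrable_atLeastAtMost' continuous_intros cont that g)
      also have "\<dots> = integral {-1..1} (\<lambda>z. f s * (k s z * g z))"
        by (simp add: algebra_simps)
      also have "\<dots> = f s * m s" using int[OF that] by simp
      finally show ?thesis .
    qed
    have i: "integrable lborel (\<lambda>s. LBINT z. indicator (dom_E R) (s, z) * k s z * (f s * g z))"
      using lborel_pair.integrable_fst'[OF wint_integrable[OF k c R]] by simp
    have "(\<lambda>s. LBINT z. indicator (dom_E R) (s, z) * k s z * (f s * g z)) = (\<lambda>s. indicator {0..R} s *\<^sub>R (LBINT z:{-1..1}. k s z * (f s * g z)))"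
      unfolding set_lebesgue_integral_def
      by (auto split: split_indicator simp: fun_eq_iff intro!: Bochner_Integration.integral_cong)
    with i have i': "integrable lborel (\<lambda>s. indicator {0..R} s *\<^sub>R (LBINT z:{-1..1}. k s z * (f s * g z)))" by simp
    have i2: "integrable lborel (\<lambda>s. indicator {0..R} s *\<^sub>R (f s * m s))"
      using borel_integrable_atLeastAtMost'[of 0 R "\<lambda>s. f s * m s"] f m
      unfolding set_integrable_def by (auto intro!: continuous_intros)
    show ?thesis
      unfolding set_lebesgue_integral_def[of _ "{0..R}"]
      by (rule integral_cong_AE)
         (use i' i2 AE eq in \<open>auto split: split_indicator elim!: eventually_mono simp del: atLeastAtMost_iff\<close>)
  qed
  also have "\<dots> = integral {0..R} (\<lambda>s. f s * m s)"
    by (intro set_borel_integral_eq_integral borel_integrable_atLeastAtMost' continuous_intros f m)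
  finally show ?thesis .
qed

section \<open>The linear potential operator\<close>

lemma kernel_K_nonneg: "0 \<le> kernel_K r \<zeta> s z" if "0 \<le> r" "0 \<le> s" "\<zeta> \<in> {-1..1}" "z \<in> {-1..1}"
  unfolding kernel_K_def zonal_arg_def[symmetric] dist_sq_def[symmetric] set_lebesgue_integral_def
proof (rule Bochner_Integration.integral_nonneg)
  fix \<beta> :: real
  have "0 \<le> dist_sq r s (zonal_arg \<zeta> z \<beta>)"
    using dist_sq_ge[OF that(1,2) zonal_arg_mem[OF that(3,4)], of \<beta>] zero_le_power2[of "r - s"] by linarith
  then show "0 \<le> indicat_real {0..2 * pi} \<beta> *\<^sub>R (1 / sqrt (dist_sq r s (zonal_arg \<zeta> z \<beta>)))" by simp
qed

text \<open>The weight tames the singularity uniformly in r: the shell theorem gives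
  \<open>4 * pi * s\<^sup>2 / max r s\<close>, at most \<open>4 * pi * s\<close>, and this
  integrates to \<open>2 * pi * R\<^sup>2\<close>.\<close>

lemma kernel_integral_le_newton:
  assumes "0 \<le> r" "0 \<le> R" "\<zeta> \<in> {-1..1}"
  shows "kernel_integral_le R (\<lambda>s z. kernel_K r \<zeta> s z * s\<^sup>2) (2 * pi * R\<^sup>2)"
proof (rule kernel_integral_leI[where N = "{0, r}" and b = "\<lambda>s. 4 * pi * s"])
  show "(\<lambda>p. kernel_K r \<zeta> (fst p) (snd p) * (fst p)\<^sup>2) \<in> borel_measurable (lborel \<Otimes>\<^sub>M lborel)"
    using kernel_K_measurable[of r \<zeta>] by measurable
  show "continuous_on {-1..1} (\<lambda>z. kernel_K r \<zeta> s z * s\<^sup>2)" if "s \<in> {0..R} - {0, r}" for s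
    using that assms by (intro continuous_intros continuous_on_kernel) auto
  show "integral {-1..1} (\<lambda>z. \<bar>kernel_K r \<zeta> s z * s\<^sup>2\<bar>) \<le> 4 * pi * s" if s: "s \<in> {0..R} - {0, r}" for s
  proof -
    have "integral {-1..1} (\<lambda>z. \<bar>kernel_K r \<zeta> s z * s\<^sup>2\<bar>) = integral {-1..1} (\<lambda>z. kernel_K r \<zeta> s z * s\<^sup>2)"
      using kernel_K_nonneg[of r s \<zeta>] assms s
      by (intro Henstock_Kurzweil_Integration.integral_cong) (auto simp: abs_mult)
    also have "\<dots> = 4 * pi / max r s * s\<^sup>2"
      using integral_kernel_K[of r s \<zeta>] assms s by simp
    also have "\<dots> \<le> 4 * pi * s"
      using s assms by (auto simp: max_def field_simps power2_eq_square)
    finally show ?thesis .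
  qed
  have "((\<lambda>s. 4 * pi * s) has_integral (2 * pi * R\<^sup>2 - 2 * pi * 0\<^sup>2)) {0..R}"
    by (rule fundamental_theorem_of_calculus)
       (use assms in \<open>auto simp: has_real_derivative_iff_has_vector_derivative[symmetric] intro!: derivative_eq_intros\<close>)
  then show "((\<lambda>s. 4 * pi * s) has_integral (2 * pi * R\<^sup>2)) {0..R}" by simp
qed auto

lemma kernel_integral_le_id:
  assumes "0 \<le> R"
  shows "kernel_integral_le R (\<lambda>s z. s) (R\<^sup>2)"
proof (rule kernel_integral_leI[where N = "{}" and b = "\<lambda>s. 2 * s"])
  have "((\<lambda>s. 2 * s) has_integral (R\<^sup>2 - 0\<^sup>2)) {0..R}"
    by (rule fundamental_theorem_of_calculus)
       (use assms in \<open>auto simp: has_real_derivative_iff_has_vector_derivative[symmetric] intro!: derivative_eq_intros\<close>)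
  then show "((\<lambda>s. 2 * s) has_integral R\<^sup>2) {0..R}" by simp
qed auto

text \<open>Common linear part of \<open>op_G\<close> and \<open>op_DG\<close>. The subtracted term
  is the value of the Newtonian potential at the origin, so every such potential vanishes at r =
  0.\<close>

definition lin_pot :: "real \<Rightarrow> (real \<times> real \<Rightarrow> real) \<Rightarrow> real \<times> real \<Rightarrow> real" where
  "lin_pot R v = (\<lambda>(r, \<zeta>). 1 / (4 * pi) * wint R (\<lambda>s z. kernel_K r \<zeta> s z * s\<^sup>2) v - 1/2 * wint R (\<lambda>s z. s) v)"

lemma lin_pot_add:
  assumes "p \<in> dom_E R" "continuous_on (dom_E R) v" "continuous_on (dom_E R) w"
  shows "lin_pot R (\<lambda>p. v p + w p) p = lin_pot R v p + lin_pot R w p"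
  using assms unfolding lin_pot_def
  by (auto simp: wint_add[OF kernel_integral_le_newton] wint_add[OF kernel_integral_le_id] algebra_simps add_divide_distrib)

lemma lin_pot_scale: "lin_pot R (\<lambda>p. a * v p) p = a * lin_pot R v p"
  unfolding lin_pot_def by (auto simp: wint_scale split_beta algebra_simps)

lemma lin_pot_cong: "(\<And>p. p \<in> dom_E R \<Longrightarrow> v p = w p) \<Longrightarrow> lin_pot R v = lin_pot R w"
  unfolding lin_pot_def using wint_cong[of R v w] by (auto simp: fun_eq_iff)

lemma lin_pot_diff:
  assumes "p \<in> dom_E R" "continuous_on (dom_E R) v" "continuous_on (dom_E R) w"
  shows "lin_pot R (\<lambda>p. v p - w p) p = lin_pot R v p - lin_pot R w p"
  using lin_pot_add[OF assms(1,2), of "\<lambda>p. -1 * w p"] lin_pot_scale[of R "-1" w p] assms(3)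
  by (auto intro!: continuous_intros)

lemma lin_pot_bound:
  assumes p: "p \<in> dom_E R" and v: "continuous_on (dom_E R) v" and R: "0 \<le> R"
    and V: "\<And>p. p \<in> dom_E R \<Longrightarrow> \<bar>v p\<bar> \<le> V" "0 \<le> V"
  shows "\<bar>lin_pot R v p\<bar> \<le> R\<^sup>2 * V"
proof -
  obtain r \<zeta> where p_eq: "p = (r, \<zeta>)" by fastforce
  have r: "0 \<le> r" "\<zeta> \<in> {-1..1}" using p p_eq by auto
  have "\<bar>1 / (4 * pi) * wint R (\<lambda>s z. kernel_K r \<zeta> s z * s\<^sup>2) v\<bar> \<le> 1 / (4 * pi) * (2 * pi * R\<^sup>2 * V)"
    unfolding abs_mult using wint_bound[OF kernel_integral_le_newton[OF r(1) R r(2)] v R V]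
    by (intro mult_mono) auto
  moreover have "\<bar>1/2 * wint R (\<lambda>s z. s) v\<bar> \<le> 1/2 * (R\<^sup>2 * V)"
    unfolding abs_mult using wint_bound[OF kernel_integral_le_id[OF R] v R V]
    by (intro mult_mono) auto
  ultimately have "\<bar>lin_pot R v p\<bar> \<le> 1 / (4 * pi) * (2 * pi * R\<^sup>2 * V) + 1/2 * (R\<^sup>2 * V)"
    unfolding p_eq lin_pot_def prod.case by linarith
  then show ?thesis by (simp add: mult.commute)
qed

lemma lin_pot_radial:
  assumes r: "0 \<le> r" and \<zeta>: "\<zeta> \<in> {-1..1}" and R: "0 \<le> R" and f: "continuous_on {0..R} f"
  shows "lin_pot R (\<lambda>(s, z). f s) (r, \<zeta>) =
    integral {0..R} (\<lambda>s. f s * (s\<^sup>2 / max r s)) - integral {0..R} (\<lambda>s. f s * s)"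
proof -
  \<comment> \<open>At r = 0 the multiplier is proportional to s; the convention
    \<open>0 / 0 = 0\<close> gives the right value at s = 0.\<close>
  have m: "continuous_on {0..R} (\<lambda>s. 4 * pi * (s\<^sup>2 / max r s))"
  proof (cases "r = 0")
    case True
    then have "continuous_on {0..R} (\<lambda>s. 4 * pi * (s\<^sup>2 / max r s)) = continuous_on {0..R} (\<lambda>s. 4 * pi * s)"
      by (intro continuous_on_cong) (auto simp: power2_eq_square)
    then show ?thesis by (auto intro!: continuous_intros)
  qed (use r in \<open>auto intro!: continuous_intros\<close>)
  have "wint R (\<lambda>s z. kernel_K r \<zeta> s z * s\<^sup>2) (\<lambda>(s, z). f s * 1) = integral {0..R} (\<lambda>s. f s * (4 * pi * (s\<^sup>2 / max r s)))"
  proof (rule wint_separated[OF kernel_integral_le_newton[OF r R \<zeta>] R f _ _ _ _ m, where N = "{0, r}"])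
    fix s assume s: "s \<in> {0..R} - {0, r}"
    then show "continuous_on {-1..1} (\<lambda>z. kernel_K r \<zeta> s z * s\<^sup>2)"
      using r \<zeta> by (intro continuous_intros continuous_on_kernel) auto
    show "integral {-1..1} (\<lambda>z. kernel_K r \<zeta> s z * s\<^sup>2 * 1) = 4 * pi * (s\<^sup>2 / max r s)"
      using integral_kernel_K[of r s \<zeta>] r \<zeta> s by simp
  qed auto
  moreover have "wint R (\<lambda>s z. s) (\<lambda>(s, z). f s * 1) = integral {0..R} (\<lambda>s. f s * (2 * s))"
    by (rule wint_separated[OF kernel_integral_le_id[OF R] R f, where N = "{}"]) (auto intro!: continuous_intros)
  moreover have "integral {0..R} (\<lambda>s. f s * (4 * pi * (s\<^sup>2 / max r s))) = 4 * pi * integral {0..R} (\<lambda>s. f s * (s\<^sup>2 / max r s))"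
    by (subst Henstock_Kurzweil_Integration.integral_mult_right[symmetric]) (simp add: mult_ac)
  moreover have "integral {0..R} (\<lambda>s. f s * (2 * s)) = 2 * integral {0..R} (\<lambda>s. f s * s)"
    by (subst Henstock_Kurzweil_Integration.integral_mult_right[symmetric]) (simp add: mult_ac)
  ultimately show ?thesis by (simp add: lin_pot_def)
qed

lemma integral_legendre_P2: "integral {-1..1} legendre_P2 = 0"
proof -
  have "(legendre_P2 has_integral ((1 ^ 3 - 1) / 2 - ((-1) ^ 3 - (-1)) / 2)) {-1..1}"
    by (rule fundamental_theorem_of_calculus)
       (auto simp: legendre_P2_def has_real_derivative_iff_has_vector_derivative[symmetric] field_simps intro!: derivative_eq_intros)
  then show ?thesis by (simp add: integral_unique)
qed

text \<open>The constant subtracted in \<open>lin_pot\<close> disappears because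
  \<open>legendre_P2\<close> has mean zero; 1/5 is the factor \<open>4 * pi / 5\<close> of the
  degree-two average divided by \<open>4 * pi\<close>.\<close>

lemma lin_pot_P2:
  assumes r: "0 \<le> r" and \<zeta>: "\<zeta> \<in> {-1..1}" and R: "0 \<le> R" and f: "continuous_on {0..R} f"
  shows "lin_pot R (\<lambda>(s, z). f s * legendre_P2 z) (r, \<zeta>) =
    1/5 * legendre_P2 \<zeta> * integral {0..R} (\<lambda>s. f s * (s\<^sup>2 * (min r s)\<^sup>2 / max r s ^ 3))"
proof -
  have P: "continuous_on {-1..1} legendre_P2" unfolding legendre_P2_def by (intro continuous_intros)
  have m: "continuous_on {0..R} (\<lambda>s. 4 * pi / 5 * legendre_P2 \<zeta> * (s\<^sup>2 * (min r s)\<^sup>2 / max r s ^ 3))"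
  proof (cases "r = 0")
    case True
    then have "continuous_on {0..R} (\<lambda>s. 4 * pi / 5 * legendre_P2 \<zeta> * (s\<^sup>2 * (min r s)\<^sup>2 / max r s ^ 3)) = continuous_on {0..R} (\<lambda>s. 0 :: real)"
      by (intro continuous_on_cong) (auto simp: min_def)
    then show ?thesis by (auto intro!: continuous_intros)
  qed (use r in \<open>auto intro!: continuous_intros\<close>)
  have "wint R (\<lambda>s z. kernel_K r \<zeta> s z * s\<^sup>2) (\<lambda>(s, z). f s * legendre_P2 z) =
      integral {0..R} (\<lambda>s. f s * (4 * pi / 5 * legendre_P2 \<zeta> * (s\<^sup>2 * (min r s)\<^sup>2 / max r s ^ 3)))"
  proof (rule wint_separated[OF kernel_integral_le_newton[OF r R \<zeta>] R f P _ _ _ m, where N = "{0, r}"])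
    fix s assume s: "s \<in> {0..R} - {0, r}"
    then show "continuous_on {-1..1} (\<lambda>z. kernel_K r \<zeta> s z * s\<^sup>2)"
      using r \<zeta> by (intro continuous_intros continuous_on_kernel) auto
    have "integral {-1..1} (\<lambda>z. kernel_K r \<zeta> s z * s\<^sup>2 * legendre_P2 z) = integral {-1..1} (\<lambda>z. s\<^sup>2 * (kernel_K r \<zeta> s z * legendre_P2 z))"
      by (simp add: mult_ac)
    also have "\<dots> = s\<^sup>2 * (4 * pi / 5 * ((min r s)\<^sup>2 / (max r s) ^ 3) * legendre_P2 \<zeta>)"
      using integral_kernel_K_P2[of r s \<zeta>] r \<zeta> s by simp
    finally show "integral {-1..1} (\<lambda>z. kernel_K r \<zeta> s z * s\<^sup>2 * legendre_P2 z) = 4 * pi / 5 * legendre_P2 \<zeta> * (s\<^sup>2 * (min r s)\<^sup>2 / max r s ^ 3)"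
      by simp
  qed auto
  moreover have "wint R (\<lambda>s z. s) (\<lambda>(s, z). f s * legendre_P2 z) = integral {0..R} (\<lambda>s. f s * 0)"
    by (rule wint_separated[OF kernel_integral_le_id[OF R] R f P, where N = "{}"])
       (auto intro!: continuous_intros simp: integral_legendre_P2)
  moreover have "integral {0..R} (\<lambda>s. f s * (4 * pi / 5 * legendre_P2 \<zeta> * (s\<^sup>2 * (min r s)\<^sup>2 / max r s ^ 3))) =
     (4 * pi / 5 * legendre_P2 \<zeta>) * integral {0..R} (\<lambda>s. f s * (s\<^sup>2 * (min r s)\<^sup>2 / max r s ^ 3))"
    by (subst Henstock_Kurzweil_Integration.integral_mult_right[symmetric]) (simp add: mult_ac)
  ultimately show ?thesis by (simp add: lin_pot_def)
qed

lemma lin_pot_eq_LBINT: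
  assumes v: "continuous_on (dom_E R) v" and p: "(r, \<zeta>) \<in> dom_E R"
  shows "lin_pot R v (r, \<zeta>) =
    1 / (4 * pi) * (LBINT z:{-1..1}. LBINT s:{0..R}. kernel_K r \<zeta> s z * v (s, z) * s\<^sup>2)
     - 1 / 2 * (LBINT z:{-1..1}. LBINT s:{0..R}. v (s, z) * s)"
proof -
  have "0 \<le> r" "0 \<le> R" "\<zeta> \<in> {-1..1}" using p by auto
  from wint_iterated(1)[OF kernel_integral_le_newton[OF this] v this(2)]
    wint_iterated(1)[OF kernel_integral_le_id[OF this(2)] v this(2)]
  show ?thesis unfolding lin_pot_def prod.case
    by (simp add: mult_ac)
qed

section \<open>Lipschitz continuity of potentials in the radius\<close>

lemma has_integral_inverse_sqrt_abs:
  assumes "0 \<le> r" "r \<le> R"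
  shows "((\<lambda>s. 1 / sqrt \<bar>s - r\<bar>) has_integral (2 * sqrt (R - r) + 2 * sqrt r)) {0..R}"
proof -
  have "((\<lambda>s. 1 / sqrt \<bar>s - r\<bar>) has_integral (2 * sqrt (R - r) - 2 * sqrt (0 - r))) {0..R}"
  proof (rule fundamental_theorem_of_calculus_interior_strong[where S = "{r}"])
    fix s assume "s \<in> {0<..<R} - {r}"
    then have "s - r \<noteq> 0" by auto
    \<comment> \<open>\<open>sqrt\<close> is odd on the reals, so one function, continuous across
      the singularity, is an antiderivative on both sides of \<open>r\<close>.\<close>
    moreover have "sqrt (s - r) = - sqrt (r - s)" by (metis minus_diff_eq real_sqrt_minus)
    ultimately have "(sqrt has_real_derivative 1 / (2 * sqrt \<bar>s - r\<bar>)) (at (s - r))"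
      by (intro DERIV_real_sqrt_generic) (auto simp: field_simps)
    then have "((\<lambda>s. sqrt (s - r)) has_real_derivative 1 / (2 * sqrt \<bar>s - r\<bar>) * 1) (at s)"
      by (rule DERIV_chain2) (auto intro!: derivative_eq_intros)
    from DERIV_cmult[OF this, of 2]
    have "((\<lambda>s. 2 * sqrt (s - r)) has_real_derivative 1 / sqrt \<bar>s - r\<bar>) (at s)" by simp
    then show "((\<lambda>s. 2 * sqrt (s - r)) has_vector_derivative 1 / sqrt \<bar>s - r\<bar>) (at s)"
      by (simp add: has_real_derivative_iff_has_vector_derivative)
  qed (use assms in \<open>auto intro!: continuous_intros\<close>)
  then show ?thesis by (simp add: real_sqrt_minus)
qed

text \<open>Moving the field point along its ray changes the distance by at most \<bar>r - r'\<bar>,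
  and the product of two inverse distances is at most the mean of their squares. In this form each
  singular term belongs to one radius only and can be averaged on its own.\<close>

lemma abs_inverse_dist_diff_le:
  assumes "0 \<le> r" "0 \<le> r'" "0 < s" "r \<noteq> s" "r' \<noteq> s" "t \<in> {-1..1}"
  shows "\<bar>1 / sqrt (dist_sq r s t) - 1 / sqrt (dist_sq r' s t)\<bar> \<le>
    \<bar>r - r'\<bar> / 2 * (1 / dist_sq r s t + 1 / dist_sq r' s t)"
proof -
  define q where "q = sqrt (dist_sq r s t)"
  define q' where "q' = sqrt (dist_sq r' s t)"
  have d: "dist_sq r s t > 0" "dist_sq r' s t > 0" using dist_sq_pos assms by auto
  have q: "q > 0" "q' > 0" using d by (auto simp: q_def q'_def)
  have q2: "q\<^sup>2 = dist_sq r s t" "q'\<^sup>2 = dist_sq r' s t" using d by (auto simp: q_def q'_def)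
  \<comment> \<open>\<open>x - s * t\<close> is the component of the distance vector along the
    ray.\<close>
  have ge: "\<bar>x - s * t\<bar> \<le> sqrt (dist_sq x s t)" for x
  proof (rule real_le_rsqrt)
    have "t\<^sup>2 \<le> 1" using assms by (auto simp: abs_square_le_1 abs_le_iff)
    then have "s\<^sup>2 * t\<^sup>2 \<le> s\<^sup>2 * 1" by (intro mult_left_mono) auto
    then show "\<bar>x - s * t\<bar>\<^sup>2 \<le> dist_sq x s t"
      by (simp add: dist_sq_def power2_eq_square algebra_simps)
  qed
  have "\<bar>q - q'\<bar> * (q + q') = \<bar>q\<^sup>2 - q'\<^sup>2\<bar>"
    using q by (simp add: power2_eq_square square_diff_square_factored abs_mult mult.commute)
  also have "q\<^sup>2 - q'\<^sup>2 = (r - r') * ((r - s * t) + (r' - s * t))"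
    unfolding q2 dist_sq_def by algebra
  also have "\<bar>\<dots>\<bar> \<le> \<bar>r - r'\<bar> * (q + q')"
    unfolding abs_mult using ge[of r] ge[of r'] by (intro mult_left_mono) (auto simp: q_def q'_def)
  finally have le: "\<bar>q - q'\<bar> \<le> \<bar>r - r'\<bar>" using q by simp
  have "\<bar>1 / q - 1 / q'\<bar> = \<bar>q - q'\<bar> / (q * q')"
  proof -
    have "1 / q - 1 / q' = (q' - q) / (q * q')" using q by (simp add: field_simps)
    then show ?thesis using q by (simp add: abs_divide abs_mult abs_minus_commute)
  qed
  also have "\<dots> \<le> \<bar>r - r'\<bar> / (q * q')" using le q by (intro divide_right_mono) auto
  also have "\<dots> = \<bar>r - r'\<bar> * (1 / q * (1 / q'))" by simp
  also have "\<dots> \<le> \<bar>r - r'\<bar> * ((1 / q\<^sup>2 + 1 / q'\<^sup>2) / 2)"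
    using sum_squares_bound[of "1 / q" "1 / q'"] by (intro mult_left_mono) (auto simp: power_divide)
  finally show ?thesis unfolding q2 by (simp add: q_def q'_def)
qed

lemma abs_kernel_K_diff_le:
  assumes r: "0 \<le> r" "0 \<le> r'" "0 < s" "r \<noteq> s" "r' \<noteq> s" and \<zeta>: "\<zeta> \<in> {-1..1}" and z: "z \<in> {-1..1}"
  shows "\<bar>kernel_K r \<zeta> s z - kernel_K r' \<zeta> s z\<bar> \<le> \<bar>r - r'\<bar> / 2 * (kernel_sq r \<zeta> s z + kernel_sq r' \<zeta> s z)"
proof -
  let ?I = "integral {0..2*pi}"
  have t: "zonal_arg \<zeta> z \<beta> \<in> {-1..1}" for \<beta> by (rule zonal_arg_mem[OF \<zeta> z])
  have cont: "continuous_on {0..2*pi} (\<lambda>\<beta>. 1 / sqrt (dist_sq x s (zonal_arg \<zeta> z \<beta>)))"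
    "continuous_on {0..2*pi} (\<lambda>\<beta>. 1 / dist_sq x s (zonal_arg \<zeta> z \<beta>))" if "0 \<le> x" "x \<noteq> s" for x
    by (rule continuous_on_compose2[OF continuous_on_inverse_sqrt_dist_sq(1)]
          continuous_on_compose2[OF continuous_on_inverse_sqrt_dist_sq(3)];
        use t r(3) that in \<open>auto intro!: continuous_intros simp del: atLeastAtMost_iff\<close>)+
  have 1: "kernel_K r \<zeta> s z - kernel_K r' \<zeta> s z =
     ?I (\<lambda>\<beta>. 1 / sqrt (dist_sq r s (zonal_arg \<zeta> z \<beta>)) - 1 / sqrt (dist_sq r' s (zonal_arg \<zeta> z \<beta>)))"
    using r \<zeta> z cont
    by (simp add: kernel_K_eq_integral Henstock_Kurzweil_Integration.integral_diff integrable_continuous_interval)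
  have 2: "norm (?I (\<lambda>\<beta>. 1 / sqrt (dist_sq r s (zonal_arg \<zeta> z \<beta>)) - 1 / sqrt (dist_sq r' s (zonal_arg \<zeta> z \<beta>))))
      \<le> ?I (\<lambda>\<beta>. \<bar>r - r'\<bar> / 2 * (1 / dist_sq r s (zonal_arg \<zeta> z \<beta>) + 1 / dist_sq r' s (zonal_arg \<zeta> z \<beta>)))"
    using abs_inverse_dist_diff_le[OF r t] r
    by (intro integral_norm_bound_integral integrable_continuous_interval continuous_intros cont) auto
  have 3: "?I (\<lambda>\<beta>. \<bar>r - r'\<bar> / 2 * (1 / dist_sq r s (zonal_arg \<zeta> z \<beta>) + 1 / dist_sq r' s (zonal_arg \<zeta> z \<beta>))) =
      \<bar>r - r'\<bar> / 2 * (kernel_sq r \<zeta> s z + kernel_sq r' \<zeta> s z)"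
    unfolding kernel_sq_def Henstock_Kurzweil_Integration.integral_mult_right
    using r cont by (subst Henstock_Kurzweil_Integration.integral_add) (auto intro!: integrable_continuous_interval)
  show ?thesis using 2 unfolding 1 3 by (simp only: real_norm_def)
qed

lemma kernel_integral_le_mono: "kernel_integral_le R k c \<Longrightarrow> c \<le> c' \<Longrightarrow> kernel_integral_le R k c'"
  unfolding kernel_integral_le_def by auto

text \<open>Trades the logarithm for an inverse square root, whose integral is explicit; it rests on
  ln y \<le> y - 1 at \<open>y = sqrt x\<close>.\<close>

lemma ln_le_2_sqrt: "0 < x \<Longrightarrow> ln x \<le> 2 * sqrt x" for x :: real
  using ln_add_one_self_le_self2[of "sqrt x - 1"] by (simp add: ln_sqrt)

text \<open>Against the factor \<open>1 / (x * s)\<close> of the averaged inverse square, the weight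
  \<open>s\<^sup>2\<close> leaves s / x; hence the lower bound \<open>a\<close> on the
  radii.\<close>

lemma kernel_integral_le_newton_diff:
  assumes a: "0 < a" "a \<le> R"
  shows "\<exists>L\<ge>0. \<forall>r\<in>{a..R}. \<forall>r'\<in>{a..R}. \<forall>\<zeta>\<in>{-1..1}.
     kernel_integral_le R (\<lambda>s z. kernel_K r \<zeta> s z * s\<^sup>2 - kernel_K r' \<zeta> s z * s\<^sup>2) (L * \<bar>r - r'\<bar>)"
proof -
  \<comment> \<open>Collects \<open>s \<le> R\<close>, \<open>x \<ge> a\<close> and
    \<open>x + s \<le> 2 * R\<close> in the product of \<open>2 * pi * (s / x)\<close> and the
    doubled square root that dominates the logarithm.\<close>
  define C where "C = 4 * pi * (R / a) * sqrt (2 * R)"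
  have C: "0 \<le> C" using a by (simp add: C_def)
  have sq_bound: "s\<^sup>2 * integral {-1..1} (kernel_sq x \<zeta> s) \<le> C * (1 / sqrt \<bar>s - x\<bar>)"
    if "x \<in> {a..R}" "s \<in> {0..R} - {0, x}" "\<zeta> \<in> {-1..1}" for x s \<zeta>
  proof -
    have x: "0 < x" "a \<le> x" "0 < s" "s \<le> R" "x \<noteq> s" "x \<le> R" using that a by auto
    have "s\<^sup>2 * integral {-1..1} (kernel_sq x \<zeta> s) = s\<^sup>2 * (2 * pi * ln ((x + s) / \<bar>x - s\<bar>) / (x * s))"
      using x that by (subst integral_kernel_sq) auto
    also have "\<dots> = 2 * pi * (s / x) * ln ((x + s) / \<bar>x - s\<bar>)"
      using x by (simp add: power2_eq_square)
    also have "\<dots> \<le> 2 * pi * (s / x) * (2 * sqrt ((x + s) / \<bar>x - s\<bar>))"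
      using x by (intro mult_left_mono ln_le_2_sqrt) auto
    also have "\<dots> \<le> 2 * pi * (R / a) * (2 * sqrt (2 * R / \<bar>x - s\<bar>))"
      using x a by (intro mult_mono frac_le real_sqrt_le_mono divide_right_mono) auto
    also have "\<dots> = C * (1 / sqrt \<bar>s - x\<bar>)"
      by (simp add: C_def real_sqrt_divide abs_minus_commute)
    finally show ?thesis .
  qed
  have "kernel_integral_le R (\<lambda>s z. kernel_K r \<zeta> s z * s\<^sup>2 - kernel_K r' \<zeta> s z * s\<^sup>2) (C * 4 * sqrt R * \<bar>r - r'\<bar>)"
    if r: "r \<in> {a..R}" "r' \<in> {a..R}" and \<zeta>: "\<zeta> \<in> {-1..1}" for r r' \<zeta>
  proof -
    let ?c = "\<bar>r - r'\<bar> / 2 * (C * ((2 * sqrt (R - r) + 2 * sqrt r) + (2 * sqrt (R - r') + 2 * sqrt r')))"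
    have k: "kernel_integral_le R (\<lambda>s z. kernel_K r \<zeta> s z * s\<^sup>2 - kernel_K r' \<zeta> s z * s\<^sup>2) ?c"
    proof (rule kernel_integral_leI[where N = "{0, r, r'}" and b = "\<lambda>s. \<bar>r - r'\<bar> / 2 * (C * (1 / sqrt \<bar>s - r\<bar> + 1 / sqrt \<bar>s - r'\<bar>))"])
      show "(\<lambda>p. kernel_K r \<zeta> (fst p) (snd p) * (fst p)\<^sup>2 - kernel_K r' \<zeta> (fst p) (snd p) * (fst p)\<^sup>2)
          \<in> borel_measurable (lborel \<Otimes>\<^sub>M lborel)"
        using kernel_K_measurable[of r \<zeta>] kernel_K_measurable[of r' \<zeta>] by measurable
      show "((\<lambda>s. \<bar>r - r'\<bar> / 2 * (C * (1 / sqrt \<bar>s - r\<bar> + 1 / sqrt \<bar>s - r'\<bar>))) has_integral ?c) {0..R}"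
        using r a by (intro has_integral_mult_right has_integral_add has_integral_inverse_sqrt_abs) auto
      show "0 \<le> \<bar>r - r'\<bar> / 2 * (C * (1 / sqrt \<bar>s - r\<bar> + 1 / sqrt \<bar>s - r'\<bar>))" for s
        using C by simp
      fix s assume s: "s \<in> {0..R} - {0, r, r'}"
      then have s': "0 < s" "r \<noteq> s" "r' \<noteq> s" "0 \<le> r" "0 \<le> r'" using r a by auto
      note ck = continuous_on_kernel[OF s'(4,1,2) \<zeta>] continuous_on_kernel[OF s'(5,1,3) \<zeta>]
      show "continuous_on {-1..1} (\<lambda>z. kernel_K r \<zeta> s z * s\<^sup>2 - kernel_K r' \<zeta> s z * s\<^sup>2)"
        by (intro continuous_intros ck)
      have "integral {-1..1} (\<lambda>z. \<bar>kernel_K r \<zeta> s z * s\<^sup>2 - kernel_K r' \<zeta> s z * s\<^sup>2\<bar>)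
          \<le> integral {-1..1} (\<lambda>z. s\<^sup>2 * (\<bar>r - r'\<bar> / 2 * (kernel_sq r \<zeta> s z + kernel_sq r' \<zeta> s z)))"
      proof (intro integral_le integrable_continuous_interval continuous_intros ck)
        fix z :: real assume z: "z \<in> {-1..1}"
        have "\<bar>kernel_K r \<zeta> s z * s\<^sup>2 - kernel_K r' \<zeta> s z * s\<^sup>2\<bar> = s\<^sup>2 * \<bar>kernel_K r \<zeta> s z - kernel_K r' \<zeta> s z\<bar>"
          by (simp add: left_diff_distrib[symmetric] abs_mult)
        also have "\<dots> \<le> s\<^sup>2 * (\<bar>r - r'\<bar> / 2 * (kernel_sq r \<zeta> s z + kernel_sq r' \<zeta> s z))"
          by (rule mult_left_mono[OF abs_kernel_K_diff_le[OF s'(4,5,1,2,3) \<zeta> z]]) simp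
        finally show "\<bar>kernel_K r \<zeta> s z * s\<^sup>2 - kernel_K r' \<zeta> s z * s\<^sup>2\<bar> \<le> s\<^sup>2 * (\<bar>r - r'\<bar> / 2 * (kernel_sq r \<zeta> s z + kernel_sq r' \<zeta> s z))" .
      qed
      also have "\<dots> = \<bar>r - r'\<bar> / 2 * (s\<^sup>2 * integral {-1..1} (kernel_sq r \<zeta> s) + s\<^sup>2 * integral {-1..1} (kernel_sq r' \<zeta> s))"
        unfolding Henstock_Kurzweil_Integration.integral_mult_right
          Henstock_Kurzweil_Integration.integral_add[OF integrable_continuous_interval[OF ck(2)] integrable_continuous_interval[OF ck(4)]]
        by (simp add: algebra_simps)
      also have "\<dots> \<le> \<bar>r - r'\<bar> / 2 * (C * (1 / sqrt \<bar>s - r\<bar>) + C * (1 / sqrt \<bar>s - r'\<bar>))"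
        using sq_bound[OF r(1) _ \<zeta>] sq_bound[OF r(2) _ \<zeta>] s by (intro mult_left_mono add_mono) auto
      finally show "integral {-1..1} (\<lambda>z. \<bar>kernel_K r \<zeta> s z * s\<^sup>2 - kernel_K r' \<zeta> s z * s\<^sup>2\<bar>)
          \<le> \<bar>r - r'\<bar> / 2 * (C * (1 / sqrt \<bar>s - r\<bar> + 1 / sqrt \<bar>s - r'\<bar>))"
        by (simp add: distrib_left)
    qed auto
    have "?c \<le> \<bar>r - r'\<bar> / 2 * (C * ((2 * sqrt R + 2 * sqrt R) + (2 * sqrt R + 2 * sqrt R)))"
      using r a C by (intro mult_left_mono add_mono) auto
    also have "\<dots> = C * 4 * sqrt R * \<bar>r - r'\<bar>" by simp
    finally show ?thesis by (rule kernel_integral_le_mono[OF k])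
  qed
  then show ?thesis using C a by (intro exI[of _ "C * 4 * sqrt R"]) auto
qed

text \<open>The normalizing constant cancels in the difference, and \<open>L\<close> does not depend
  on the density. A density of size O(\<epsilon>) therefore has a potential with Lipschitz constant
  O(\<epsilon>).\<close>

lemma lin_pot_Lipschitz:
  assumes a: "0 < a" "a \<le> R"
  obtains L where "0 \<le> L" "\<And>r r' \<zeta> v V. r \<in> {a..R} \<Longrightarrow> r' \<in> {a..R} \<Longrightarrow> \<zeta> \<in> {-1..1} \<Longrightarrow>
      continuous_on (dom_E R) v \<Longrightarrow> (\<And>p. p \<in> dom_E R \<Longrightarrow> \<bar>v p\<bar> \<le> V) \<Longrightarrow> 0 \<le> V \<Longrightarrow>
      \<bar>lin_pot R v (r, \<zeta>) - lin_pot R v (r', \<zeta>)\<bar> \<le> L * V * \<bar>r - r'\<bar>"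
proof -
  obtain L where L: "0 \<le> L" "\<And>r r' \<zeta>. r \<in> {a..R} \<Longrightarrow> r' \<in> {a..R} \<Longrightarrow> \<zeta> \<in> {-1..1} \<Longrightarrow>
     kernel_integral_le R (\<lambda>s z. kernel_K r \<zeta> s z * s\<^sup>2 - kernel_K r' \<zeta> s z * s\<^sup>2) (L * \<bar>r - r'\<bar>)"
    using kernel_integral_le_newton_diff[OF a] by blast
  have R: "0 \<le> R" using a by simp
  show thesis
  proof (rule that[of "L / (4 * pi)"])
    fix r r' \<zeta> V :: real and v :: "real \<times> real \<Rightarrow> real"
    assume *: "r \<in> {a..R}" "r' \<in> {a..R}" "\<zeta> \<in> {-1..1}" "continuous_on (dom_E R) v"
      "\<And>p. p \<in> dom_E R \<Longrightarrow> \<bar>v p\<bar> \<le> V" "0 \<le> V"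
    then have "0 \<le> r" "0 \<le> r'" using a by auto
    note k = kernel_integral_le_newton[OF this(1) R *(3)] kernel_integral_le_newton[OF this(2) R *(3)]
    have "lin_pot R v (r, \<zeta>) - lin_pot R v (r', \<zeta>) =
        1 / (4 * pi) * wint R (\<lambda>s z. kernel_K r \<zeta> s z * s\<^sup>2 - kernel_K r' \<zeta> s z * s\<^sup>2) v"
      unfolding wint_kernel_diff[OF k *(4) R] lin_pot_def by (simp add: diff_divide_distrib)
    also have "\<bar>\<dots>\<bar> \<le> 1 / (4 * pi) * (L * \<bar>r - r'\<bar> * V)"
      unfolding abs_mult using wint_bound[OF L(2)[OF *(1-3)] *(4) R *(5,6)] by (intro mult_mono) auto
    finally show "\<bar>lin_pot R v (r, \<zeta>) - lin_pot R v (r', \<zeta>)\<bar> \<le> L / (4 * pi) * V * \<bar>r - r'\<bar>"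
      by (simp add: mult_ac)
  qed (use L in simp)
qed

section \<open>Radial differential equations\<close>

lemma DERIV_integral_from_0:
  fixes F :: "real \<Rightarrow> real"
  assumes F: "continuous_on {0..<b} F" and r: "0 < r" "r < b"
  shows "((\<lambda>r. integral {0..r} F) has_real_derivative F r) (at r)"
proof -
  obtain c where c: "r < c" "c < b" using dense[OF r(2)] by auto
  have "((\<lambda>r. integral {0..r} F) has_real_derivative F r) (at r within {0..c})"
    using c r by (intro integral_has_real_derivative continuous_on_subset[OF F]) auto
  moreover have "at r within {0..c} = at r" using c r by (intro at_within_Icc_at) auto
  ultimately show ?thesis by simp
qed

lemma integral_from_0_over_tendsto_0:
  fixes F :: "real \<Rightarrow> real"
  assumes F: "continuous_on {0..<b} F" and b: "0 < b" and F0: "F 0 = 0"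
  shows "((\<lambda>r. integral {0..r} F / r) \<longlongrightarrow> 0) (at_right 0)"
proof -
  obtain c where c: "0 < c" "c < b" using b dense by blast
  have "((\<lambda>r. integral {0..r} F) has_real_derivative F 0) (at 0 within {0..c})"
    using c by (intro integral_has_real_derivative continuous_on_subset[OF F]) auto
  then show ?thesis using c F0
    by (simp add: has_field_derivative_iff at_within_Icc_at_right)
qed

lemma integral_from_0_tendsto_0:
  fixes F :: "real \<Rightarrow> real"
  assumes F: "continuous_on {0..<b} F" and b: "0 < b"
  shows "((\<lambda>r. integral {0..r} F) \<longlongrightarrow> 0) (at_right 0)"
proof -
  obtain c where c: "0 < c" "c < b" using b dense by blast
  have "continuous_on {0..c} (\<lambda>r. integral {0..r} F)"
    using c by (intro indefinite_integral_continuous_1 integrable_continuous_interval continuous_on_subset[OF F]) auto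
  then have "\<forall>x\<in>{0..c}. ((\<lambda>r. integral {0..r} F) \<longlongrightarrow> integral {0..x} F) (at x within {0..c})"
    unfolding continuous_on_def .
  then have "((\<lambda>r. integral {0..r} F) \<longlongrightarrow> integral {0..0} F) (at 0 within {0..c})"
    by (rule bspec) (use c in simp)
  then show ?thesis using c by (simp add: at_within_Icc_at_right)
qed

lemma integral_from_0_power_bound:
  fixes F :: "real \<Rightarrow> real"
  assumes F: "continuous_on {0..1} F"
  shows "\<exists>C\<ge>0. \<forall>r\<in>{0..1}. \<bar>integral {0..r} (\<lambda>s. F s * s ^ n)\<bar> \<le> C * r ^ Suc n"
proof -
  have "bounded (F ` {0..1})" by (intro compact_imp_bounded compact_continuous_image F) auto
  then obtain C where "\<forall>x\<in>F ` {0..1}. norm x \<le> C" unfolding bounded_iff by blast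
  then have C: "\<bar>F s\<bar> \<le> C" if "s \<in> {0..1}" for s using that by auto
  have C0: "0 \<le> C" using C[of 0] by auto
  show ?thesis
  proof (intro exI[of _ C] conjI C0 ballI)
    fix r :: real assume r: "r \<in> {0..1}"
    have "norm (integral {0..r} (\<lambda>s. F s * s ^ n)) \<le> (C * r ^ n) * (r - 0)"
    proof (rule integral_bound)
      fix t assume "t \<in> {0..r}"
      then show "norm (F t * t ^ n) \<le> C * r ^ n"
        using r C0 by (auto simp: abs_mult power_abs intro!: mult_mono C power_mono)
    qed (use r in \<open>auto intro!: continuous_intros continuous_on_subset[OF F]\<close>)
    then show "\<bar>integral {0..r} (\<lambda>s. F s * s ^ n)\<bar> \<le> C * r ^ Suc n" by (simp add: mult_ac)
  qed
qed

lemma DERIV_zero_on_interval_const: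
  fixes f :: "real \<Rightarrow> real"
  assumes "\<And>r. 0 < r \<Longrightarrow> r < b \<Longrightarrow> (f has_real_derivative 0) (at r)"
  shows "\<exists>c. \<forall>r\<in>{0<..<b}. f r = c"
  by (rule has_field_derivative_zero_constant) (auto intro!: DERIV_subset[OF assms])

lemma DERIV_radial_potential:
  fixes F :: "real \<Rightarrow> real"
  assumes F: "continuous_on {0..<b} F" and r: "0 < r" "r < b"
  shows "((\<lambda>r. integral {0..r} (\<lambda>s. F s * s\<^sup>2) / r - integral {0..r} (\<lambda>s. F s * s))
    has_real_derivative - integral {0..r} (\<lambda>s. F s * s\<^sup>2) / r\<^sup>2) (at r)"
proof -
  have 1: "((\<lambda>r. integral {0..r} (\<lambda>s. F s * s\<^sup>2)) has_real_derivative F r * r\<^sup>2) (at r)"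
    by (rule DERIV_integral_from_0[OF _ r]) (intro continuous_intros F)
  have 2: "((\<lambda>r. integral {0..r} (\<lambda>s. F s * s)) has_real_derivative F r * r) (at r)"
    by (rule DERIV_integral_from_0[OF _ r]) (intro continuous_intros F)
  show ?thesis
    by (rule DERIV_cong[OF DERIV_diff[OF DERIV_divide[OF 1 DERIV_ident] 2]])
       (use r in \<open>auto simp: field_simps power2_eq_square\<close>)
qed

text \<open>Two integrations leave the homogeneous solutions 1 and 1/r undetermined. A finite limit
  at the origin excludes 1/r and supplies the other constant.\<close>

lemma radial_solution_l0:
  fixes y F :: "real \<Rightarrow> real"
  assumes dy: "\<And>r. 0 < r \<Longrightarrow> r < b \<Longrightarrow> y differentiable (at r)"
    and eq: "\<And>r. 0 < r \<Longrightarrow> r < b \<Longrightarrow> ((\<lambda>s. s\<^sup>2 * deriv y s) has_real_derivative - (F r * r\<^sup>2)) (at r)"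
    and F: "continuous_on {0..<b} F" and y0: "(y \<longlongrightarrow> y0) (at_right 0)"
    and r: "0 < r" "r < b"
  shows "y r = y0 + (integral {0..r} (\<lambda>s. F s * s\<^sup>2) / r - integral {0..r} (\<lambda>s. F s * s))"
proof -
  have b: "0 < b" using r by simp
  define M where "M = (\<lambda>r. integral {0..r} (\<lambda>s. F s * s\<^sup>2))"
  define N where "N = (\<lambda>r. M r / r - integral {0..r} (\<lambda>s. F s * s))"
  have dM: "(M has_real_derivative F r * r\<^sup>2) (at r)" if "0 < r" "r < b" for r
    unfolding M_def by (rule DERIV_integral_from_0[OF _ that]) (intro continuous_intros F)
  have dN: "(N has_real_derivative - M r / r\<^sup>2) (at r)" if "0 < r" "r < b" for r
    unfolding N_def M_def using DERIV_radial_potential[OF F that] .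
  have dy': "(y has_real_derivative deriv y r) (at r)" if "0 < r" "r < b" for r
    using dy[OF that] by (simp add: DERIV_deriv_iff_real_differentiable)
  have "((\<lambda>r. r\<^sup>2 * deriv y r + M r) has_real_derivative 0) (at r)" if "0 < r" "r < b" for r
    using DERIV_add[OF eq[OF that] dM[OF that]] by simp
  then obtain c where "\<forall>r\<in>{0<..<b}. r\<^sup>2 * deriv y r + M r = c"
    using DERIV_zero_on_interval_const by blast
  then have c: "r\<^sup>2 * deriv y r + M r = c" if "0 < r" "r < b" for r using that by simp
  have "((\<lambda>r. y r - N r + c / r) has_real_derivative 0) (at r)" if r: "0 < r" "r < b" for r
  proof -
    have "deriv y r = (c - M r) / r\<^sup>2" using c[OF r] r by (simp add: field_simps)
    then show ?thesis
      using r by (auto intro!: derivative_eq_intros dy' dN simp: field_simps power2_eq_square)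
  qed
  then obtain d where "\<forall>r\<in>{0<..<b}. y r - N r + c / r = d"
    using DERIV_zero_on_interval_const by blast
  then have d: "y r - N r + c / r = d" if "0 < r" "r < b" for r using that by simp
  have N0: "(N \<longlongrightarrow> 0 - 0) (at_right 0)"
    unfolding N_def M_def
    by (intro tendsto_diff integral_from_0_over_tendsto_0[OF _ b] integral_from_0_tendsto_0[OF _ b]
        continuous_intros F) auto
  have ev: "\<forall>\<^sub>F r in at_right 0. 0 < r \<and> r < (b::real)"
    using b by (auto simp: eventually_at_right_field intro!: exI[of _ b])
  \<comment> \<open>Multiplication by r isolates the coefficient \<open>c\<close> of 1/r, while the
    convergent rest is sent to 0.\<close>
  have "((\<lambda>r. r * (d - y r + N r)) \<longlongrightarrow> 0 * (d - y0 + (0 - 0))) (at_right 0)"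
    by (intro tendsto_intros y0 N0)
  moreover have "\<forall>\<^sub>F r in at_right 0. r * (d - y r + N r) = c"
    using ev
  proof eventually_elim
    case (elim r)
    then have "c / r = d - y r + N r" using d[of r] by simp
    then show ?case using elim by (simp add: field_simps)
  qed
  ultimately have "((\<lambda>r. c) \<longlongrightarrow> 0 * (d - y0 + (0 - 0))) (at_right (0::real))"
    by (rule Lim_transform_eventually)
  then have c0: "c = 0" by (simp add: tendsto_const_iff)
  have "((\<lambda>r. y r - N r) \<longlongrightarrow> y0 - (0 - 0)) (at_right 0)" by (intro tendsto_intros y0 N0)
  moreover have "\<forall>\<^sub>F r in at_right 0. y r - N r = d"
    using ev by eventually_elim (use d c0 in simp)
  ultimately have "((\<lambda>r. d) \<longlongrightarrow> y0 - (0 - 0)) (at_right (0::real))"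
    by (rule Lim_transform_eventually)
  then have "d = y0" by (simp add: tendsto_const_iff)
  then show ?thesis using d[OF r] c0 by (simp add: N_def M_def)
qed

section \<open>Powers of the positive part\<close>

lemma DERIV_pos_part_powr:
  assumes "1 < (\<nu>::real)"
  shows "((\<lambda>x. max 0 x powr \<nu>) has_real_derivative \<nu> * max 0 x powr (\<nu> - 1)) (at x)"
proof (cases "x = 0")
  case False
  show ?thesis
  proof (cases "x > 0")
    case True
    have "((\<lambda>x. x powr \<nu>) has_real_derivative \<nu> * max 0 x powr (\<nu> - 1)) (at x)"
      using has_real_derivative_powr[OF True, of \<nu>] True by simp
    then show ?thesis
      by (rule has_field_derivative_transform_within_open[where S = "{0<..}"]) (use True in auto)
  next
    case F: False
    have "((\<lambda>x. 0) has_real_derivative \<nu> * max 0 x powr (\<nu> - 1)) (at x)"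
      using F by (auto simp: max_def)
    then show ?thesis
      by (rule has_field_derivative_transform_within_open[where S = "{..<0}"]) (use False F in auto)
  qed
next
  case True
  \<comment> \<open>At the boundary of the support the difference quotient is at most \<bar>h\<bar>
    to the power \<open>\<nu> - 1\<close>, which is positive.\<close>
  have "((\<lambda>h. max 0 h powr \<nu> / h) \<longlongrightarrow> 0) (at 0)"
  proof (rule Lim_null_comparison)
    have "((\<lambda>h::real. \<bar>h\<bar> powr (\<nu> - 1)) \<longlongrightarrow> \<bar>0\<bar> powr (\<nu> - 1)) (at 0)"
      using assms by (intro tendsto_powr' tendsto_intros) auto
    then show "((\<lambda>h::real. \<bar>h\<bar> powr (\<nu> - 1)) \<longlongrightarrow> 0) (at 0)" by simp
    have "norm (max 0 h powr \<nu> / h) \<le> \<bar>h\<bar> powr (\<nu> - 1)" for h :: real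
      by (cases "h > 0") (auto simp: powr_diff max_def intro!: divide_nonneg_nonpos)
    then show "\<forall>\<^sub>F h in at 0. norm (max 0 h powr \<nu> / h) \<le> \<bar>h\<bar> powr (\<nu> - 1)" by simp
  qed
  then show ?thesis using True by (simp add: has_field_derivative_iff)
qed

lemma continuous_on_pos_part_powr [continuous_intros]:
  fixes f :: "'a::topological_space \<Rightarrow> real"
  assumes "continuous_on S f" "0 < a"
  shows "continuous_on S (\<lambda>x. max 0 (f x) powr a)"
  using assms by (intro continuous_on_powr' continuous_intros) auto

section \<open>The Lane-Emden function\<close>

text \<open>Mass inside radius r, equal to -r^2 \<theta>'(r) for all r > 0; the positive part makes
  the formula valid beyond the first zero, where the mass stays constant.\<close>

definition lane_emden_flux :: "real \<Rightarrow> (real \<Rightarrow> real) \<Rightarrow> real \<Rightarrow> real" where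
  "lane_emden_flux \<nu> \<theta> r = integral {0..r} (\<lambda>s. max 0 (\<theta> s) powr \<nu> * s\<^sup>2)"

context
  fixes \<nu> \<xi> :: real and \<theta> :: "real \<Rightarrow> real"
  assumes LE: "lane_emden \<nu> \<theta> \<xi>" and nu: "1 < \<nu>"
begin

lemma xi_pos: "0 < \<xi>" and theta_0: "\<theta> 0 = 1" and theta_xi: "\<theta> \<xi> = 0"
  and theta_pos: "0 < r \<Longrightarrow> r < \<xi> \<Longrightarrow> 0 < \<theta> r"
  and theta_outside: "\<xi> < r \<Longrightarrow> \<theta> r = - lane_emden_mass \<nu> \<theta> \<xi> * (1 / \<xi> - 1 / r)"
  using LE by (auto simp: lane_emden_def)

lemma continuous_on_theta: "continuous_on {0..} \<theta>"
proof -
  have "continuous_on {\<xi>..} (\<lambda>r. - lane_emden_mass \<nu> \<theta> \<xi> * (1 / \<xi> - 1 / r))"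
    using xi_pos by (intro continuous_intros) auto
  then have "continuous_on {\<xi>..} \<theta>"
    by (rule continuous_on_eq) (use theta_outside theta_xi in \<open>force simp: le_less\<close>)
  moreover have "continuous_on {0..\<xi>} \<theta>" using LE by (auto simp: lane_emden_def)
  ultimately have "continuous_on ({0..\<xi>} \<union> {\<xi>..}) \<theta>"
    by (intro continuous_on_closed_Un) auto
  moreover have "{0..\<xi>} \<union> {\<xi>..} = {0..}" using xi_pos by auto
  ultimately show ?thesis by simp
qed

lemma continuous_on_theta_powr: "0 < a \<Longrightarrow> continuous_on {0..} (\<lambda>s. max 0 (\<theta> s) powr a)"
  by (intro continuous_intros continuous_on_theta)

lemma continuous_on_subset_theta_powr: "0 < a \<Longrightarrow> S \<subseteq> {0..} \<Longrightarrow> continuous_on S (\<lambda>s. max 0 (\<theta> s) powr a)"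
  using continuous_on_subset[OF continuous_on_theta_powr] .

lemma theta_eq_inside:
  assumes r: "0 < r" "r < \<xi>"
  shows "\<theta> r = 1 + (lane_emden_flux \<nu> \<theta> r / r - integral {0..r} (\<lambda>s. max 0 (\<theta> s) powr \<nu> * s))"
  unfolding lane_emden_flux_def
proof (rule radial_solution_l0[OF _ _ _ _ r])
  fix r assume r: "0 < r" "r < \<xi>"
  then have *: "\<theta> differentiable (at r)" "deriv \<theta> differentiable (at r)"
    "deriv (deriv \<theta>) r + 2 / r * deriv \<theta> r + \<theta> r powr \<nu> = 0" using LE by (auto simp: lane_emden_def)
  show "\<theta> differentiable (at r)" by fact
  have d: "(deriv \<theta> has_real_derivative deriv (deriv \<theta>) r) (at r)"
    using *(2) by (simp add: DERIV_deriv_iff_real_differentiable)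
  have "2 * r * deriv \<theta> r + deriv (deriv \<theta>) r * r\<^sup>2 = - (max 0 (\<theta> r) powr \<nu> * r\<^sup>2)"
  proof -
    have "deriv (deriv \<theta>) r = - 2 / r * deriv \<theta> r - max 0 (\<theta> r) powr \<nu>"
      using *(3) theta_pos[OF r] by (simp add: max_def)
    then show ?thesis unfolding \<open>deriv (deriv \<theta>) r = _\<close> using r by (simp add: field_simps power2_eq_square)
  qed
  then show "((\<lambda>s. s\<^sup>2 * deriv \<theta> s) has_real_derivative - (max 0 (\<theta> r) powr \<nu> * r\<^sup>2)) (at r)"
    by (auto intro!: derivative_eq_intros d)
next
  show "continuous_on {0..<\<xi>} (\<lambda>s. max 0 (\<theta> s) powr \<nu>)"
    using nu by (intro continuous_on_subset_theta_powr) auto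
  have "(\<theta> \<longlongrightarrow> \<theta> 0) (at 0 within {0..\<xi>})"
    using continuous_on_theta xi_pos
    by (meson atLeastAtMost_iff atLeast_iff continuous_on_def continuous_on_subset dual_order.refl less_imp_le subsetI)
  then show "(\<theta> \<longlongrightarrow> 1) (at_right 0)"
    using xi_pos theta_0 by (simp add: at_within_Icc_at_right)
qed

lemma theta_pos_part_zero: "\<xi> \<le> r \<Longrightarrow> max 0 (\<theta> r) = 0"
proof -
  assume r: "\<xi> \<le> r"
  have "0 \<le> lane_emden_mass \<nu> \<theta> \<xi>"
    unfolding lane_emden_mass_def set_lebesgue_integral_def by (intro Bochner_Integration.integral_nonneg) auto
  moreover have "0 \<le> 1 / \<xi> - 1 / r" using r xi_pos by (simp add: frac_le)
  ultimately have "0 \<le> lane_emden_mass \<nu> \<theta> \<xi> * (1 / \<xi> - 1 / r)" by (rule mult_nonneg_nonneg)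
  then have "\<theta> r \<le> 0" using theta_outside[of r] theta_xi r by (cases "r = \<xi>") auto
  then show ?thesis by (rule max_absorb1)
qed

lemma integral_pos_part_theta_beyond:
  assumes a: "0 < a" and r: "\<xi> \<le> r" and g: "continuous_on {0..} g"
  shows "integral {0..r} (\<lambda>s. max 0 (\<theta> s) powr a * g s) = integral {0..\<xi>} (\<lambda>s. max 0 (\<theta> s) powr a * g s)"
proof -
  have "(\<lambda>s. max 0 (\<theta> s) powr a * g s) integrable_on {0..r}"
    by (intro integrable_continuous_interval continuous_intros continuous_on_subset_theta_powr a continuous_on_subset[OF g]) auto
  then have "integral {0..r} (\<lambda>s. max 0 (\<theta> s) powr a * g s) =
      integral {0..\<xi>} (\<lambda>s. max 0 (\<theta> s) powr a * g s) + integral {\<xi>..r} (\<lambda>s. max 0 (\<theta> s) powr a * g s)"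
    using xi_pos r by (intro Henstock_Kurzweil_Integration.integral_combine[symmetric]) auto
  moreover have "integral {\<xi>..r} (\<lambda>s. max 0 (\<theta> s) powr a * g s) = integral {\<xi>..r} (\<lambda>s. 0)"
    by (intro Henstock_Kurzweil_Integration.integral_cong) (use theta_pos_part_zero a in auto)
  ultimately show ?thesis by simp
qed

lemma lane_emden_mass_eq: "lane_emden_mass \<nu> \<theta> \<xi> = lane_emden_flux \<nu> \<theta> \<xi>"
proof -
  have eq: "\<theta> r powr \<nu> * r\<^sup>2 = max 0 (\<theta> r) powr \<nu> * r\<^sup>2" if "r \<in> {0..\<xi>}" for r
  proof -
    have "0 \<le> \<theta> r" using that theta_pos[of r] theta_0 theta_xi by (cases "r = 0 \<or> r = \<xi>") auto
    then show ?thesis by (simp add: max_def)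
  qed
  have "lane_emden_mass \<nu> \<theta> \<xi> = (LBINT r:{0..\<xi>}. max 0 (\<theta> r) powr \<nu> * r\<^sup>2)"
    unfolding lane_emden_mass_def by (rule set_lebesgue_integral_cong) (simp, use eq in blast)
  also have "\<dots> = lane_emden_flux \<nu> \<theta> \<xi>"
    unfolding lane_emden_flux_def using nu
    by (intro set_borel_integral_eq_integral borel_integrable_atLeastAtMost' continuous_intros continuous_on_subset_theta_powr) auto
  finally show ?thesis .
qed

lemma DERIV_lane_emden_potential:
  assumes "0 < r"
  shows "((\<lambda>r. 1 + (lane_emden_flux \<nu> \<theta> r / r - integral {0..r} (\<lambda>s. max 0 (\<theta> s) powr \<nu> * s)))
     has_real_derivative - lane_emden_flux \<nu> \<theta> r / r\<^sup>2) (at r)"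
proof -
  have "((\<lambda>r. lane_emden_flux \<nu> \<theta> r / r - integral {0..r} (\<lambda>s. max 0 (\<theta> s) powr \<nu> * s))
     has_real_derivative - lane_emden_flux \<nu> \<theta> r / r\<^sup>2) (at r)"
    unfolding lane_emden_flux_def
    by (rule DERIV_radial_potential[of "r + 1"]) (use nu assms in \<open>auto intro!: continuous_on_subset_theta_powr\<close>)
  from DERIV_add[OF DERIV_const[of 1] this] show ?thesis by simp
qed

text \<open>Beyond \<xi> both integrals are frozen, so the right side has the form a + b / r with b
  the total mass. Continuity at \<xi> gives the value 0 there and fixes a, which reproduces the
  prescribed exterior function.\<close>

lemma theta_eq:
  assumes r: "0 < r"
  shows "\<theta> r = 1 + (lane_emden_flux \<nu> \<theta> r / r - integral {0..r} (\<lambda>s. max 0 (\<theta> s) powr \<nu> * s))"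
proof -
  define N where "N = (\<lambda>r. 1 + (lane_emden_flux \<nu> \<theta> r / r - integral {0..r} (\<lambda>s. max 0 (\<theta> s) powr \<nu> * s)))"
  have N_inside: "\<theta> r = N r" if "0 < r" "r < \<xi>" for r using theta_eq_inside[OF that] by (simp add: N_def)
  have N_cont: "isCont N r" if "0 < r" for r
    using DERIV_isCont[OF DERIV_lane_emden_potential[OF that]] by (simp add: N_def)
  have "(N \<longlongrightarrow> N \<xi>) (at_left \<xi>)"
    using N_cont[OF xi_pos] by (auto simp: isCont_def intro: filterlim_mono at_le)
  moreover have "\<forall>\<^sub>F r in at_left \<xi>. N r = \<theta> r"
    using xi_pos N_inside by (auto simp: eventually_at_left_field intro!: exI[of _ 0])
  ultimately have "(\<theta> \<longlongrightarrow> N \<xi>) (at_left \<xi>)" by (rule Lim_transform_eventually)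
  moreover have "(\<theta> \<longlongrightarrow> \<theta> \<xi>) (at_left \<xi>)"
  proof -
    have "isCont \<theta> \<xi>" using continuous_on_theta xi_pos
      by (metis atLeast_iff continuous_on_interior interior_real_atLeast greaterThan_iff)
    then show ?thesis by (auto simp: isCont_def intro: filterlim_mono at_le)
  qed
  ultimately have N_xi: "N \<xi> = 0"
    using theta_xi tendsto_unique[of "at_left \<xi>" \<theta>] by (metis trivial_limit_at_left_real)
  show ?thesis
  proof (cases "r \<le> \<xi>")
    case True
    then show ?thesis using N_inside[of r] N_xi theta_xi r by (cases "r = \<xi>") (auto simp: N_def)
  next
    case False
    have "lane_emden_flux \<nu> \<theta> r = lane_emden_flux \<nu> \<theta> \<xi>"
      unfolding lane_emden_flux_def using nu False
      by (intro integral_pos_part_theta_beyond continuous_intros) auto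
    moreover have "integral {0..r} (\<lambda>s. max 0 (\<theta> s) powr \<nu> * s) = integral {0..\<xi>} (\<lambda>s. max 0 (\<theta> s) powr \<nu> * s)"
      using nu False by (intro integral_pos_part_theta_beyond continuous_intros) auto
    moreover have "integral {0..\<xi>} (\<lambda>s. max 0 (\<theta> s) powr \<nu> * s) = 1 + lane_emden_flux \<nu> \<theta> \<xi> / \<xi>"
      using N_xi by (simp add: N_def)
    ultimately show ?thesis
      using theta_outside[of r] False by (simp add: lane_emden_mass_eq algebra_simps)
  qed
qed

lemma DERIV_theta:
  assumes "0 < r"
  shows "(\<theta> has_real_derivative - lane_emden_flux \<nu> \<theta> r / r\<^sup>2) (at r)"
  by (rule has_field_derivative_transform_within_open[OF DERIV_lane_emden_potential[OF assms], where S = "{0<..}"])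
     (use theta_eq assms in auto)

lemma DERIV_lane_emden_flux:
  assumes "0 < r"
  shows "(lane_emden_flux \<nu> \<theta> has_real_derivative max 0 (\<theta> r) powr \<nu> * r\<^sup>2) (at r)"
  unfolding lane_emden_flux_def[abs_def]
  by (rule DERIV_integral_from_0[of "r + 1"])
     (use assms nu in \<open>auto intro!: continuous_intros continuous_on_subset_theta_powr\<close>)

lemma lane_emden_flux_mono: "0 \<le> r \<Longrightarrow> r \<le> r' \<Longrightarrow> lane_emden_flux \<nu> \<theta> r \<le> lane_emden_flux \<nu> \<theta> r'"
  unfolding lane_emden_flux_def using nu
  by (intro integral_subset_le integrable_continuous_interval continuous_intros continuous_on_subset_theta_powr) auto

lemma lane_emden_flux_pos:
  assumes r: "0 < r"
  shows "0 < lane_emden_flux \<nu> \<theta> r"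
proof -
  have in_pos: "0 < lane_emden_flux \<nu> \<theta> s" if "0 < s" "s < \<xi>" for s
  proof -
    have "deriv \<theta> s < 0" using LE that by (auto simp: lane_emden_def)
    moreover have "deriv \<theta> s = - lane_emden_flux \<nu> \<theta> s / s\<^sup>2" using DERIV_theta[of s] that DERIV_imp_deriv by blast
    ultimately show ?thesis using that by (simp add: zero_less_divide_iff)
  qed
  have "0 < lane_emden_flux \<nu> \<theta> (min r (\<xi> / 2))" using r xi_pos by (intro in_pos) auto
  also have "\<dots> \<le> lane_emden_flux \<nu> \<theta> r" using r xi_pos by (intro lane_emden_flux_mono) auto
  finally show ?thesis .
qed

lemma lane_emden_mass_pos: "0 < lane_emden_mass \<nu> \<theta> \<xi>"
  using lane_emden_flux_pos[OF xi_pos] lane_emden_mass_eq by simp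

text \<open>The general radial formula is applied to the source
  \<open>\<nu> * max 0 (\<theta> s) powr (\<nu> - 1) * h s - 1\<close>. The constant -1 contributes
  \<open>- r\<^sup>2 / 3 + r\<^sup>2 / 2\<close>, that is \<open>r\<^sup>2 / 6\<close>, the radial
  part of \<open>frak_g\<close>.\<close>

lemma h0_eq:
  assumes h: "is_h0 \<nu> \<theta> h" and r: "0 < r"
  shows "h r = integral {0..r} (\<lambda>s. \<nu> * max 0 (\<theta> s) powr (\<nu> - 1) * h s * s\<^sup>2) / r
     - integral {0..r} (\<lambda>s. \<nu> * max 0 (\<theta> s) powr (\<nu> - 1) * h s * s) + r\<^sup>2 / 6"
    and "continuous_on {0..} h"
proof -
  have dh: "h differentiable (at r)" "(\<lambda>s. s\<^sup>2 * deriv h s) differentiable (at r)"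
    "- radial_laplacian h r = \<nu> * max 0 (\<theta> r) powr (\<nu> - 1) * h r - 1" if "0 < r" for r
    using h that by (auto simp: is_h0_def radial_twice_diff_def)
  have h0: "continuous (at 0 within {0..}) h" "h 0 = 0" using h by (auto simp: is_h0_def)
  show ch: "continuous_on {0..} h"
    unfolding continuous_on_eq_continuous_within
  proof
    fix x :: real assume "x \<in> {0..}"
    then show "continuous (at x within {0..}) h"
      using h0 dh(1)[of x] differentiable_imp_continuous_within continuous_at_imp_continuous_at_within
      by (cases "x = 0") (auto, blast)
  qed
  let ?q = "\<lambda>s. \<nu> * max 0 (\<theta> s) powr (\<nu> - 1) * h s"
  have cq: "continuous_on {0..r} ?q" for r
    using nu by (intro continuous_intros continuous_on_subset_theta_powr continuous_on_subset[OF ch]) auto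
  have e1: "h r = 0 + (integral {0..r} (\<lambda>s. (?q s - 1) * s\<^sup>2) / r - integral {0..r} (\<lambda>s. (?q s - 1) * s))"
  proof (rule radial_solution_l0[where b = "r + 1"])
    fix r :: real assume r: "0 < r"
    show "h differentiable (at r)" using dh r by auto
    have "deriv (\<lambda>s. s\<^sup>2 * deriv h s) r = - ((?q r - 1) * r\<^sup>2)"
      using dh(3)[OF r] r by (simp add: radial_laplacian_def field_simps)
    then show "((\<lambda>s. s\<^sup>2 * deriv h s) has_real_derivative - ((?q r - 1) * r\<^sup>2)) (at r)"
      using dh(2)[OF r] DERIV_deriv_iff_real_differentiable by metis
  next
    show "continuous_on {0..<r + 1} (\<lambda>s. ?q s - 1)"
      by (rule continuous_on_diff[OF continuous_on_subset[OF cq[of "r + 1"]] continuous_on_const]) auto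
    have "(h \<longlongrightarrow> h 0) (at 0 within {0..})" using h0 by (simp add: continuous_within)
    then show "(h \<longlongrightarrow> 0) (at_right 0)"
      using h0 by (auto elim: tendsto_within_subset)
  qed (use r in auto)
  have e2: "integral {0..r} (\<lambda>s. (?q s - 1) * s\<^sup>2) = integral {0..r} (\<lambda>s. ?q s * s\<^sup>2) - r ^ 3 / 3"
  proof -
    have "((\<lambda>s. s\<^sup>2) has_integral (r ^ 3 / 3 - 0 ^ 3 / 3)) {0..r}"
      by (rule fundamental_theorem_of_calculus)
         (use r in \<open>auto simp: has_real_derivative_iff_has_vector_derivative[symmetric] intro!: derivative_eq_intros\<close>)
    moreover have "((\<lambda>s. ?q s * s\<^sup>2) has_integral integral {0..r} (\<lambda>s. ?q s * s\<^sup>2)) {0..r}"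
      by (intro integrable_integral integrable_continuous_interval continuous_intros cq)
    ultimately have "((\<lambda>s. ?q s * s\<^sup>2 - s\<^sup>2) has_integral (integral {0..r} (\<lambda>s. ?q s * s\<^sup>2) - (r ^ 3 / 3 - 0 ^ 3 / 3))) {0..r}"
      by (intro has_integral_diff)
    then show ?thesis by (simp add: left_diff_distrib integral_unique)
  qed
  have e3: "integral {0..r} (\<lambda>s. (?q s - 1) * s) = integral {0..r} (\<lambda>s. ?q s * s) - r\<^sup>2 / 2"
  proof -
    have "((\<lambda>s. s) has_integral (r ^ 2 / 2 - 0 ^ 2 / 2)) {0..r}"
      by (rule fundamental_theorem_of_calculus)
         (use r in \<open>auto simp: has_real_derivative_iff_has_vector_derivative[symmetric] intro!: derivative_eq_intros\<close>)
    moreover have "((\<lambda>s. ?q s * s) has_integral integral {0..r} (\<lambda>s. ?q s * s)) {0..r}"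
      by (intro integrable_integral integrable_continuous_interval continuous_intros cq)
    ultimately have "((\<lambda>s. ?q s * s - s) has_integral (integral {0..r} (\<lambda>s. ?q s * s) - (r ^ 2 / 2 - 0 ^ 2 / 2))) {0..r}"
      by (intro has_integral_diff)
    then show ?thesis by (simp add: left_diff_distrib integral_unique)
  qed
  show "h r = integral {0..r} (\<lambda>s. ?q s * s\<^sup>2) / r - integral {0..r} (\<lambda>s. ?q s * s) + r\<^sup>2 / 6"
    using e1[unfolded e2 e3] r by (simp add: diff_divide_distrib power2_eq_square power3_eq_cube)
qed

end

section \<open>The quadrupole mode\<close>

context
  fixes \<nu> \<xi> :: real and \<theta> \<psi> :: "real \<Rightarrow> real"
  assumes LE: "lane_emden \<nu> \<theta> \<xi>" and nu: "1 < \<nu>" and psi: "is_psi2 \<nu> \<theta> \<psi>"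
begin

lemma psi2_asymp: "((\<lambda>r. \<psi> r / r\<^sup>2) \<longlongrightarrow> 1) (at_right 0)"
proof -
  have "\<psi> \<sim>[at_right 0] (\<lambda>r. r\<^sup>2)" using psi by (simp add: is_psi2_def)
  then have "((\<lambda>r. if \<psi> r = 0 \<and> r\<^sup>2 = 0 then 1 else \<psi> r / r\<^sup>2) \<longlongrightarrow> 1) (at_right 0)"
    by (rule asymp_equivD)
  moreover have "\<forall>\<^sub>F r in at_right (0::real). (if \<psi> r = 0 \<and> r\<^sup>2 = 0 then 1 else \<psi> r / r\<^sup>2) = \<psi> r / r\<^sup>2"
    by (auto simp: eventually_at_right_field intro!: exI[of _ 1])
  ultimately show ?thesis by (rule Lim_transform_eventually)
qed

lemma psi2_over_tendsto_0: "((\<lambda>r. \<psi> r / r) \<longlongrightarrow> 0) (at_right 0)"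
proof -
  have "((\<lambda>r. \<psi> r / r\<^sup>2 * r) \<longlongrightarrow> 1 * 0) (at_right 0)"
    by (intro tendsto_intros psi2_asymp)
  moreover have "\<forall>\<^sub>F r in at_right (0::real). \<psi> r / r\<^sup>2 * r = \<psi> r / r"
    by (auto simp: eventually_at_right_field power2_eq_square intro!: exI[of _ 1])
  ultimately have "((\<lambda>r. \<psi> r / r) \<longlongrightarrow> 1 * 0) (at_right 0)" by (rule Lim_transform_eventually)
  then show ?thesis by simp
qed

lemma psi2_tendsto_0: "(\<psi> \<longlongrightarrow> 0) (at_right 0)"
proof -
  have "((\<lambda>r. \<psi> r / r * r) \<longlongrightarrow> 0 * 0) (at_right 0)"
    by (intro tendsto_intros psi2_over_tendsto_0)
  moreover have "\<forall>\<^sub>F r in at_right (0::real). \<psi> r / r * r = \<psi> r"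
    by (auto simp: eventually_at_right_field intro!: exI[of _ 1])
  ultimately have "(\<psi> \<longlongrightarrow> 0 * 0) (at_right 0)" by (rule Lim_transform_eventually)
  then show ?thesis by simp
qed

lemma psi2_0: "\<psi> 0 = 0"
  using psi by (simp add: is_psi2_def)

lemma DERIV_psi2: "0 < r \<Longrightarrow> (\<psi> has_real_derivative deriv \<psi> r) (at r)"
  using psi by (auto simp: is_psi2_def radial_twice_diff_def DERIV_deriv_iff_real_differentiable)

lemma DERIV_psi2_flux:
  assumes r: "0 < r"
  shows "((\<lambda>s. s\<^sup>2 * deriv \<psi> s) has_real_derivative 6 * \<psi> r - r\<^sup>2 * (\<nu> * max 0 (\<theta> r) powr (\<nu> - 1) * \<psi> r)) (at r)"
proof -
  have d: "(\<lambda>s. s\<^sup>2 * deriv \<psi> s) differentiable (at r)"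
    and e: "- radial_laplacian \<psi> r + 6 / r\<^sup>2 * \<psi> r = \<nu> * max 0 (\<theta> r) powr (\<nu> - 1) * \<psi> r"
    using psi r by (auto simp: is_psi2_def radial_twice_diff_def)
  have "deriv (\<lambda>s. s\<^sup>2 * deriv \<psi> s) r = 6 * \<psi> r - r\<^sup>2 * (\<nu> * max 0 (\<theta> r) powr (\<nu> - 1) * \<psi> r)"
    unfolding e[symmetric] radial_laplacian_def using r by (simp add: algebra_simps)
  then show ?thesis using d DERIV_deriv_iff_real_differentiable by metis
qed

lemma continuous_on_0_from_tendsto:
  fixes f :: "real \<Rightarrow> real"
  assumes "\<And>r. 0 < r \<Longrightarrow> isCont f r" "(f \<longlongrightarrow> f 0) (at_right 0)"
  shows "continuous_on {0..} f"
  unfolding continuous_on_eq_continuous_within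
proof
  fix x :: real assume x: "x \<in> {0..}"
  show "continuous (at x within {0..}) f"
  proof (cases "x = 0")
    case True
    have "at (0::real) within {0..} = at_right 0"
      by (rule at_within_nhd[of _ UNIV]) auto
    then show ?thesis using assms(2) True by (simp add: continuous_within)
  next
    case False
    then show ?thesis using assms(1)[of x] x by (auto intro: continuous_at_imp_continuous_at_within)
  qed
qed

lemma continuous_on_psi2: "continuous_on {0..} \<psi>"
  using DERIV_isCont[OF DERIV_psi2] psi2_tendsto_0 psi2_0 by (intro continuous_on_0_from_tendsto) auto

text \<open>The quotient at 0 is 0 by convention and agrees with the limit because \<psi> behaves
  like r^2; the moment with the singular weight is thus an integral of a continuous
  function.\<close>

lemma continuous_on_psi2_over: "continuous_on {0..} (\<lambda>r. \<psi> r / r)"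
  using DERIV_isCont[OF DERIV_psi2] psi2_over_tendsto_0 psi2_0
  by (intro continuous_on_0_from_tendsto) (auto intro!: continuous_intros)

lemma continuous_on_q: "S \<subseteq> {0..} \<Longrightarrow> continuous_on S (\<lambda>s. \<nu> * max 0 (\<theta> s) powr (\<nu> - 1))"
  using nu by (intro continuous_intros continuous_on_subset_theta_powr[OF LE nu]) auto

text \<open>Moments of the source against the regular solution r^2 and the singular solution r^-3,
  each multiplied by the weight s^2 of the radial measure.\<close>

abbreviation "inner_moment r \<equiv> integral {0..r} (\<lambda>s. \<nu> * max 0 (\<theta> s) powr (\<nu> - 1) * \<psi> s * s ^ 4)"
abbreviation "outer_moment r \<equiv> integral {0..r} (\<lambda>s. \<nu> * max 0 (\<theta> s) powr (\<nu> - 1) * (\<psi> s / s))"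

lemma continuous_on_moments:
  "S \<subseteq> {0..} \<Longrightarrow> continuous_on S (\<lambda>s. \<nu> * max 0 (\<theta> s) powr (\<nu> - 1) * \<psi> s * s ^ 4)"
  "S \<subseteq> {0..} \<Longrightarrow> continuous_on S (\<lambda>s. \<nu> * max 0 (\<theta> s) powr (\<nu> - 1) * (\<psi> s / s))"
  by (intro continuous_on_mult continuous_on_q continuous_on_subset[OF continuous_on_psi2]
      continuous_on_subset[OF continuous_on_psi2_over] continuous_on_power continuous_on_id; simp)+

text \<open>
  The Wronskians with the two homogeneous solutions \<open>r\<^sup>2\<close> and \<open>r\<^sup>-\<^sup>3\<close> integrate the equation;
  regularity at the origin annihilates the coefficient of \<open>r\<^sup>-\<^sup>3\<close>.
\<close>

lemma psi2_representation:
  shows "\<exists>k. \<forall>r>0. r ^ 4 * deriv \<psi> r = 2 * r ^ 3 * \<psi> r - inner_moment r \<and>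
    deriv \<psi> r / r + 3 * \<psi> r / r\<^sup>2 = k - outer_moment r \<and>
    5 * \<psi> r = r\<^sup>2 * (k - outer_moment r) + inner_moment r / r ^ 3"
proof -
  let ?q = "\<lambda>s. \<nu> * max 0 (\<theta> s) powr (\<nu> - 1)"
  let ?U = "\<lambda>r. r\<^sup>2 * deriv \<psi> r"
  let ?a = "\<lambda>r. inner_moment r" and ?e = "\<lambda>r. outer_moment r"
  have da: "(?a has_real_derivative ?q r * \<psi> r * r ^ 4) (at r)" if "0 < r" for r
    by (rule DERIV_integral_from_0[OF continuous_on_moments(1), of "r + 1"]) (use that in auto)
  have de: "(?e has_real_derivative ?q r * (\<psi> r / r)) (at r)" if "0 < r" for r
    by (rule DERIV_integral_from_0[OF continuous_on_moments(2), of "r + 1"]) (use that in auto)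
  have "((\<lambda>r. r\<^sup>2 * ?U r - 2 * r ^ 3 * \<psi> r + ?a r) has_real_derivative 0) (at r)" if r: "0 < r" for r
    by (rule DERIV_cong[OF DERIV_add[OF DERIV_diff[OF DERIV_mult[OF DERIV_pow DERIV_psi2_flux[OF r]]
          DERIV_mult[OF DERIV_cmult[OF DERIV_pow] DERIV_psi2[OF r]]] da[OF r]]])
       (simp add: algebra_simps power2_eq_square power3_eq_cube power4_eq_xxxx)
  then have "\<exists>c. \<forall>r\<in>{0<..}. r\<^sup>2 * ?U r - 2 * r ^ 3 * \<psi> r + ?a r = c"
    by (intro has_field_derivative_zero_constant) (auto intro: has_field_derivative_at_within)
  then obtain c where c: "\<And>r. 0 < r \<Longrightarrow> r\<^sup>2 * ?U r - 2 * r ^ 3 * \<psi> r + ?a r = c" by auto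
  have "((\<lambda>r. ?U r / r ^ 3 + 3 * \<psi> r / r\<^sup>2 + ?e r) has_real_derivative 0) (at r)" if r: "0 < r" for r
    by (rule DERIV_cong[OF DERIV_add[OF DERIV_add[OF DERIV_divide[OF DERIV_psi2_flux[OF r] DERIV_pow]
          DERIV_divide[OF DERIV_cmult[OF DERIV_psi2[OF r]] DERIV_pow]] de[OF r]]])
       (use r in \<open>auto simp: field_simps power2_eq_square power3_eq_cube power4_eq_xxxx\<close>)
  then have "\<exists>k. \<forall>r\<in>{0<..}. ?U r / r ^ 3 + 3 * \<psi> r / r\<^sup>2 + ?e r = k"
    by (intro has_field_derivative_zero_constant) (auto intro: has_field_derivative_at_within)
  then obtain k where k: "\<And>r. 0 < r \<Longrightarrow> ?U r / r ^ 3 + 3 * \<psi> r / r\<^sup>2 + ?e r = k" by auto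
  \<comment> \<open>Eliminating \<psi>' leaves a relation for \<psi> alone, in which a nonzero
    \<open>c\<close> would be an r^-3 term. Its limit at the origin can be taken although the
    behavior of \<psi>' there is not known.\<close>
  have comb: "5 * r ^ 3 * \<psi> r = r ^ 5 * (k - ?e r) + ?a r - c" if r: "0 < r" for r
  proof -
    have "r ^ 5 * (k - ?e r) = r ^ 5 * (?U r / r ^ 3 + 3 * \<psi> r / r\<^sup>2)" using k[OF r] by auto
    also have "\<dots> = r\<^sup>2 * ?U r + 3 * r ^ 3 * \<psi> r"
      using r by (simp add: field_simps eval_nat_numeral)
    finally show ?thesis using c[OF r] by (simp add: algebra_simps)
  qed
  have "((\<lambda>r. r ^ 5 * (k - ?e r) + ?a r - 5 * r ^ 3 * \<psi> r) \<longlongrightarrow> 0 ^ 5 * (k - 0) + 0 - 5 * 0 ^ 3 * 0) (at_right 0)"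
    by (intro tendsto_intros psi2_tendsto_0 integral_from_0_tendsto_0[of 1] continuous_on_moments) auto
  moreover have "\<forall>\<^sub>F r in at_right 0. r ^ 5 * (k - ?e r) + ?a r - 5 * r ^ 3 * \<psi> r = c"
    using comb by (auto simp: eventually_at_right_field intro!: exI[of _ 1])
  ultimately have "((\<lambda>r. c) \<longlongrightarrow> 0 ^ 5 * (k - 0) + 0 - 5 * 0 ^ 3 * 0) (at_right (0::real))"
    by (rule Lim_transform_eventually)
  then have c0: "c = 0" by (simp add: tendsto_const_iff)
  show ?thesis
  proof (intro exI[of _ k] allI impI conjI)
    fix r :: real assume r: "0 < r"
    show "r ^ 4 * deriv \<psi> r = 2 * r ^ 3 * \<psi> r - ?a r"
      using c[OF r] c0 by (simp add: algebra_simps eval_nat_numeral)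
    show "deriv \<psi> r / r + 3 * \<psi> r / r\<^sup>2 = k - ?e r"
      using k[OF r] r by (simp add: algebra_simps power2_eq_square power3_eq_cube)
    have "5 * \<psi> r = (5 * r ^ 3 * \<psi> r) / r ^ 3" using r by simp
    also have "\<dots> = r\<^sup>2 * (k - ?e r) + ?a r / r ^ 3"
      unfolding comb[OF r] c0 using r by (simp add: add_divide_distrib eval_nat_numeral)
    finally show "5 * \<psi> r = r\<^sup>2 * (k - ?e r) + ?a r / r ^ 3" .
  qed
qed

text \<open>
  \<open>sturm_wronskian\<close> is \<open>r\<^sup>2\<close> times the Wronskian of \<open>\<psi>\<^sub>2\<close> and \<open>- \<theta>'\<close>, a positive solution of the equation with
  \<open>2/r\<^sup>2\<close> in place of \<open>6/r\<^sup>2\<close> (Sturm comparison).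
\<close>

definition "sturm_wronskian r = r\<^sup>2 * deriv \<psi> r * (lane_emden_flux \<nu> \<theta> r / r\<^sup>2) - \<psi> r * (r\<^sup>2 * max 0 (\<theta> r) powr \<nu> - 2 * lane_emden_flux \<nu> \<theta> r / r)"

text \<open>The terms with \<open>\<nu> * max 0 (\<theta> r) powr (\<nu> - 1)\<close> are common to
  both equations and cancel; the factor 4 is 6 - 2, the gap between the centrifugal terms.\<close>

lemma DERIV_sturm_wronskian:
  assumes r: "0 < r"
  shows "(sturm_wronskian has_real_derivative 4 * \<psi> r * lane_emden_flux \<nu> \<theta> r / r\<^sup>2) (at r)"
proof -
  let ?M = "lane_emden_flux \<nu> \<theta>"
  have dM: "(?M has_real_derivative max 0 (\<theta> r) powr \<nu> * r\<^sup>2) (at r)"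
    by (rule DERIV_lane_emden_flux[OF LE nu r])
  have df: "((\<lambda>r. max 0 (\<theta> r) powr \<nu>) has_real_derivative \<nu> * max 0 (\<theta> r) powr (\<nu> - 1) * (- ?M r / r\<^sup>2)) (at r)"
    using DERIV_chain2[OF DERIV_pos_part_powr[OF nu] DERIV_theta[OF LE nu r]] .
  show ?thesis unfolding sturm_wronskian_def[abs_def]
    by (rule DERIV_cong[OF DERIV_diff[OF DERIV_mult[OF DERIV_psi2_flux[OF r] DERIV_divide[OF dM DERIV_pow]]
       DERIV_mult[OF DERIV_psi2[OF r] DERIV_diff[OF DERIV_mult[OF DERIV_pow df] DERIV_divide[OF DERIV_cmult[OF dM] DERIV_ident]]]]])
      (use r in \<open>auto simp: field_simps power2_eq_square power4_eq_xxxx\<close>)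
qed

text \<open>The asymptotics of \<psi> do not control \<psi>', so \<psi>' is eliminated by the
  Wronskian identity with r^2; what remains tends to 0 term by term.\<close>

lemma sturm_wronskian_tendsto_0: "(sturm_wronskian \<longlongrightarrow> 0) (at_right 0)"
proof -
  obtain k where "\<forall>r>0. r ^ 4 * deriv \<psi> r = 2 * r ^ 3 * \<psi> r - inner_moment r \<and>
    deriv \<psi> r / r + 3 * \<psi> r / r\<^sup>2 = k - outer_moment r \<and>
    5 * \<psi> r = r\<^sup>2 * (k - outer_moment r) + inner_moment r / r ^ 3"
    using psi2_representation by (rule exE)
  then have k: "r ^ 4 * deriv \<psi> r = 2 * r ^ 3 * \<psi> r - inner_moment r" if "0 < r" for r
    using that by simp
  let ?M = "lane_emden_flux \<nu> \<theta>" and ?f = "\<lambda>r. max 0 (\<theta> r) powr \<nu>"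
  have "continuous_on {0..1} (\<lambda>s. \<nu> * max 0 (\<theta> s) powr (\<nu> - 1) * \<psi> s)"
    by (intro continuous_on_mult[OF continuous_on_q] continuous_on_subset[OF continuous_on_psi2]) auto
  from integral_from_0_power_bound[OF this, of 4]
  obtain A where A: "0 \<le> A" "\<forall>r\<in>{0..1}. \<bar>inner_moment r\<bar> \<le> A * r ^ Suc 4" by (elim exE conjE)
  have "continuous_on {0..1} ?f"
    using nu by (intro continuous_on_subset_theta_powr[OF LE nu]) auto
  from integral_from_0_power_bound[OF this, of 2]
  obtain B where B: "0 \<le> B" "\<forall>r\<in>{0..1}. \<bar>?M r\<bar> \<le> B * r ^ Suc 2"
    unfolding lane_emden_flux_def by (elim exE conjE)
  have sturm_wronskian_eq: "sturm_wronskian r = 4 * \<psi> r * (?M r / r) - inner_moment r * ?M r / r ^ 4 - \<psi> r * (r\<^sup>2 * ?f r)" if r: "0 < r" for r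
  proof -
    have "deriv \<psi> r = (2 * r ^ 3 * \<psi> r - inner_moment r) / r ^ 4" using k[OF r] r by (simp add: field_simps)
    then show ?thesis unfolding sturm_wronskian_def \<open>deriv \<psi> r = _\<close> using r by (simp add: field_simps eval_nat_numeral)
  qed
  have M: "((\<lambda>r. ?M r / r) \<longlongrightarrow> 0) (at_right 0)"
    unfolding lane_emden_flux_def
    by (rule integral_from_0_over_tendsto_0[of 1])
       (use nu in \<open>auto intro!: continuous_intros continuous_on_subset_theta_powr[OF LE nu]\<close>)
  have f: "(?f \<longlongrightarrow> ?f 0) (at_right 0)"
  proof -
    have "continuous_on {0..} ?f" using nu by (intro continuous_on_theta_powr[OF LE nu]) auto
    then have "\<forall>x\<in>{0..}. (?f \<longlongrightarrow> ?f x) (at x within {0..})" unfolding continuous_on_def .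
    then have "(?f \<longlongrightarrow> ?f 0) (at 0 within {0..})" by (rule bspec) simp
    then show ?thesis by (rule tendsto_within_subset) auto
  qed
  have am: "((\<lambda>r. inner_moment r * ?M r / r ^ 4) \<longlongrightarrow> 0) (at_right 0)"
  proof (rule Lim_null_comparison)
    have "((\<lambda>r::real. A * B * r ^ 4) \<longlongrightarrow> A * B * 0 ^ 4) (at_right 0)" by (intro tendsto_intros)
    then show "((\<lambda>r::real. A * B * r ^ 4) \<longlongrightarrow> 0) (at_right 0)" by simp
    have "norm (inner_moment r * ?M r / r ^ 4) \<le> A * B * r ^ 4" if r: "0 < r" "r < 1" for r
    proof -
      have "norm (inner_moment r * ?M r / r ^ 4) = \<bar>inner_moment r\<bar> * \<bar>?M r\<bar> / r ^ 4"
        using r by (simp add: abs_mult)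
      also have "\<dots> \<le> (A * r ^ Suc 4) * (B * r ^ Suc 2) / r ^ 4"
        using r A B by (intro divide_right_mono mult_mono) auto
      also have "\<dots> = A * B * r ^ 4" using r by (simp add: eval_nat_numeral)
      finally show ?thesis .
    qed
    then show "\<forall>\<^sub>F r in at_right 0. norm (inner_moment r * ?M r / r ^ 4) \<le> A * B * r ^ 4"
      by (auto simp: eventually_at_right_field intro!: exI[of _ 1])
  qed
  have "((\<lambda>r. 4 * \<psi> r * (?M r / r) - inner_moment r * ?M r / r ^ 4 - \<psi> r * (r\<^sup>2 * ?f r)) \<longlongrightarrow>
      4 * 0 * 0 - 0 - 0 * (0\<^sup>2 * ?f 0)) (at_right 0)"
    by (intro tendsto_intros psi2_tendsto_0 M f am)
  moreover have "\<forall>\<^sub>F r in at_right 0. 4 * \<psi> r * (?M r / r) - inner_moment r * ?M r / r ^ 4 - \<psi> r * (r\<^sup>2 * ?f r) = sturm_wronskian r"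
    using sturm_wronskian_eq by (auto simp: eventually_at_right_field intro!: exI[of _ 1])
  ultimately have "(sturm_wronskian \<longlongrightarrow> 4 * 0 * 0 - 0 - 0 * (0\<^sup>2 * ?f 0)) (at_right 0)" by (rule Lim_transform_eventually)
  then show ?thesis by simp
qed

lemma sturm_wronskian_pos:
  assumes pos: "\<And>s. 0 < s \<Longrightarrow> s < r \<Longrightarrow> 0 < \<psi> s" and r: "0 < r"
  shows "0 < sturm_wronskian r"
proof -
  have mono: "sturm_wronskian s < sturm_wronskian t" if "0 < s" "s < t" "t \<le> r" for s t
  proof (rule DERIV_pos_imp_increasing_open[OF that(2)])
    fix x assume x: "s < x" "x < t"
    show "\<exists>y. DERIV sturm_wronskian x :> y \<and> 0 < y"
      using DERIV_sturm_wronskian[of x] pos[of x] lane_emden_flux_pos[OF LE nu, of x] x that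
      by (intro exI[of _ "4 * \<psi> x * lane_emden_flux \<nu> \<theta> x / x\<^sup>2"]) auto
  next
    show "continuous_on {s..t} sturm_wronskian"
      using that by (intro continuous_at_imp_continuous_on ballI DERIV_isCont[OF DERIV_sturm_wronskian]) auto
  qed
  \<comment> \<open>The limit 0 at the origin lies below every later value of an increasing
    function; strictness is gained between r / 2 and r.\<close>
  have "0 \<le> sturm_wronskian (r / 2)"
  proof (rule tendsto_upperbound[OF sturm_wronskian_tendsto_0])
    show "\<forall>\<^sub>F x in at_right 0. sturm_wronskian x \<le> sturm_wronskian (r / 2)"
      using mono[of _ "r / 2"] r by (auto simp: eventually_at_right_field less_imp_le intro!: exI[of _ "r / 2"])
  qed auto
  also have "\<dots> < sturm_wronskian r" using r by (intro mono) auto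
  finally show ?thesis .
qed

text \<open>As long as \<psi> is positive, the Wronskian is positive and the quotient of \<psi> by
  -\<theta>' increases. It cannot have dropped to 0 at a first zero of \<psi>.\<close>

lemma psi2_pos:
  assumes "0 < r"
  shows "0 < \<psi> r"
proof (rule ccontr)
  assume neg: "\<not> 0 < \<psi> r"
  let ?M = "lane_emden_flux \<nu> \<theta>"
  have "\<forall>\<^sub>F r in at_right 0. 0 < \<psi> r / r\<^sup>2"
    using psi2_asymp by (rule order_tendstoD) simp
  then obtain b where b: "0 < b" "\<And>s. 0 < s \<Longrightarrow> s < b \<Longrightarrow> 0 < \<psi> s"
    by (auto simp: eventually_at_right_field zero_less_divide_iff)
  \<comment> \<open>The cut at \<open>b / 2\<close> keeps the origin, where \<psi> also vanishes,
    out of the closed set whose infimum is the first nonpositive point.\<close>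
  define S where "S = {s \<in> {b / 2..r}. \<psi> s \<le> 0}"
  have rb: "b \<le> r" using b(2)[OF assms] neg by (cases "r < b") auto
  have "closed S"
  proof -
    have "continuous_on {b / 2..r} \<psi>" using b by (intro continuous_on_subset[OF continuous_on_psi2]) auto
    then have "closed ({b / 2..r} \<inter> \<psi> -` {..0})" by (rule continuous_closed_preimage) auto
    moreover have "{b / 2..r} \<inter> \<psi> -` {..0} = S" by (auto simp: S_def)
    ultimately show ?thesis by simp
  qed
  moreover have "S \<noteq> {}" using neg rb b by (auto simp: S_def)
  moreover have "bdd_below S" by (rule bdd_belowI[of _ "b / 2"]) (auto simp: S_def)
  ultimately have S: "Inf S \<in> S" by (intro closed_contains_Inf)
  define t where "t = Inf S"
  have t: "b / 2 \<le> t" "\<psi> t \<le> 0" "t \<le> r" using S by (auto simp: S_def t_def)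
  have tp: "0 < t" using t b by simp
  have pos: "0 < \<psi> s" if "0 < s" "s < t" for s
  proof (rule ccontr)
    assume "\<not> 0 < \<psi> s"
    then have "s \<in> S" using that t b(2)[OF that(1)] by (cases "s < b") (auto simp: S_def)
    then have "t \<le> s" unfolding t_def using \<open>bdd_below S\<close> by (rule cInf_lower)
    then show False using that by simp
  qed
  have d: "((\<lambda>r. \<psi> r / (?M r / r\<^sup>2)) has_real_derivative sturm_wronskian x * x\<^sup>2 / (?M x)\<^sup>2) (at x)" if x: "0 < x" for x
    by (rule DERIV_cong[OF DERIV_divide[OF DERIV_psi2[OF x] DERIV_divide[OF DERIV_lane_emden_flux[OF LE nu x] DERIV_pow]]])
       (use x lane_emden_flux_pos[OF LE nu x] in \<open>auto simp: sturm_wronskian_def field_simps power2_eq_square\<close>)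
  have "\<psi> (t / 2) / (?M (t / 2) / (t / 2)\<^sup>2) < \<psi> t / (?M t / t\<^sup>2)"
  proof (rule DERIV_pos_imp_increasing[where f = "\<lambda>r. \<psi> r / (?M r / r\<^sup>2)"])
    show "t / 2 < t" using tp by simp
    fix x assume x: "t / 2 \<le> x" "x \<le> t"
    then have x0: "0 < x" using tp by simp
    have "0 < sturm_wronskian x" using x by (intro sturm_wronskian_pos pos x0) auto
    then show "\<exists>y. ((\<lambda>r. \<psi> r / (?M r / r\<^sup>2)) has_real_derivative y) (at x) \<and> 0 < y"
      using d[OF x0] lane_emden_flux_pos[OF LE nu x0] x0 by (intro exI[of _ "sturm_wronskian x * x\<^sup>2 / (?M x)\<^sup>2"]) auto
  qed
  moreover have "0 < \<psi> (t / 2) / (?M (t / 2) / (t / 2)\<^sup>2)"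
    using pos[of "t / 2"] tp lane_emden_flux_pos[OF LE nu, of "t / 2"] by auto
  moreover have "\<psi> t / (?M t / t\<^sup>2) \<le> 0"
    using t tp lane_emden_flux_pos[OF LE nu tp] by (intro divide_nonpos_pos divide_pos_pos) auto
  ultimately show False by linarith
qed

text \<open>At \<xi> the power of \<theta> vanishes, and the positive Wronskian reduces to a
  positive multiple of \<open>\<xi> * deriv \<psi> \<xi> + 2 * \<psi> \<xi>\<close>; one more
  \<open>\<psi> \<xi>\<close> gives the denominator of \<open>coeff_A2\<close>.\<close>

lemma psi2_boundary_pos: "0 < 3 * \<psi> \<xi> + \<xi> * deriv \<psi> \<xi>"
proof -
  let ?M = "lane_emden_flux \<nu> \<theta>"
  note xi = xi_pos[OF LE nu]
  have M: "0 < ?M \<xi>" by (rule lane_emden_flux_pos[OF LE nu xi])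
  have "0 < sturm_wronskian \<xi>" by (intro sturm_wronskian_pos psi2_pos xi) auto
  also have "sturm_wronskian \<xi> = ?M \<xi> / \<xi> * (\<xi> * deriv \<psi> \<xi> + 2 * \<psi> \<xi>)"
    using xi theta_xi[OF LE nu] nu by (simp add: sturm_wronskian_def field_simps power2_eq_square)
  finally have "0 < \<xi> * deriv \<psi> \<xi> + 2 * \<psi> \<xi>" using M xi by (simp add: zero_less_mult_iff zero_less_divide_iff)
  then show ?thesis using psi2_pos[OF xi] by simp
qed

text \<open>The kernel takes the outer moment from r to the edge, while the representation of \<psi>
  carries the constant \<open>k\<close> minus the moment up to r. The mismatch
  \<open>k - outer_moment \<xi>\<close> is read off from the Wronskian with r^-3 at \<xi>, and it is
  the coefficient of r^2 on the right.\<close>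

lemma psi2_integral_equation:
  assumes R: "\<xi> \<le> R" and r: "r \<in> {0..R}"
  shows "1/5 * integral {0..R} (\<lambda>s. \<nu> * max 0 (\<theta> s) powr (\<nu> - 1) * \<psi> s * (s\<^sup>2 * (min r s)\<^sup>2 / max r s ^ 3)) =
    \<psi> r - (3 * \<psi> \<xi> + \<xi> * deriv \<psi> \<xi>) / (5 * \<xi>\<^sup>2) * r\<^sup>2"
proof (cases "r = 0")
  case True
  have "integral {0..R} (\<lambda>s. \<nu> * max 0 (\<theta> s) powr (\<nu> - 1) * \<psi> s * (s\<^sup>2 * (min r s)\<^sup>2 / max r s ^ 3)) = integral {0..R} (\<lambda>s. 0)"
    by (intro Henstock_Kurzweil_Integration.integral_cong) (use True in auto)
  then show ?thesis using True psi2_0 by simp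
next
  case False
  then have r0: "0 < r" using r by simp
  note xi = xi_pos[OF LE nu]
  obtain k where "\<forall>r>0. r ^ 4 * deriv \<psi> r = 2 * r ^ 3 * \<psi> r - inner_moment r \<and>
    deriv \<psi> r / r + 3 * \<psi> r / r\<^sup>2 = k - outer_moment r \<and>
    5 * \<psi> r = r\<^sup>2 * (k - outer_moment r) + inner_moment r / r ^ 3"
    using psi2_representation by (rule exE)
  then have k: "deriv \<psi> r / r + 3 * \<psi> r / r\<^sup>2 = k - outer_moment r"
      "5 * \<psi> r = r\<^sup>2 * (k - outer_moment r) + inner_moment r / r ^ 3" if "0 < r" for r
    using that by simp_all
  let ?q = "\<lambda>s. \<nu> * max 0 (\<theta> s) powr (\<nu> - 1)"
  let ?g = "\<lambda>s. ?q s * \<psi> s * (s\<^sup>2 * (min r s)\<^sup>2 / max r s ^ 3)"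
  have "continuous_on {0..R} ?g"
    using r0 by (intro continuous_on_mult continuous_on_q continuous_on_subset[OF continuous_on_psi2] continuous_intros) auto
  then have "integral {0..R} ?g = integral {0..r} ?g + integral {r..R} ?g"
    using r by (intro Henstock_Kurzweil_Integration.integral_combine[symmetric] integrable_continuous_interval) auto
  moreover have "integral {0..r} ?g = integral {0..r} (\<lambda>s. 1 / r ^ 3 * (?q s * \<psi> s * s ^ 4))"
    by (intro Henstock_Kurzweil_Integration.integral_cong) (auto simp: min_def max_def eval_nat_numeral)
  moreover have "integral {r..R} ?g = integral {r..R} (\<lambda>s. r\<^sup>2 * (?q s * (\<psi> s / s)))"
    by (intro Henstock_Kurzweil_Integration.integral_cong) (use r0 in \<open>auto simp: min_def max_def eval_nat_numeral\<close>)
  ultimately have g: "integral {0..R} ?g = 1 / r ^ 3 * inner_moment r + r\<^sup>2 * integral {r..R} (\<lambda>s. ?q s * (\<psi> s / s))"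
    by (simp only: Henstock_Kurzweil_Integration.integral_mult_right)
  have "outer_moment R = outer_moment r + integral {r..R} (\<lambda>s. ?q s * (\<psi> s / s))"
    using r by (intro Henstock_Kurzweil_Integration.integral_combine[symmetric] integrable_continuous_interval continuous_on_moments) auto
  \<comment> \<open>The source vanishes beyond \<xi>, so the radius \<open>R\<close> of the domain
    drops out.\<close>
  moreover have "outer_moment R = outer_moment \<xi>"
  proof -
    have "integral {0..R} (\<lambda>s. max 0 (\<theta> s) powr (\<nu> - 1) * (\<nu> * (\<psi> s / s))) =
        integral {0..\<xi>} (\<lambda>s. max 0 (\<theta> s) powr (\<nu> - 1) * (\<nu> * (\<psi> s / s)))"
      using nu by (intro integral_pos_part_theta_beyond[OF LE nu] R continuous_on_mult continuous_on_const continuous_on_psi2_over) auto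
    moreover have "(\<lambda>s. max 0 (\<theta> s) powr (\<nu> - 1) * (\<nu> * (\<psi> s / s))) = (\<lambda>s. ?q s * (\<psi> s / s))" by auto
    ultimately show ?thesis by simp
  qed
  ultimately have Y: "integral {r..R} (\<lambda>s. ?q s * (\<psi> s / s)) = outer_moment \<xi> - outer_moment r" by linarith
  have X: "1 / r ^ 3 * inner_moment r = 5 * \<psi> r - r\<^sup>2 * (k - outer_moment r)"
    using k(2)[OF r0] by simp
  have "deriv \<psi> \<xi> / \<xi> + 3 * \<psi> \<xi> / \<xi>\<^sup>2 = (3 * \<psi> \<xi> + \<xi> * deriv \<psi> \<xi>) / \<xi>\<^sup>2"
    using xi by (simp add: field_simps power2_eq_square)
  then have "(3 * \<psi> \<xi> + \<xi> * deriv \<psi> \<xi>) / \<xi>\<^sup>2 = k - outer_moment \<xi>"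
    using k(1)[OF xi] by (rule subst)
  moreover have "(3 * \<psi> \<xi> + \<xi> * deriv \<psi> \<xi>) / (5 * \<xi>\<^sup>2) = (3 * \<psi> \<xi> + \<xi> * deriv \<psi> \<xi>) / \<xi>\<^sup>2 / 5"
    by (simp add: mult.commute)
  ultimately have w: "(3 * \<psi> \<xi> + \<xi> * deriv \<psi> \<xi>) / (5 * \<xi>\<^sup>2) = (k - outer_moment \<xi>) / 5"
    by (simp only:)
  show ?thesis unfolding g X Y w by (simp add: algebra_simps diff_divide_distrib)
qed

end

text \<open>Shells outside r contribute a constant to the potential, which the normalization at the
  origin removes; only the matter inside r remains.\<close>

lemma integral_radial_kernel_split:
  fixes f :: "real \<Rightarrow> real"
  assumes f: "continuous_on {0..R} f" and r: "r \<in> {0..R}"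
  shows "integral {0..R} (\<lambda>s. f s * (s\<^sup>2 / max r s)) - integral {0..R} (\<lambda>s. f s * s) =
    integral {0..r} (\<lambda>s. f s * s\<^sup>2) / r - integral {0..r} (\<lambda>s. f s * s)"
proof (cases "r = 0")
  case True
  have "integral {0..R} (\<lambda>s. f s * (s\<^sup>2 / max r s)) = integral {0..R} (\<lambda>s. f s * s)"
    by (intro Henstock_Kurzweil_Integration.integral_cong) (use True in \<open>auto simp: power2_eq_square\<close>)
  then show ?thesis using True by simp
next
  case False
  then have r0: "0 < r" using r by simp
  have "continuous_on {0..R} (\<lambda>s. f s * (s\<^sup>2 / max r s))"
    using r0 by (intro continuous_intros f) auto
  then have "integral {0..R} (\<lambda>s. f s * (s\<^sup>2 / max r s)) =
      integral {0..r} (\<lambda>s. f s * (s\<^sup>2 / max r s)) + integral {r..R} (\<lambda>s. f s * (s\<^sup>2 / max r s))"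
    using r by (intro Henstock_Kurzweil_Integration.integral_combine[symmetric] integrable_continuous_interval) auto
  moreover have "integral {0..r} (\<lambda>s. f s * (s\<^sup>2 / max r s)) = integral {0..r} (\<lambda>s. 1 / r * (f s * s\<^sup>2))"
    by (intro Henstock_Kurzweil_Integration.integral_cong) (auto simp: max_def)
  moreover have "\<dots> = integral {0..r} (\<lambda>s. f s * s\<^sup>2) / r" unfolding Henstock_Kurzweil_Integration.integral_mult_right by simp
  moreover have "integral {r..R} (\<lambda>s. f s * (s\<^sup>2 / max r s)) = integral {r..R} (\<lambda>s. f s * s)"
    by (intro Henstock_Kurzweil_Integration.integral_cong) (use r0 in \<open>auto simp: max_def power2_eq_square\<close>)
  moreover have "integral {0..R} (\<lambda>s. f s * s) = integral {0..r} (\<lambda>s. f s * s) + integral {r..R} (\<lambda>s. f s * s)"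
    using r by (intro Henstock_Kurzweil_Integration.integral_combine[symmetric] integrable_continuous_interval continuous_intros f) auto
  ultimately show ?thesis by simp
qed

section \<open>The linearized equation\<close>

lemma op_G_eq_lin_pot:
  assumes "continuous_on (dom_E R) u" "0 < \<nu>" "p \<in> dom_E R"
  shows "op_G \<nu> R u p = 1 + lin_pot R (\<lambda>p. max 0 (u p) powr \<nu>) p"
proof -
  obtain r \<zeta> where p: "p = (r, \<zeta>)" by fastforce
  have "continuous_on (dom_E R) (\<lambda>p. max 0 (u p) powr \<nu>)" by (intro continuous_intros assms)
  from lin_pot_eq_LBINT[OF this, of r \<zeta>] show ?thesis
    using assms(3) by (simp add: p op_G_def on_dom_def)
qed

text \<open>Derivative at \<theta> of the power of the positive part, in direction \<open>h\<close>;
  its \<open>lin_pot\<close> is \<open>op_DG\<close>.\<close>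

definition linear_source :: "real \<Rightarrow> (real \<Rightarrow> real) \<Rightarrow> (real \<times> real \<Rightarrow> real) \<Rightarrow> real \<times> real \<Rightarrow> real" where
  "linear_source \<nu> \<theta> h = (\<lambda>p. \<nu> * max 0 (\<theta> (fst p)) powr (\<nu> - 1) * h p)"

lemma op_DG_eq_lin_pot:
  assumes h: "continuous_on (dom_E R) h" and \<theta>: "continuous_on {0..R} \<theta>" and "1 < \<nu>" and pd: "p \<in> dom_E R"
  shows "op_DG \<nu> R \<theta> h p = lin_pot R (linear_source \<nu> \<theta> h) p"
proof -
  obtain r \<zeta> where p: "p = (r, \<zeta>)" by fastforce
  let ?v = "\<lambda>p. max 0 (\<theta> (fst p)) powr (\<nu> - 1) * h p"
  have "continuous_on (dom_E R) ?v"
    using assms(3) by (intro continuous_intros h continuous_on_compose2[OF \<theta>]) auto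
  from lin_pot_eq_LBINT[OF this, of r \<zeta>]
  have "op_DG \<nu> R \<theta> h p = \<nu> * lin_pot R ?v p"
    using pd by (simp add: p op_DG_def on_dom_def mult.assoc right_diff_distrib)
  also have "\<dots> = lin_pot R (\<lambda>p. \<nu> * ?v p) p" by (rule lin_pot_scale[symmetric])
  finally show ?thesis by (simp add: linear_source_def mult.assoc)
qed

lemma continuous_on_linear_source:
  assumes "continuous_on (dom_E R) h" "continuous_on {0..R} \<theta>" "1 < \<nu>"
  shows "continuous_on (dom_E R) (linear_source \<nu> \<theta> h)"
  unfolding linear_source_def
  using assms(3) by (intro continuous_intros assms(1) continuous_on_compose2[OF assms(2)]) auto

section \<open>Sup norm, Lipschitz and Taylor bounds\<close>

lemma dom_E_nonempty: "0 \<le> R \<Longrightarrow> dom_E R \<noteq> {}" by auto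

lemma abs_le_norm_E:
  assumes "continuous_on (dom_E R) u" "p \<in> dom_E R"
  shows "\<bar>u p\<bar> \<le> norm_E R u"
proof -
  have "0 \<le> R" using assms(2) by auto
  then obtain V where "0 \<le> V" "\<And>p. p \<in> dom_E R \<Longrightarrow> \<bar>u p\<bar> \<le> V"
    using continuous_on_dom_bounded[OF assms(1)] by blast
  then have "bdd_above ((\<lambda>p. \<bar>u p\<bar>) ` dom_E R)" by (intro bdd_aboveI2[where M = V])
  then show ?thesis unfolding norm_E_def by (intro cSUP_upper assms(2))
qed

lemma norm_E_le:
  assumes "0 \<le> R" "\<And>p. p \<in> dom_E R \<Longrightarrow> \<bar>u p\<bar> \<le> c"
  shows "norm_E R u \<le> c"
  unfolding norm_E_def by (intro cSUP_least dom_E_nonempty assms)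

lemma pos_part_powr_Lipschitz:
  fixes x y :: real
  assumes a: "1 \<le> a" and M: "0 < M" "\<bar>x\<bar> \<le> M" "\<bar>y\<bar> \<le> M"
  shows "\<bar>max 0 x powr a - max 0 y powr a\<bar> \<le> a * M powr (a - 1) * \<bar>x - y\<bar>"
\<comment> \<open>The exponent 1 occurs as \<open>\<nu> - 1\<close> when \<open>\<nu> = 2\<close>;
  the positive part itself is not differentiable at 0 and is treated directly.\<close>
proof (cases "a = 1")
  case True
  then show ?thesis using M by (auto simp: max_def)
next
  case False
  then have a1: "1 < a" using a by simp
  have "norm (max 0 x powr a - max 0 y powr a) \<le> a * M powr (a - 1) * norm (x - y)"
  proof (rule field_differentiable_bound[where S = "{-M..M}"])
    fix z assume z: "z \<in> {-M..M}"
    show "((\<lambda>x. max 0 x powr a) has_field_derivative a * max 0 z powr (a - 1)) (at z within {-M..M})"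
      by (rule has_field_derivative_at_within[OF DERIV_pos_part_powr[OF a1]])
    have "max 0 z powr (a - 1) \<le> M powr (a - 1)" using z a1 M by (intro powr_mono2) auto
    then show "norm (a * max 0 z powr (a - 1)) \<le> a * M powr (a - 1)" using a by (auto simp: abs_mult)
  qed (use M in auto)
  then show ?thesis by simp
qed

text \<open>The power minus its tangent at \<open>y\<close> has as derivative \<open>a\<close> times
  a difference of powers with exponent \<open>a - 1 \<ge> 1\<close>, and these are Lipschitz. The
  bound \<open>2 \<le> a\<close> thus makes the remainder quadratic.\<close>

lemma pos_part_powr_Taylor:
  fixes x y :: real
  assumes a: "2 \<le> a" and M: "0 < M" "\<bar>x\<bar> \<le> M" "\<bar>y\<bar> \<le> M"
  shows "\<bar>max 0 x powr a - max 0 y powr a - a * max 0 y powr (a - 1) * (x - y)\<bar>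
    \<le> a * ((a - 1) * M powr (a - 2)) * (x - y)\<^sup>2"
proof -
  define f where "f z = max 0 z powr a - a * max 0 y powr (a - 1) * z" for z
  let ?S = "{min x y..max x y}"
  have "norm (f x - f y) \<le> (a * ((a - 1) * M powr (a - 2)) * \<bar>x - y\<bar>) * norm (x - y)"
  proof (rule field_differentiable_bound[where S = ?S])
    fix z assume z: "z \<in> ?S"
    show "(f has_field_derivative a * max 0 z powr (a - 1) - a * max 0 y powr (a - 1)) (at z within ?S)"
      unfolding f_def[abs_def]
      by (rule has_field_derivative_at_within,
          rule DERIV_cong[OF DERIV_diff[OF DERIV_pos_part_powr DERIV_cmult[OF DERIV_ident]]])
         (use a in auto)
    have "\<bar>max 0 z powr (a - 1) - max 0 y powr (a - 1)\<bar> \<le> (a - 1) * M powr (a - 1 - 1) * \<bar>z - y\<bar>"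
      using z M a by (intro pos_part_powr_Lipschitz) auto
    also have "\<dots> \<le> (a - 1) * M powr (a - 1 - 1) * \<bar>x - y\<bar>"
      using z a by (intro mult_left_mono) auto
    finally have "a * \<bar>max 0 z powr (a - 1) - max 0 y powr (a - 1)\<bar> \<le> a * ((a - 1) * M powr (a - 1 - 1) * \<bar>x - y\<bar>)"
      using a by (intro mult_left_mono) auto
    then show "norm (a * max 0 z powr (a - 1) - a * max 0 y powr (a - 1)) \<le> a * ((a - 1) * M powr (a - 2)) * \<bar>x - y\<bar>"
      using a by (simp add: right_diff_distrib[symmetric] abs_mult mult_ac)
  qed auto
  moreover have "f x - f y = max 0 x powr a - max 0 y powr a - a * max 0 y powr (a - 1) * (x - y)"
    by (simp add: f_def algebra_simps)
  moreover have "(x - y)\<^sup>2 = \<bar>x - y\<bar> * \<bar>x - y\<bar>" by (simp add: power2_eq_square)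
  ultimately show ?thesis by (simp only: real_norm_def mult.assoc)
qed

lemma nu_gt_1: "2 \<le> \<nu> \<Longrightarrow> 1 < \<nu>" for \<nu> :: real by simp

section \<open>The spherical solution as a fixed point\<close>

context
  fixes \<nu> \<xi> R :: real and \<theta> :: "real \<Rightarrow> real"
  assumes nu: "2 \<le> \<nu>" and LE: "lane_emden \<nu> \<theta> \<xi>" and R: "\<xi> \<le> R"
begin

lemma R_pos: "0 < R" using R xi_pos[OF LE nu_gt_1[OF nu]] by simp

lemma continuous_on_theta_R: "continuous_on {0..R} \<theta>"
  by (rule continuous_on_subset[OF continuous_on_theta[OF LE nu_gt_1[OF nu]]]) auto

lemma continuous_on_theta_dom: "continuous_on (dom_E R) (\<lambda>p. \<theta> (fst p))"
  by (rule continuous_on_compose2[OF continuous_on_theta_R]) (auto intro!: continuous_intros)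

lemma theta_fixed_point:
  assumes p: "p \<in> dom_E R"
  shows "\<theta> (fst p) = 1 + lin_pot R (\<lambda>p. max 0 (\<theta> (fst p)) powr \<nu>) p"
proof -
  obtain r \<zeta> where p_eq: "p = (r, \<zeta>)" by fastforce
  have r: "r \<in> {0..R}" "\<zeta> \<in> {-1..1}" using p p_eq by auto
  let ?f = "\<lambda>s. max 0 (\<theta> s) powr \<nu>"
  have f: "continuous_on {0..R} ?f" using nu by (intro continuous_intros continuous_on_theta_R) auto
  have "lin_pot R (\<lambda>p. ?f (fst p)) p = lin_pot R (\<lambda>(s, z). ?f s) (r, \<zeta>)" by (simp add: p_eq case_prod_unfold)
  also have "\<dots> = integral {0..R} (\<lambda>s. ?f s * (s\<^sup>2 / max r s)) - integral {0..R} (\<lambda>s. ?f s * s)"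
    using r R_pos by (intro lin_pot_radial f) auto
  also have "\<dots> = integral {0..r} (\<lambda>s. ?f s * s\<^sup>2) / r - integral {0..r} (\<lambda>s. ?f s * s)"
    by (rule integral_radial_kernel_split[OF f r(1)])
  also have "1 + \<dots> = \<theta> r"
    using theta_eq[OF LE nu_gt_1[OF nu], of r] theta_0[OF LE nu_gt_1[OF nu]] r
    by (cases "r = 0") (auto simp: lane_emden_flux_def)
  finally show ?thesis by (simp add: p_eq)
qed

end

section \<open>Explicit solution of the linearized equation\<close>

context
  fixes \<nu> \<xi> R :: real and \<theta> h\<^sub>0 \<psi>\<^sub>2 :: "real \<Rightarrow> real"
  assumes nu: "2 \<le> \<nu>" and LE: "lane_emden \<nu> \<theta> \<xi>" and R: "\<xi> \<le> R"
    and h0: "is_h0 \<nu> \<theta> h\<^sub>0" and psi: "is_psi2 \<nu> \<theta> \<psi>\<^sub>2"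
begin

text \<open>Cut off by \<open>on_dom\<close>, since an element of the space is a total function and
  the comparison with \<open>frak_h\<close> is an equality of such functions.\<close>

definition "first_order = on_dom R (\<lambda>(r, \<zeta>). h\<^sub>0 r + coeff_A2 \<xi> \<psi>\<^sub>2 * \<psi>\<^sub>2 r * legendre_P2 \<zeta>)"

lemma continuous_on_first_order: "continuous_on (dom_E R) first_order"
proof -
  have "continuous_on (dom_E R) (\<lambda>p. h\<^sub>0 (fst p) + coeff_A2 \<xi> \<psi>\<^sub>2 * \<psi>\<^sub>2 (fst p) * legendre_P2 (snd p))"
    unfolding legendre_P2_def
    by (intro continuous_intros continuous_on_compose2[OF h0_eq(2)[OF LE nu_gt_1[OF nu] h0]]
        continuous_on_compose2[OF continuous_on_psi2[OF LE nu_gt_1[OF nu] psi]]) (auto intro: zero_less_one)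
  then show ?thesis
    by (rule continuous_on_eq) (auto simp: first_order_def on_dom_def)
qed

lemma h0_at_0: "h\<^sub>0 0 = 0" using h0 by (simp add: is_h0_def)

lemma first_order_in_space_E: "first_order \<in> space_E R"
  unfolding space_E_def
  using continuous_on_first_order R_pos[OF nu LE R] psi2_0[OF LE nu_gt_1[OF nu] psi]
  by (auto simp: first_order_def on_dom_def legendre_P2_def)

text \<open>Origin of the 5/6: the 5 compensates the multiplier 1/5 of the degree-two potential, and
  -1/6 is the coefficient of \<open>r\<^sup>2 * legendre_P2 \<zeta>\<close> in
  \<open>frak_g\<close>.\<close>

lemma coeff_A2_times: "coeff_A2 \<xi> \<psi>\<^sub>2 * ((3 * \<psi>\<^sub>2 \<xi> + \<xi> * deriv \<psi>\<^sub>2 \<xi>) / (5 * \<xi>\<^sup>2)) = - 1 / 6"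
  using psi2_boundary_pos[OF LE nu_gt_1[OF nu] psi] xi_pos[OF LE nu_gt_1[OF nu]]
  by (simp add: coeff_A2_def)

lemma coeff_A2_neg: "coeff_A2 \<xi> \<psi>\<^sub>2 < 0"
  using psi2_boundary_pos[OF LE nu_gt_1[OF nu] psi] xi_pos[OF LE nu_gt_1[OF nu]]
  by (simp add: coeff_A2_def)

lemma one_minus_DG_first_order: "one_minus_DG \<nu> R \<theta> first_order = frak_g R"
proof
  fix p :: "real \<times> real"
  obtain r \<zeta> where p_eq: "p = (r, \<zeta>)" by fastforce
  show "one_minus_DG \<nu> R \<theta> first_order p = frak_g R p"
  proof (cases "p \<in> dom_E R")
    case False
    then show ?thesis by (simp add: one_minus_DG_def first_order_def frak_g_def op_DG_def on_dom_def)
  next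
    case p: True
    then have r: "r \<in> {0..R}" "\<zeta> \<in> {-1..1}" using p_eq by auto
    note nu1 = nu_gt_1[OF nu]
    have R0: "0 \<le> R" using R_pos[OF nu LE R] by simp
    let ?q = "\<lambda>s. \<nu> * max 0 (\<theta> s) powr (\<nu> - 1)"
    let ?A = "coeff_A2 \<xi> \<psi>\<^sub>2"
    have c1: "continuous_on {0..R} (\<lambda>s. ?q s * h\<^sub>0 s)"
      by (intro continuous_on_mult continuous_on_q[OF LE nu1 psi] continuous_on_subset[OF h0_eq(2)[OF LE nu1 h0]]) (auto intro: zero_less_one)
    have c2: "continuous_on {0..R} (\<lambda>s. ?q s * \<psi>\<^sub>2 s)"
      by (intro continuous_on_mult continuous_on_q[OF LE nu1 psi] continuous_on_subset[OF continuous_on_psi2[OF LE nu1 psi]]) auto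
    have d1: "continuous_on (dom_E R) (\<lambda>(s, z). ?q s * h\<^sub>0 s)"
      unfolding split_beta by (rule continuous_on_compose2[OF c1]) (auto intro!: continuous_intros)
    have d2: "continuous_on (dom_E R) (\<lambda>(s, z). ?q s * \<psi>\<^sub>2 s * legendre_P2 z)"
      unfolding split_beta legendre_P2_def
      by (intro continuous_on_mult[OF continuous_on_compose2[OF c2]]) (auto intro!: continuous_intros)
    have "op_DG \<nu> R \<theta> first_order p = lin_pot R (linear_source \<nu> \<theta> first_order) p"
      by (rule op_DG_eq_lin_pot[OF continuous_on_first_order continuous_on_theta_R[OF nu LE R] nu1 p])
    also have "lin_pot R (linear_source \<nu> \<theta> first_order) =
        lin_pot R (\<lambda>p. (\<lambda>(s, z). ?q s * h\<^sub>0 s) p + ?A * (\<lambda>(s, z). ?q s * \<psi>\<^sub>2 s * legendre_P2 z) p)"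
      by (rule lin_pot_cong) (auto simp: linear_source_def first_order_def on_dom_def algebra_simps)
    also have "\<dots> p = lin_pot R (\<lambda>(s, z). ?q s * h\<^sub>0 s) p + ?A * lin_pot R (\<lambda>(s, z). ?q s * \<psi>\<^sub>2 s * legendre_P2 z) p"
      by (subst lin_pot_add[OF p d1 continuous_on_mult_left[OF d2]]) (simp only: lin_pot_scale)
    also have "lin_pot R (\<lambda>(s, z). ?q s * h\<^sub>0 s) p = h\<^sub>0 r - r\<^sup>2 / 6"
    proof -
      have "lin_pot R (\<lambda>(s, z). ?q s * h\<^sub>0 s) p =
          integral {0..R} (\<lambda>s. ?q s * h\<^sub>0 s * (s\<^sup>2 / max r s)) - integral {0..R} (\<lambda>s. ?q s * h\<^sub>0 s * s)"
        unfolding p_eq using r R0 by (intro lin_pot_radial c1) auto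
      also have "\<dots> = integral {0..r} (\<lambda>s. ?q s * h\<^sub>0 s * s\<^sup>2) / r - integral {0..r} (\<lambda>s. ?q s * h\<^sub>0 s * s)"
        by (rule integral_radial_kernel_split[OF c1 r(1)])
      finally show ?thesis using h0_eq(1)[OF LE nu1 h0, of r] h0_at_0 r by (cases "r = 0") auto
    qed
    also have "lin_pot R (\<lambda>(s, z). ?q s * \<psi>\<^sub>2 s * legendre_P2 z) p =
        legendre_P2 \<zeta> * (\<psi>\<^sub>2 r - (3 * \<psi>\<^sub>2 \<xi> + \<xi> * deriv \<psi>\<^sub>2 \<xi>) / (5 * \<xi>\<^sup>2) * r\<^sup>2)"
      unfolding p_eq psi2_integral_equation[OF LE nu1 psi R r(1), symmetric]
      using r R0 by (subst lin_pot_P2[OF _ _ _ c2]) auto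
    also have "?A * (legendre_P2 \<zeta> * (\<psi>\<^sub>2 r - (3 * \<psi>\<^sub>2 \<xi> + \<xi> * deriv \<psi>\<^sub>2 \<xi>) / (5 * \<xi>\<^sup>2) * r\<^sup>2)) =
        ?A * \<psi>\<^sub>2 r * legendre_P2 \<zeta> - (?A * ((3 * \<psi>\<^sub>2 \<xi> + \<xi> * deriv \<psi>\<^sub>2 \<xi>) / (5 * \<xi>\<^sup>2))) * legendre_P2 \<zeta> * r\<^sup>2"
      by (simp only: right_diff_distrib mult_ac)
    finally have "op_DG \<nu> R \<theta> first_order p = h\<^sub>0 r - r\<^sup>2 / 6 + (?A * \<psi>\<^sub>2 r * legendre_P2 \<zeta> + 1/6 * legendre_P2 \<zeta> * r\<^sup>2)"
      unfolding coeff_A2_times by simp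
    moreover have "first_order p = h\<^sub>0 r + ?A * \<psi>\<^sub>2 r * legendre_P2 \<zeta>"
      using p by (simp add: first_order_def on_dom_def p_eq)
    \<comment> \<open>From
      \<open>1 - \<zeta>\<^sup>2 = 2/3 * (1 - legendre_P2 \<zeta>)\<close>.\<close>
    moreover have "frak_g R p = r\<^sup>2 / 6 - 1/6 * legendre_P2 \<zeta> * r\<^sup>2"
      using p by (simp add: frak_g_def on_dom_def p_eq legendre_P2_def field_simps)
    ultimately show ?thesis by (simp add: one_minus_DG_def)
  qed
qed

text \<open>Injectivity of the operator on the space identifies the chosen preimage of
  \<open>frak_g\<close> with the explicit one.\<close>

lemma frak_h_eq:
  assumes "has_bounded_inverse_E R (one_minus_DG \<nu> R \<theta>)"
  shows "frak_h \<nu> R \<theta> = first_order"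
  unfolding frak_h_def one_minus_DG_first_order[symmetric]
  using assms first_order_in_space_E
  by (intro inv_into_f_f) (auto simp: has_bounded_inverse_E_def bij_betw_def)

end

section \<open>First-order expansion and the free surface\<close>

lemma DERIV_local_Lipschitz:
  fixes f :: "real \<Rightarrow> real"
  assumes "(f has_real_derivative D) (at x)"
  shows "\<exists>C \<delta>. 0 \<le> C \<and> 0 < \<delta> \<and> (\<forall>y. \<bar>y - x\<bar> < \<delta> \<longrightarrow> \<bar>f y - f x\<bar> \<le> C * \<bar>y - x\<bar>)"
proof -
  have "((\<lambda>y. (f y - f x) / (y - x)) \<longlongrightarrow> D) (at x)" using assms by (simp add: has_field_derivative_iff)
  then have "\<forall>\<^sub>F y in at x. \<bar>(f y - f x) / (y - x) - D\<bar> < 1"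
    by (auto dest: tendstoD[of _ _ _ 1] simp: dist_real_def)
  then obtain d where d: "0 < d" "\<And>y. y \<noteq> x \<Longrightarrow> \<bar>y - x\<bar> < d \<Longrightarrow> \<bar>(f y - f x) / (y - x) - D\<bar> < 1"
    by (auto simp: eventually_at dist_real_def)
  have "\<bar>f y - f x\<bar> \<le> (\<bar>D\<bar> + 1) * \<bar>y - x\<bar>" if y: "\<bar>y - x\<bar> < d" for y
  proof (cases "y = x")
    case False
    have "\<bar>(f y - f x) / (y - x)\<bar> \<le> \<bar>D\<bar> + 1" using d(2)[OF False y] by linarith
    then show ?thesis using False by (simp add: abs_divide divide_le_eq)
  qed simp
  then show ?thesis using d(1) by (intro exI[of _ "\<bar>D\<bar> + 1"] exI[of _ d]) auto
qed

text \<open>Differentiability of \<open>f'\<close> at \<open>x\<close> bounds its increments from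
  \<open>x\<close> linearly; the mean value inequality for \<open>f\<close> minus its tangent then
  yields the second order.\<close>

lemma Taylor_quadratic_bound:
  fixes f f' :: "real \<Rightarrow> real"
  assumes f: "\<And>y. \<bar>y - x\<bar> < \<rho> \<Longrightarrow> (f has_real_derivative f' y) (at y)" and \<rho>: "0 < \<rho>"
    and f': "(f' has_real_derivative D) (at x)"
  shows "\<exists>C \<delta>. 0 \<le> C \<and> 0 < \<delta> \<and> (\<forall>y. \<bar>y - x\<bar> < \<delta> \<longrightarrow> \<bar>f y - f x - f' x * (y - x)\<bar> \<le> C * (y - x)\<^sup>2)"
proof -
  obtain C d where C: "0 \<le> C" "0 < d" "\<forall>y. \<bar>y - x\<bar> < d \<longrightarrow> \<bar>f' y - f' x\<bar> \<le> C * \<bar>y - x\<bar>"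
    using DERIV_local_Lipschitz[OF f'] by (elim exE conjE)
  have "\<bar>f y - f x - f' x * (y - x)\<bar> \<le> C * (y - x)\<^sup>2" if y: "\<bar>y - x\<bar> < min d \<rho>" for y
  proof -
    let ?S = "{min x y..max x y}"
    have "norm ((f y - f' x * y) - (f x - f' x * x)) \<le> (C * \<bar>y - x\<bar>) * norm (y - x)"
    proof (rule field_differentiable_bound[where S = ?S])
      fix z assume z: "z \<in> ?S"
      then have zx: "\<bar>z - x\<bar> \<le> \<bar>y - x\<bar>" by auto
      then have "\<bar>z - x\<bar> < \<rho>" using y by simp
      from DERIV_diff[OF f[OF this] DERIV_cmult[OF DERIV_ident, of "f' x"]]
      show "((\<lambda>y. f y - f' x * y) has_field_derivative f' z - f' x) (at z within ?S)"
        by (simp add: has_field_derivative_at_within)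
      have "\<bar>f' z - f' x\<bar> \<le> C * \<bar>z - x\<bar>" using C(3) zx y by auto
      also have "\<dots> \<le> C * \<bar>y - x\<bar>" using zx C by (intro mult_left_mono) auto
      finally show "norm (f' z - f' x) \<le> C * \<bar>y - x\<bar>" by simp
    qed auto
    moreover have "(f y - f' x * y) - (f x - f' x * x) = f y - f x - f' x * (y - x)" by (simp add: algebra_simps)
    moreover have "(y - x)\<^sup>2 = \<bar>y - x\<bar> * \<bar>y - x\<bar>" by (simp add: power2_eq_square)
    ultimately show ?thesis by (simp only: real_norm_def mult.assoc)
  qed
  then show ?thesis using C \<rho> by (intro exI[of _ C] exI[of _ "min d \<rho>"]) auto
qed

lemma surface_radius_eqI:
  assumes x: "0 < x" "x < 2 * \<xi>" and "\<And>r. 0 \<le> r \<Longrightarrow> r < x \<Longrightarrow> 0 < u (r, \<zeta>)" "u (x, \<zeta>) = 0"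
    "\<And>r. x < r \<Longrightarrow> r \<le> 2 * \<xi> \<Longrightarrow> u (r, \<zeta>) < 0"
  shows "surface_radius \<xi> u \<zeta> = x"
  unfolding surface_radius_def
proof (rule the_equality)
  fix y assume y: "0 < y \<and> y < 2 * \<xi> \<and> (\<forall>r. 0 \<le> r \<and> r < y \<longrightarrow> 0 < u (r, \<zeta>)) \<and> u (y, \<zeta>) = 0 \<and>
    (\<forall>r. y < r \<and> r \<le> 2 * \<xi> \<longrightarrow> u (r, \<zeta>) < 0)"
  show "y = x"
  proof (cases x y rule: linorder_cases)
    case less
    then have "0 < u (x, \<zeta>)" using y x by simp
    then show ?thesis using assms by simp
  next
    case greater
    then have "0 < u (y, \<zeta>)" using assms(3)[of y] y by simp
    then show ?thesis using y by simp
  qed simp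
qed (use assms in auto)

text \<open>Monotonicity is asked for on [\<xi>/2, 2\<xi>] only, because the Lipschitz comparison of
  \<Theta> with \<theta> does not reach the origin; nearer to it the sign comes from sup-norm
  closeness.\<close>

lemma surface_radius_exists:
  assumes \<xi>: "0 < \<xi>" and cont: "continuous_on {\<xi> / 2..2 * \<xi>} (\<lambda>r. u (r, \<zeta>))"
    and pos: "\<And>r. 0 \<le> r \<Longrightarrow> r \<le> \<xi> / 2 \<Longrightarrow> 0 < u (r, \<zeta>)" and neg: "u (2 * \<xi>, \<zeta>) < 0"
    and dec: "\<And>r r'. \<xi> / 2 \<le> r \<Longrightarrow> r < r' \<Longrightarrow> r' \<le> 2 * \<xi> \<Longrightarrow> u (r', \<zeta>) < u (r, \<zeta>)"
  shows "surface_radius \<xi> u \<zeta> \<in> {\<xi> / 2<..<2 * \<xi>} \<and> u (surface_radius \<xi> u \<zeta>, \<zeta>) = 0"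
proof -
  have "\<exists>x. \<xi> / 2 \<le> x \<and> x \<le> 2 * \<xi> \<and> u (x, \<zeta>) = 0"
    using IVT2'[of "\<lambda>r. u (r, \<zeta>)" "2 * \<xi>" 0 "\<xi> / 2"] pos[of "\<xi> / 2"] neg \<xi> cont by auto
  then obtain x where x: "\<xi> / 2 \<le> x" "x \<le> 2 * \<xi>" "u (x, \<zeta>) = 0" by auto
  have x': "\<xi> / 2 < x" "x < 2 * \<xi>"
    using x pos[of "\<xi> / 2"] neg \<xi> by (auto simp: le_less)
  have "surface_radius \<xi> u \<zeta> = x"
  proof (rule surface_radius_eqI)
    fix r assume r: "0 \<le> r" "r < x"
    show "0 < u (r, \<zeta>)"
      using pos[of r] dec[of r x] r x by (cases "r \<le> \<xi> / 2") auto
  next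
    fix r assume r: "x < r" "r \<le> 2 * \<xi>"
    show "u (r, \<zeta>) < 0" using dec[of x r] x r by auto
  qed (use x x' \<xi> in auto)
  then show ?thesis using x x' by simp
qed

section \<open>Estimates uniform in the distorted family\<close>

context
  fixes \<nu> \<xi> R \<epsilon>\<^sub>1 C\<^sub>1 :: real and \<theta> h\<^sub>0 \<psi>\<^sub>2 :: "real \<Rightarrow> real"
    and \<Theta> :: "real \<Rightarrow> real \<times> real \<Rightarrow> real"
  assumes nu: "2 \<le> \<nu>" and LE: "lane_emden \<nu> \<theta> \<xi>" and R2: "2 * \<xi> \<le> R"
    and inv: "has_bounded_inverse_E R (one_minus_DG \<nu> R \<theta>)"
    and fam: "distorted_family \<nu> R \<theta> \<epsilon>\<^sub>1 C\<^sub>1 \<Theta>"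
    and h0: "is_h0 \<nu> \<theta> h\<^sub>0" and psi: "is_psi2 \<nu> \<theta> \<psi>\<^sub>2"
begin

lemma xi_gt_0: "0 < \<xi>" by (rule xi_pos[OF LE nu_gt_1[OF nu]])

lemma xi_le_R: "\<xi> \<le> R" using xi_gt_0 R2 by simp

lemma R_gt_0: "0 < R" using xi_gt_0 R2 by simp

lemma family_facts:
  assumes "0 < \<epsilon>" "\<epsilon> \<le> \<epsilon>\<^sub>1"
  shows "\<Theta> \<epsilon> \<in> space_E R" "continuous_on (dom_E R) (\<Theta> \<epsilon>)"
    and "p \<in> dom_E R \<Longrightarrow> \<Theta> \<epsilon> p = \<epsilon> * frak_g R p + op_G \<nu> R (\<Theta> \<epsilon>) p"
    and "p \<in> dom_E R \<Longrightarrow> \<bar>\<Theta> \<epsilon> p - \<theta> (fst p)\<bar> \<le> C\<^sub>1 * \<epsilon>"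
proof -
  show E: "\<Theta> \<epsilon> \<in> space_E R" and "p \<in> dom_E R \<Longrightarrow> \<Theta> \<epsilon> p = \<epsilon> * frak_g R p + op_G \<nu> R (\<Theta> \<epsilon>) p"
    using fam assms by (auto simp: distorted_family_def)
  then show c: "continuous_on (dom_E R) (\<Theta> \<epsilon>)" by (simp add: space_E_def)
  have "continuous_on (dom_E R) (\<lambda>(r, \<zeta>). \<Theta> \<epsilon> (r, \<zeta>) - \<theta> r)"
    using continuous_on_diff[OF c continuous_on_theta_dom[OF nu LE xi_le_R]] by (simp add: case_prod_unfold)
  moreover assume p: "p \<in> dom_E R"
  ultimately have "\<bar>(\<lambda>(r, \<zeta>). \<Theta> \<epsilon> (r, \<zeta>) - \<theta> r) p\<bar> \<le> norm_E R (\<lambda>(r, \<zeta>). \<Theta> \<epsilon> (r, \<zeta>) - \<theta> r)"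
    by (rule abs_le_norm_E)
  also have "\<dots> \<le> C\<^sub>1 * \<epsilon>" using fam assms by (auto simp: distorted_family_def)
  finally show "\<bar>\<Theta> \<epsilon> p - \<theta> (fst p)\<bar> \<le> C\<^sub>1 * \<epsilon>" by (simp add: case_prod_unfold)
qed

lemma constants_pos: "0 < \<epsilon>\<^sub>1" "0 < C\<^sub>1" using fam by (auto simp: distorted_family_def)

text \<open>A common range for all arguments of the powers, so that Lipschitz and Taylor constants
  do not depend on \<epsilon>.\<close>

lemma uniform_bound:
  "\<exists>M>0. (\<forall>p\<in>dom_E R. \<bar>\<theta> (fst p)\<bar> \<le> M) \<and>
    (\<forall>\<epsilon>. 0 < \<epsilon> \<longrightarrow> \<epsilon> \<le> \<epsilon>\<^sub>1 \<longrightarrow> (\<forall>p\<in>dom_E R. \<bar>\<Theta> \<epsilon> p\<bar> \<le> M))"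
proof -
  obtain V where V: "0 \<le> V" "\<And>p. p \<in> dom_E R \<Longrightarrow> \<bar>\<theta> (fst p)\<bar> \<le> V"
    using continuous_on_dom_bounded[OF continuous_on_theta_dom[OF nu LE xi_le_R] less_imp_le[OF R_gt_0]] by blast
  have ce: "0 < C\<^sub>1 * \<epsilon>\<^sub>1" using constants_pos by simp
  show ?thesis
  proof (intro exI[of _ "V + C\<^sub>1 * \<epsilon>\<^sub>1"] conjI ballI allI impI)
    show "0 < V + C\<^sub>1 * \<epsilon>\<^sub>1" using V(1) ce by simp
    fix p assume p: "p \<in> dom_E R"
    show "\<bar>\<theta> (fst p)\<bar> \<le> V + C\<^sub>1 * \<epsilon>\<^sub>1" using V(2)[OF p] ce by linarith
    fix \<epsilon> assume e: "0 < \<epsilon>" "\<epsilon> \<le> \<epsilon>\<^sub>1"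
    have "C\<^sub>1 * \<epsilon> \<le> C\<^sub>1 * \<epsilon>\<^sub>1" using e constants_pos by (intro mult_left_mono) auto
    then show "\<bar>\<Theta> \<epsilon> p\<bar> \<le> V + C\<^sub>1 * \<epsilon>\<^sub>1" using family_facts(4)[OF e p] V(2)[OF p] by linarith
  qed
qed

lemma difference_equation:
  assumes e: "0 < \<epsilon>" "\<epsilon> \<le> \<epsilon>\<^sub>1" and p: "p \<in> dom_E R"
  shows "\<Theta> \<epsilon> p - \<theta> (fst p) = \<epsilon> * frak_g R p +
    lin_pot R (\<lambda>p. max 0 (\<Theta> \<epsilon> p) powr \<nu> - max 0 (\<theta> (fst p)) powr \<nu>) p"
proof -
  have c: "continuous_on (dom_E R) (\<lambda>p. max 0 (\<Theta> \<epsilon> p) powr \<nu>)" "continuous_on (dom_E R) (\<lambda>p. max 0 (\<theta> (fst p)) powr \<nu>)"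
    using nu by (auto intro!: continuous_intros family_facts(2)[OF e] continuous_on_theta_dom[OF nu LE xi_le_R])
  show ?thesis
    unfolding lin_pot_diff[OF p c]
    using family_facts(3)[OF e p] op_G_eq_lin_pot[OF family_facts(2)[OF e] _ p, of \<nu>]
      theta_fixed_point[OF nu LE xi_le_R p] nu by simp
qed

lemma frak_h_facts:
  "frak_h \<nu> R \<theta> \<in> space_E R" "continuous_on (dom_E R) (frak_h \<nu> R \<theta>)"
  "p \<in> dom_E R \<Longrightarrow> lin_pot R (linear_source \<nu> \<theta> (frak_h \<nu> R \<theta>)) p = frak_h \<nu> R \<theta> p - frak_g R p"
proof -
  note eq = frak_h_eq[OF nu LE xi_le_R h0 psi inv]
  show "frak_h \<nu> R \<theta> \<in> space_E R" unfolding eq by (rule first_order_in_space_E[OF nu LE xi_le_R h0 psi])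
  show c: "continuous_on (dom_E R) (frak_h \<nu> R \<theta>)" unfolding eq by (rule continuous_on_first_order[OF nu LE xi_le_R h0 psi])
  assume p: "p \<in> dom_E R"
  have "one_minus_DG \<nu> R \<theta> (frak_h \<nu> R \<theta>) p = frak_g R p"
    unfolding eq one_minus_DG_first_order[OF nu LE xi_le_R h0 psi] ..
  then show "lin_pot R (linear_source \<nu> \<theta> (frak_h \<nu> R \<theta>)) p = frak_h \<nu> R \<theta> p - frak_g R p"
    using op_DG_eq_lin_pot[OF c continuous_on_theta_R[OF nu LE xi_le_R] nu_gt_1[OF nu] p]
    by (simp add: one_minus_DG_def)
qed

text \<open>
  With \<open>w = \<Theta>\<^sub>\<epsilon> - \<theta>\<close>, the operator \<open>1 - DG(\<theta>)\<close> maps \<open>w - \<epsilon> h\<close> to the potential of the Taylor remainder of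
  \<open>u \<mapsto> u\<^sub>\<sharp>\<^sup>\<nu>\<close> at \<open>\<theta>\<close>, which is quadratic in \<open>w\<close> because \<open>\<nu> \<ge> 2\<close>.
\<close>

lemma first_order_expansion:
  "\<exists>C\<ge>0. \<forall>\<epsilon>. 0 < \<epsilon> \<longrightarrow> \<epsilon> \<le> \<epsilon>\<^sub>1 \<longrightarrow> (\<forall>p\<in>dom_E R.
     \<bar>\<Theta> \<epsilon> p - (\<theta> (fst p) + \<epsilon> * frak_h \<nu> R \<theta> p)\<bar> \<le> C * \<epsilon>\<^sup>2)"
proof -
  obtain M where M: "0 < M" "\<forall>p\<in>dom_E R. \<bar>\<theta> (fst p)\<bar> \<le> M"
    "\<forall>\<epsilon>. 0 < \<epsilon> \<longrightarrow> \<epsilon> \<le> \<epsilon>\<^sub>1 \<longrightarrow> (\<forall>p\<in>dom_E R. \<bar>\<Theta> \<epsilon> p\<bar> \<le> M)"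
    using uniform_bound by (elim exE conjE)
  define T where "T = one_minus_DG \<nu> R \<theta>"
  have T_bij: "bij_betw T (space_E R) (space_E R)" using inv by (simp add: has_bounded_inverse_E_def T_def)
  obtain B where B: "\<forall>u\<in>space_E R. norm_E R (inv_into (space_E R) T u) \<le> B * norm_E R u"
    using inv unfolding has_bounded_inverse_E_def T_def by (elim exE conjE)
  define K where "K = \<nu> * ((\<nu> - 1) * M powr (\<nu> - 2))"
  have K: "0 \<le> K" using nu by (simp add: K_def)
  let ?h = "frak_h \<nu> R \<theta>"
  note nu1 = nu_gt_1[OF nu]
  note c\<theta> = continuous_on_theta_dom[OF nu LE xi_le_R]
  have "\<bar>\<Theta> \<epsilon> p - (\<theta> (fst p) + \<epsilon> * ?h p)\<bar> \<le> (\<bar>B\<bar> * (R\<^sup>2 * (K * C\<^sub>1\<^sup>2))) * \<epsilon>\<^sup>2"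
    if e: "0 < \<epsilon>" "\<epsilon> \<le> \<epsilon>\<^sub>1" and p: "p \<in> dom_E R" for \<epsilon> p
  proof -
    define w where "w = (\<lambda>p. \<Theta> \<epsilon> p - \<theta> (fst p))"
    \<comment> \<open>\<open>on_dom\<close> is applied to \<theta> so that \<open>d\<close> vanishes
      off the rectangle and belongs to the space, where the inverse acts.\<close>
    define d where "d = (\<lambda>p. \<Theta> \<epsilon> p - on_dom R (\<lambda>p. \<theta> (fst p)) p - \<epsilon> * ?h p)"
    have cw: "continuous_on (dom_E R) w"
      unfolding w_def by (intro continuous_intros family_facts(2)[OF e] c\<theta>)
    have d_eq: "d p = w p - \<epsilon> * ?h p" if "p \<in> dom_E R" for p
      using that by (simp add: d_def w_def on_dom_def)
    have cd: "continuous_on (dom_E R) d"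
      by (rule continuous_on_eq[of _ "\<lambda>p. w p - \<epsilon> * ?h p"])
         (use d_eq in \<open>auto intro!: continuous_intros cw frak_h_facts(2)\<close>)
    have dE: "d \<in> space_E R"
    proof -
      have "d (0, \<zeta>) = d (0, 0)" if "\<zeta> \<in> {-1..1}" for \<zeta>
      proof -
        have "\<Theta> \<epsilon> (0, \<zeta>) = \<Theta> \<epsilon> (0, 0)" "?h (0, \<zeta>) = ?h (0, 0)"
          using family_facts(1)[OF e] frak_h_facts(1) that unfolding space_E_def by blast+
        then show ?thesis using that R_gt_0 by (simp add: d_def on_dom_def)
      qed
      moreover have "d (r, \<zeta>) = d (r, -\<zeta>)" if "r \<in> {0..R}" "\<zeta> \<in> {-1..1}" for r \<zeta>
      proof -
        have "\<Theta> \<epsilon> (r, \<zeta>) = \<Theta> \<epsilon> (r, -\<zeta>)" "?h (r, \<zeta>) = ?h (r, -\<zeta>)"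
          using family_facts(1)[OF e] frak_h_facts(1) that unfolding space_E_def by blast+
        then show ?thesis using that by (simp add: d_def on_dom_def)
      qed
      moreover have "d p = 0" if "p \<notin> dom_E R" for p
      proof -
        have "\<Theta> \<epsilon> p = 0" "?h p = 0"
          using family_facts(1)[OF e] frak_h_facts(1) that unfolding space_E_def by blast+
        then show ?thesis using that by (simp add: d_def on_dom_def)
      qed
      ultimately show ?thesis using cd unfolding space_E_def by blast
    qed
    have Td: "\<bar>T d p\<bar> \<le> R\<^sup>2 * (K * (C\<^sub>1 * \<epsilon>)\<^sup>2)" if p: "p \<in> dom_E R" for p
    proof -
      let ?D = "\<lambda>p. max 0 (\<Theta> \<epsilon> p) powr \<nu> - max 0 (\<theta> (fst p)) powr \<nu>"
      have cD: "continuous_on (dom_E R) ?D"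
        using nu by (intro continuous_intros family_facts(2)[OF e] c\<theta>) auto
      note cl = continuous_on_linear_source[OF _ continuous_on_theta_R[OF nu LE xi_le_R] nu1]
      have "lin_pot R (linear_source \<nu> \<theta> d) = lin_pot R (\<lambda>p. linear_source \<nu> \<theta> w p - \<epsilon> * linear_source \<nu> \<theta> ?h p)"
        by (rule lin_pot_cong) (simp add: linear_source_def d_eq right_diff_distrib)
      then have "lin_pot R (linear_source \<nu> \<theta> d) p = lin_pot R (\<lambda>p. linear_source \<nu> \<theta> w p - \<epsilon> * linear_source \<nu> \<theta> ?h p) p"
        by simp
      also have "\<dots> = lin_pot R (linear_source \<nu> \<theta> w) p - \<epsilon> * (?h p - frak_g R p)"
        by (subst lin_pot_diff[OF p cl[OF cw] continuous_on_mult_left[OF cl[OF frak_h_facts(2)]]])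
           (simp only: lin_pot_scale frak_h_facts(3)[OF p])
      finally have "T d p = w p - \<epsilon> * ?h p - (lin_pot R (linear_source \<nu> \<theta> w) p - \<epsilon> * (?h p - frak_g R p))"
        using op_DG_eq_lin_pot[OF cd continuous_on_theta_R[OF nu LE xi_le_R] nu1 p]
        by (simp add: T_def one_minus_DG_def d_eq[OF p])
      \<comment> \<open>All terms with \<open>?h\<close> cancel, and
        \<open>w p - \<epsilon> * frak_g R p\<close> is the full potential difference.\<close>
      also have "\<dots> = lin_pot R ?D p - lin_pot R (linear_source \<nu> \<theta> w) p"
        using difference_equation[OF e p] by (simp add: w_def algebra_simps)
      also have "\<dots> = lin_pot R (\<lambda>p. ?D p - linear_source \<nu> \<theta> w p) p"
        by (rule lin_pot_diff[OF p cD cl[OF cw], symmetric])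
      also have "\<bar>\<dots>\<bar> \<le> R\<^sup>2 * (K * (C\<^sub>1 * \<epsilon>)\<^sup>2)"
      proof (rule lin_pot_bound[OF p])
        show "continuous_on (dom_E R) (\<lambda>p. ?D p - linear_source \<nu> \<theta> w p)"
          by (intro continuous_on_diff[OF cD cl[OF cw]])
        fix p assume p: "p \<in> dom_E R"
        have "\<bar>?D p - linear_source \<nu> \<theta> w p\<bar> \<le> K * (w p)\<^sup>2"
          unfolding linear_source_def w_def K_def
          using M e p by (intro pos_part_powr_Taylor nu) auto
        also have "\<dots> \<le> K * (C\<^sub>1 * \<epsilon>)\<^sup>2"
          using family_facts(4)[OF e p] K by (intro mult_left_mono abs_le_square_iff[THEN iffD1]) (auto simp: w_def)
        finally show "\<bar>?D p - linear_source \<nu> \<theta> w p\<bar> \<le> K * (C\<^sub>1 * \<epsilon>)\<^sup>2" .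
      qed (use R_gt_0 K in auto)
      finally show ?thesis .
    qed
    have TdE: "T d \<in> space_E R" using T_bij dE by (auto simp: bij_betw_def)
    have "\<bar>d p\<bar> \<le> norm_E R d" by (rule abs_le_norm_E[OF cd p])
    also have "norm_E R d = norm_E R (inv_into (space_E R) T (T d))"
      using T_bij dE unfolding bij_betw_def by (intro arg_cong[where f = "norm_E R"] inv_into_f_f[symmetric]) auto
    also have "\<dots> \<le> B * norm_E R (T d)" using B TdE by blast
    \<comment> \<open>The bounded inverse does not come with a sign for \<open>B\<close>; the point
      \<open>p\<close> shows that the norm is nonnegative.\<close>
    also have "\<dots> \<le> \<bar>B\<bar> * norm_E R (T d)"
    proof -
      have "0 \<le> \<bar>T d p\<bar>" by simp
      also have "\<dots> \<le> norm_E R (T d)" using TdE by (intro abs_le_norm_E p) (simp add: space_E_def)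
      finally show ?thesis by (intro mult_right_mono) auto
    qed
    also have "\<dots> \<le> \<bar>B\<bar> * (R\<^sup>2 * (K * (C\<^sub>1 * \<epsilon>)\<^sup>2))"
      using R_gt_0 by (intro mult_left_mono norm_E_le Td) auto
    also have "\<dots> = (\<bar>B\<bar> * (R\<^sup>2 * (K * C\<^sub>1\<^sup>2))) * \<epsilon>\<^sup>2" by (simp add: power_mult_distrib)
    finally show ?thesis using d_eq[OF p] by (simp add: w_def algebra_simps)
  qed
  then show ?thesis using K by (intro exI[of _ "\<bar>B\<bar> * (R\<^sup>2 * (K * C\<^sub>1\<^sup>2))"]) auto
qed

lemma frak_h_value:
  assumes "r \<in> {0..R}" "\<zeta> \<in> {-1..1}"
  shows "frak_h \<nu> R \<theta> (r, \<zeta>) = h\<^sub>0 r + coeff_A2 \<xi> \<psi>\<^sub>2 * \<psi>\<^sub>2 r * legendre_P2 \<zeta>"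
  using assms
  by (simp add: frak_h_eq[OF nu LE xi_le_R h0 psi inv] first_order_def[OF nu LE xi_le_R h0 psi] on_dom_def)

text \<open>The difference is \<epsilon> times \<open>frak_g\<close> plus the potential of a density
  of size O(\<epsilon>), so the Lipschitz bound along rays inherits the factor \<epsilon>. This
  stands in for closeness of the radial derivatives.\<close>

lemma difference_Lipschitz:
  "\<exists>D\<ge>0. \<forall>\<epsilon> r r' \<zeta>. 0 < \<epsilon> \<longrightarrow> \<epsilon> \<le> \<epsilon>\<^sub>1 \<longrightarrow> r \<in> {\<xi> / 2..2 * \<xi>} \<longrightarrow> r' \<in> {\<xi> / 2..2 * \<xi>} \<longrightarrow> \<zeta> \<in> {-1..1} \<longrightarrow>
     \<bar>(\<Theta> \<epsilon> (r, \<zeta>) - \<theta> r) - (\<Theta> \<epsilon> (r', \<zeta>) - \<theta> r')\<bar> \<le> \<epsilon> * D * \<bar>r - r'\<bar>"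
proof -
  obtain M where M: "0 < M" "\<forall>p\<in>dom_E R. \<bar>\<theta> (fst p)\<bar> \<le> M"
    "\<forall>\<epsilon>. 0 < \<epsilon> \<longrightarrow> \<epsilon> \<le> \<epsilon>\<^sub>1 \<longrightarrow> (\<forall>p\<in>dom_E R. \<bar>\<Theta> \<epsilon> p\<bar> \<le> M)"
    using uniform_bound by (elim exE conjE)
  have a: "0 < \<xi> / 2" "\<xi> / 2 \<le> R" using xi_gt_0 R2 by auto
  obtain L where L: "0 \<le> L" "\<And>r r' \<zeta> v V. r \<in> {\<xi> / 2..R} \<Longrightarrow> r' \<in> {\<xi> / 2..R} \<Longrightarrow> \<zeta> \<in> {-1..1} \<Longrightarrow>
      continuous_on (dom_E R) v \<Longrightarrow> (\<And>p. p \<in> dom_E R \<Longrightarrow> \<bar>v p\<bar> \<le> V) \<Longrightarrow> 0 \<le> V \<Longrightarrow>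
      \<bar>lin_pot R v (r, \<zeta>) - lin_pot R v (r', \<zeta>)\<bar> \<le> L * V * \<bar>r - r'\<bar>"
    using lin_pot_Lipschitz[OF a] by blast
  define K where "K = \<nu> * M powr (\<nu> - 1)"
  have K: "0 \<le> K" using nu by (simp add: K_def)
  have C: "0 < C\<^sub>1" using constants_pos by simp
  have "\<bar>(\<Theta> \<epsilon> (r, \<zeta>) - \<theta> r) - (\<Theta> \<epsilon> (r', \<zeta>) - \<theta> r')\<bar> \<le> \<epsilon> * (\<xi> + L * (K * C\<^sub>1)) * \<bar>r - r'\<bar>"
    if e: "0 < \<epsilon>" "\<epsilon> \<le> \<epsilon>\<^sub>1" and r: "r \<in> {\<xi> / 2..2 * \<xi>}" "r' \<in> {\<xi> / 2..2 * \<xi>}" and \<zeta>: "\<zeta> \<in> {-1..1}" for \<epsilon> r r' \<zeta>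
  proof -
    let ?D = "\<lambda>p. max 0 (\<Theta> \<epsilon> p) powr \<nu> - max 0 (\<theta> (fst p)) powr \<nu>"
    have p: "(r, \<zeta>) \<in> dom_E R" "(r', \<zeta>) \<in> dom_E R" using r \<zeta> R2 a by auto
    have cD: "continuous_on (dom_E R) ?D"
      using nu by (intro continuous_intros family_facts(2)[OF e] continuous_on_theta_dom[OF nu LE xi_le_R]) auto
    have bD: "\<bar>?D p\<bar> \<le> K * (C\<^sub>1 * \<epsilon>)" if p: "p \<in> dom_E R" for p
    proof -
      have "\<bar>?D p\<bar> \<le> K * \<bar>\<Theta> \<epsilon> p - \<theta> (fst p)\<bar>"
        unfolding K_def using M p e nu by (intro pos_part_powr_Lipschitz) auto
      also have "\<dots> \<le> K * (C\<^sub>1 * \<epsilon>)" using family_facts(4)[OF e p] K by (intro mult_left_mono) auto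
      finally show ?thesis .
    qed
    have "\<bar>lin_pot R ?D (r, \<zeta>) - lin_pot R ?D (r', \<zeta>)\<bar> \<le> L * (K * (C\<^sub>1 * \<epsilon>)) * \<bar>r - r'\<bar>"
      using r R2 \<zeta> e C K by (intro L(2) cD bD) auto
    moreover have "\<bar>\<epsilon> * frak_g R (r, \<zeta>) - \<epsilon> * frak_g R (r', \<zeta>)\<bar> \<le> \<epsilon> * (\<xi> * \<bar>r - r'\<bar>)"
    proof -
      have "\<zeta>\<^sup>2 \<le> 1" using \<zeta> by (auto simp: abs_square_le_1 abs_le_iff)
      then have z: "\<bar>1/4 * (1 - \<zeta>\<^sup>2)\<bar> \<le> 1/4" by simp
      have "\<epsilon> * frak_g R (r, \<zeta>) - \<epsilon> * frak_g R (r', \<zeta>) = \<epsilon> * (1/4 * (1 - \<zeta>\<^sup>2) * ((r + r') * (r - r')))"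
      proof -
        have g: "frak_g R (r, \<zeta>) = 1/4 * (1 - \<zeta>\<^sup>2) * r\<^sup>2" "frak_g R (r', \<zeta>) = 1/4 * (1 - \<zeta>\<^sup>2) * r'\<^sup>2"
          using p by (auto simp: frak_g_def on_dom_def)
        show ?thesis unfolding g by algebra
      qed
      also have "\<bar>\<dots>\<bar> = \<epsilon> * (\<bar>1/4 * (1 - \<zeta>\<^sup>2)\<bar> * (\<bar>r + r'\<bar> * \<bar>r - r'\<bar>))"
        using e by (simp add: abs_mult)
      \<comment> \<open>Here r + r' \<le> 4 \<xi> absorbs the 1/4 and leaves the constant
        \<xi>.\<close>
      also have "\<dots> \<le> \<epsilon> * (1/4 * ((4 * \<xi>) * \<bar>r - r'\<bar>))"
        using e r xi_gt_0 z by (intro mult_left_mono mult_mono) auto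
      finally show ?thesis by simp
    qed
    ultimately have "\<bar>(\<Theta> \<epsilon> (r, \<zeta>) - \<theta> r) - (\<Theta> \<epsilon> (r', \<zeta>) - \<theta> r')\<bar> \<le> \<epsilon> * (\<xi> * \<bar>r - r'\<bar>) + L * (K * (C\<^sub>1 * \<epsilon>)) * \<bar>r - r'\<bar>"
      using difference_equation[OF e p(1)] difference_equation[OF e p(2)] unfolding fst_conv by linarith
    also have "\<dots> = \<epsilon> * (\<xi> + L * (K * C\<^sub>1)) * \<bar>r - r'\<bar>" by (simp add: algebra_simps)
    finally show ?thesis .
  qed
  then show ?thesis using L K C xi_gt_0 by (intro exI[of _ "\<xi> + L * (K * C\<^sub>1)"]) auto
qed

text \<open>-\<theta>' at z is the flux divided by z^2. The flux increases, so its value at \<xi>/2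
  together with z \<le> 2\<xi> bounds the slope below, inside and outside the star.\<close>

lemma theta_slope:
  "\<exists>c>0. \<forall>r r'. \<xi> / 2 \<le> r \<longrightarrow> r < r' \<longrightarrow> r' \<le> 2 * \<xi> \<longrightarrow> \<theta> r' - \<theta> r \<le> - c * (r' - r)"
proof -
  note nu1 = nu_gt_1[OF nu]
  let ?c = "lane_emden_flux \<nu> \<theta> (\<xi> / 2) / (2 * \<xi>)\<^sup>2"
  have c: "0 < ?c" using lane_emden_flux_pos[OF LE nu1, of "\<xi> / 2"] xi_gt_0 by simp
  have "\<theta> r' - \<theta> r \<le> - ?c * (r' - r)" if r: "\<xi> / 2 \<le> r" "r < r'" "r' \<le> 2 * \<xi>" for r r'
  proof -
    have "\<exists>z>r. z < r' \<and> \<theta> r' - \<theta> r = (r' - r) * (- lane_emden_flux \<nu> \<theta> z / z\<^sup>2)"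
      by (rule MVT2[OF r(2)]) (use r xi_gt_0 in \<open>auto intro!: DERIV_theta[OF LE nu1, simplified] simp flip: minus_divide_left\<close>)
    then obtain z where z: "r < z" "z < r'" "\<theta> r' - \<theta> r = (r' - r) * (- lane_emden_flux \<nu> \<theta> z / z\<^sup>2)" by blast
    have "?c \<le> lane_emden_flux \<nu> \<theta> z / z\<^sup>2"
      using z r xi_gt_0 lane_emden_flux_pos[OF LE nu1, of "\<xi> / 2"] lane_emden_flux_pos[OF LE nu1, of z]
      by (intro frac_le lane_emden_flux_mono[OF LE nu1] power_mono) auto
    then have "(r' - r) * (- lane_emden_flux \<nu> \<theta> z / z\<^sup>2) \<le> (r' - r) * (- ?c)"
      using r by (intro mult_left_mono) auto
    then show ?thesis unfolding z(3) by (simp only: mult.commute)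
  qed
  then show ?thesis using c by blast
qed

lemma theta_inner_lower_bound:
  assumes "0 \<le> r" "r \<le> \<xi> / 2"
  shows "\<theta> (\<xi> / 2) \<le> \<theta> r"
proof (cases "r = \<xi> / 2")
  case False
  note nu1 = nu_gt_1[OF nu]
  have "\<theta> (\<xi> / 2) < \<theta> r"
  proof (rule DERIV_neg_imp_decreasing_open[where f = \<theta>])
    show "r < \<xi> / 2" using False assms by simp
    fix x assume x: "r < x" "x < \<xi> / 2"
    then have "0 < x" using assms by simp
    then show "\<exists>y. (\<theta> has_real_derivative y) (at x) \<and> y < 0"
      using DERIV_theta[OF LE nu1, of x] lane_emden_flux_pos[OF LE nu1, of x]
      by (intro exI[of _ "- lane_emden_flux \<nu> \<theta> x / x\<^sup>2"]) auto
  next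
    show "continuous_on {r..\<xi> / 2} \<theta>"
      by (rule continuous_on_subset[OF continuous_on_theta[OF LE nu1]]) (use assms in auto)
  qed
  then show ?thesis by simp
next
  case True
  then show ?thesis by (simp only: order_refl)
qed

lemma surface_radius_properties:
  "\<exists>\<epsilon>\<^sub>0>0. \<epsilon>\<^sub>0 \<le> \<epsilon>\<^sub>1 \<and> (\<forall>\<epsilon> \<zeta>. 0 < \<epsilon> \<longrightarrow> \<epsilon> \<le> \<epsilon>\<^sub>0 \<longrightarrow> \<zeta> \<in> {-1..1} \<longrightarrow>
     surface_radius \<xi> (\<Theta> \<epsilon>) \<zeta> \<in> {\<xi> / 2<..<2 * \<xi>} \<and> \<Theta> \<epsilon> (surface_radius \<xi> (\<Theta> \<epsilon>) \<zeta>, \<zeta>) = 0)"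
proof -
  note nu1 = nu_gt_1[OF nu]
  obtain D where D: "0 \<le> D" "\<forall>\<epsilon> r r' \<zeta>. 0 < \<epsilon> \<longrightarrow> \<epsilon> \<le> \<epsilon>\<^sub>1 \<longrightarrow> r \<in> {\<xi> / 2..2 * \<xi>} \<longrightarrow> r' \<in> {\<xi> / 2..2 * \<xi>} \<longrightarrow> \<zeta> \<in> {-1..1} \<longrightarrow>
     \<bar>(\<Theta> \<epsilon> (r, \<zeta>) - \<theta> r) - (\<Theta> \<epsilon> (r', \<zeta>) - \<theta> r')\<bar> \<le> \<epsilon> * D * \<bar>r - r'\<bar>"
    using difference_Lipschitz by (elim exE conjE)
  obtain c where c: "0 < c" "\<forall>r r'. \<xi> / 2 \<le> r \<longrightarrow> r < r' \<longrightarrow> r' \<le> 2 * \<xi> \<longrightarrow> \<theta> r' - \<theta> r \<le> - c * (r' - r)"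
    using theta_slope by (elim exE conjE)
  have C: "0 < C\<^sub>1" "0 < \<epsilon>\<^sub>1" using constants_pos by auto
  have in_pos: "0 < \<theta> (\<xi> / 2)" using theta_pos[OF LE nu1, of "\<xi> / 2"] xi_gt_0 by simp
  have out_neg: "\<theta> (2 * \<xi>) < 0"
  proof -
    have "\<theta> (2 * \<xi>) - \<theta> \<xi> \<le> - c * (2 * \<xi> - \<xi>)" using c(2)[rule_format, of \<xi> "2 * \<xi>"] xi_gt_0 by simp
    also have "\<dots> < 0" using c(1) xi_gt_0 by simp
    finally show ?thesis using theta_xi[OF LE nu1] by simp
  qed
  \<comment> \<open>Besides membership in the family: \<open>C\<^sub>1 * \<epsilon>\<close> stays
    below \<theta>(\<xi>/2) and -\<theta>(2\<xi>), which preserves the signs at both ends, and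
    \<open>\<epsilon> * D\<close> stays below the slope \<open>c\<close>. The factor 2 makes these
    strict, and \<open>D + 1\<close> avoids a zero divisor.\<close>
  define \<epsilon>\<^sub>0 where "\<epsilon>\<^sub>0 = min \<epsilon>\<^sub>1 (min (\<theta> (\<xi> / 2) / (2 * C\<^sub>1)) (min (- \<theta> (2 * \<xi>) / (2 * C\<^sub>1)) (c / (2 * (D + 1)))))"
  have e0: "0 < \<epsilon>\<^sub>0" using C in_pos out_neg c(1) D(1) by (simp add: \<epsilon>\<^sub>0_def divide_neg_pos)
  have "surface_radius \<xi> (\<Theta> \<epsilon>) \<zeta> \<in> {\<xi> / 2<..<2 * \<xi>} \<and> \<Theta> \<epsilon> (surface_radius \<xi> (\<Theta> \<epsilon>) \<zeta>, \<zeta>) = 0"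
    if e: "0 < \<epsilon>" "\<epsilon> \<le> \<epsilon>\<^sub>0" and \<zeta>: "\<zeta> \<in> {-1..1}" for \<epsilon> \<zeta>
  proof (rule surface_radius_exists[OF xi_gt_0])
    have e1: "\<epsilon> \<le> \<epsilon>\<^sub>1" using e by (simp add: \<epsilon>\<^sub>0_def)
    have e2: "C\<^sub>1 * \<epsilon> < \<theta> (\<xi> / 2)" "C\<^sub>1 * \<epsilon> < - \<theta> (2 * \<xi>)"
    proof -
      have "\<epsilon> \<le> \<theta> (\<xi> / 2) / (2 * C\<^sub>1)" "\<epsilon> \<le> - \<theta> (2 * \<xi>) / (2 * C\<^sub>1)" using e by (simp_all add: \<epsilon>\<^sub>0_def)
      then have "\<epsilon> * (2 * C\<^sub>1) \<le> \<theta> (\<xi> / 2)" "\<epsilon> * (2 * C\<^sub>1) \<le> - \<theta> (2 * \<xi>)"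
        using C by (simp_all only: pos_le_divide_eq mult_pos_pos zero_less_numeral)
      moreover have "0 < C\<^sub>1 * \<epsilon>" using C e by simp
      moreover have "\<epsilon> * (2 * C\<^sub>1) = 2 * (C\<^sub>1 * \<epsilon>)" by simp
      ultimately show "C\<^sub>1 * \<epsilon> < \<theta> (\<xi> / 2)" "C\<^sub>1 * \<epsilon> < - \<theta> (2 * \<xi>)" by linarith+
    qed
    have e3: "\<epsilon> * D < c"
    proof -
      have "\<epsilon> \<le> c / (2 * (D + 1))" using e by (simp add: \<epsilon>\<^sub>0_def)
      then have "\<epsilon> * (2 * (D + 1)) \<le> c" using D by (simp add: pos_le_divide_eq)
      moreover have "0 < \<epsilon> * (D + 2)" using e D by simp
      ultimately show ?thesis by (simp add: algebra_simps)
    qed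
    have close: "\<bar>\<Theta> \<epsilon> (r, \<zeta>) - \<theta> r\<bar> \<le> C\<^sub>1 * \<epsilon>" if "r \<in> {0..2 * \<xi>}" for r
      using family_facts(4)[OF e(1) e1, of "(r, \<zeta>)"] that \<zeta> R2 by simp
    show "continuous_on {\<xi> / 2..2 * \<xi>} (\<lambda>r. \<Theta> \<epsilon> (r, \<zeta>))"
      by (rule continuous_on_compose2[OF family_facts(2)[OF e(1) e1]])
         (use \<zeta> R2 xi_gt_0 in \<open>auto intro!: continuous_intros\<close>)
    show "0 < \<Theta> \<epsilon> (r, \<zeta>)" if "0 \<le> r" "r \<le> \<xi> / 2" for r
      using close[of r] theta_inner_lower_bound[OF that] e2(1) that xi_gt_0 by auto
    show "\<Theta> \<epsilon> (2 * \<xi>, \<zeta>) < 0" using close[of "2 * \<xi>"] e2(2) xi_gt_0 by auto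
    show "\<Theta> \<epsilon> (r', \<zeta>) < \<Theta> \<epsilon> (r, \<zeta>)" if r: "\<xi> / 2 \<le> r" "r < r'" "r' \<le> 2 * \<xi>" for r r'
    proof -
      have d1: "\<bar>(\<Theta> \<epsilon> (r', \<zeta>) - \<theta> r') - (\<Theta> \<epsilon> (r, \<zeta>) - \<theta> r)\<bar> \<le> \<epsilon> * D * \<bar>r' - r\<bar>"
        by (rule D(2)[rule_format]) (use e(1) e1 r \<zeta> in auto)
      have d2: "\<theta> r' - \<theta> r \<le> - c * (r' - r)" using c(2) r by blast
      have d3: "\<epsilon> * D * (r' - r) < c * (r' - r)" using e3 r by (intro mult_strict_right_mono) auto
      have "\<bar>r' - r\<bar> = r' - r" using r by simp
      then show ?thesis using d1 d2 d3 unfolding mult_minus_left by linarith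
    qed
  qed
  moreover have "\<epsilon>\<^sub>0 \<le> \<epsilon>\<^sub>1" by (simp add: \<epsilon>\<^sub>0_def)
  ultimately show ?thesis using e0 by blast
qed

text \<open>Two passes. The slope of \<theta> first locates the zero X within O(\<epsilon>) of
  \<xi>; the Taylor error of \<theta> and the change of \<epsilon> times \<open>frak_h\<close>
  between X and \<xi> are then both O(\<epsilon>^2). What is left is linear in X - \<xi>, with
  coefficient \<theta>'(\<xi>) = -\<mu>/\<xi>^2.\<close>

lemma surface_radius_expansion:
  "\<exists>C\<ge>0. \<exists>\<epsilon>\<^sub>0>0. \<forall>\<epsilon> \<zeta>. 0 < \<epsilon> \<longrightarrow> \<epsilon> \<le> \<epsilon>\<^sub>0 \<longrightarrow> \<zeta> \<in> {-1..1} \<longrightarrow>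
     \<bar>surface_radius \<xi> (\<Theta> \<epsilon>) \<zeta> - (\<xi> + \<xi>\<^sup>2 / lane_emden_mass \<nu> \<theta> \<xi> * frak_h \<nu> R \<theta> (\<xi>, \<zeta>) * \<epsilon>)\<bar> \<le> C * \<epsilon>\<^sup>2"
proof -
  note nu1 = nu_gt_1[OF nu]
  note xi0 = xi_gt_0
  define \<mu> where "\<mu> = lane_emden_mass \<nu> \<theta> \<xi>"
  have \<mu>: "0 < \<mu>" "\<mu> = lane_emden_flux \<nu> \<theta> \<xi>"
    using lane_emden_mass_pos[OF LE nu1] lane_emden_mass_eq[OF LE nu1] by (simp_all add: \<mu>_def)
  have C1: "0 < C\<^sub>1" using constants_pos by simp
  obtain e0 where e0: "0 < e0" "e0 \<le> \<epsilon>\<^sub>1" "\<forall>\<epsilon> \<zeta>. 0 < \<epsilon> \<longrightarrow> \<epsilon> \<le> e0 \<longrightarrow> \<zeta> \<in> {-1..1} \<longrightarrow>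
     surface_radius \<xi> (\<Theta> \<epsilon>) \<zeta> \<in> {\<xi> / 2<..<2 * \<xi>} \<and> \<Theta> \<epsilon> (surface_radius \<xi> (\<Theta> \<epsilon>) \<zeta>, \<zeta>) = 0"
    using surface_radius_properties by (elim exE conjE)
  obtain c where c: "0 < c" "\<forall>r r'. \<xi> / 2 \<le> r \<longrightarrow> r < r' \<longrightarrow> r' \<le> 2 * \<xi> \<longrightarrow> \<theta> r' - \<theta> r \<le> - c * (r' - r)"
    using theta_slope by (elim exE conjE)
  obtain C where C: "0 \<le> C" "\<forall>\<epsilon>. 0 < \<epsilon> \<longrightarrow> \<epsilon> \<le> \<epsilon>\<^sub>1 \<longrightarrow> (\<forall>p\<in>dom_E R.
     \<bar>\<Theta> \<epsilon> p - (\<theta> (fst p) + \<epsilon> * frak_h \<nu> R \<theta> p)\<bar> \<le> C * \<epsilon>\<^sup>2)"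
    using first_order_expansion by (elim exE conjE)
  \<comment> \<open>The flux is differentiable across the edge, so \<theta> has a second derivative
    at \<xi>; its value only affects the constant.\<close>
  have "\<exists>D. ((\<lambda>r. - lane_emden_flux \<nu> \<theta> r / r\<^sup>2) has_real_derivative D) (at \<xi>)"
    by (rule exI, rule DERIV_divide[OF DERIV_minus[OF DERIV_lane_emden_flux[OF LE nu1 xi0]] DERIV_pow])
       (use xi0 in simp)
  then obtain D where dflux: "((\<lambda>r. - lane_emden_flux \<nu> \<theta> r / r\<^sup>2) has_real_derivative D) (at \<xi>)" ..
  have d\<theta>: "(\<theta> has_real_derivative - lane_emden_flux \<nu> \<theta> y / y\<^sup>2) (at y)" if "\<bar>y - \<xi>\<bar> < \<xi>" for y
    using that by (intro DERIV_theta[OF LE nu1]) auto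
  have "\<exists>Q d. 0 \<le> Q \<and> 0 < d \<and> (\<forall>y. \<bar>y - \<xi>\<bar> < d \<longrightarrow>
      \<bar>\<theta> y - \<theta> \<xi> - - lane_emden_flux \<nu> \<theta> \<xi> / \<xi>\<^sup>2 * (y - \<xi>)\<bar> \<le> Q * (y - \<xi>)\<^sup>2)"
    by (rule Taylor_quadratic_bound[OF _ xi0 dflux]) (rule d\<theta>)
  then obtain Q d1 where Q: "0 \<le> Q" "0 < d1" "\<forall>y. \<bar>y - \<xi>\<bar> < d1 \<longrightarrow>
      \<bar>\<theta> y - \<theta> \<xi> - - lane_emden_flux \<nu> \<theta> \<xi> / \<xi>\<^sup>2 * (y - \<xi>)\<bar> \<le> Q * (y - \<xi>)\<^sup>2"
    by (elim exE conjE)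
  have "h\<^sub>0 differentiable (at \<xi>)" using h0 xi0 by (auto simp: is_h0_def radial_twice_diff_def)
  then have "(h\<^sub>0 has_real_derivative deriv h\<^sub>0 \<xi>) (at \<xi>)" by (simp add: DERIV_deriv_iff_real_differentiable)
  from DERIV_local_Lipschitz[OF this]
  obtain H d2 where H: "0 \<le> H" "0 < d2" "\<forall>y. \<bar>y - \<xi>\<bar> < d2 \<longrightarrow> \<bar>h\<^sub>0 y - h\<^sub>0 \<xi>\<bar> \<le> H * \<bar>y - \<xi>\<bar>"
    by (elim exE conjE)
  from DERIV_local_Lipschitz[OF DERIV_psi2[OF LE nu1 psi xi0]]
  obtain P d3 where P: "0 \<le> P" "0 < d3" "\<forall>y. \<bar>y - \<xi>\<bar> < d3 \<longrightarrow> \<bar>\<psi>\<^sub>2 y - \<psi>\<^sub>2 \<xi>\<bar> \<le> P * \<bar>y - \<xi>\<bar>"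
    by (elim exE conjE)
  let ?A = "coeff_A2 \<xi> \<psi>\<^sub>2"
  \<comment> \<open>\<open>L\<close> bounds the increments of \<open>frak_h\<close> along rays from
    \<xi>, uniformly in \<zeta> since \<open>\<bar>legendre_P2 \<zeta>\<bar> \<le> 1\<close>; below,
    \<open>K * \<epsilon>\<close> bounds the displacement of the zero.\<close>
  define L where "L = H + \<bar>?A\<bar> * P"
  define K where "K = C\<^sub>1 / c"
  have K: "0 < K" using C1 c(1) by (simp add: K_def)
  have L: "0 \<le> L" using H(1) P(1) by (simp add: L_def)
  define E where "E = \<xi>\<^sup>2 / \<mu> * (L * K + C + Q * K\<^sup>2)"
  \<comment> \<open>Half the smallest radius of validity, divided by \<open>K\<close>, keeps the
    displacement strictly below each of \<open>d1\<close>, \<open>d2\<close> and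
    \<open>d3\<close>.\<close>
  define \<epsilon>\<^sub>0 where "\<epsilon>\<^sub>0 = min e0 (min d1 (min d2 d3) / (2 * K))"
  have "\<bar>surface_radius \<xi> (\<Theta> \<epsilon>) \<zeta> - (\<xi> + \<xi>\<^sup>2 / \<mu> * frak_h \<nu> R \<theta> (\<xi>, \<zeta>) * \<epsilon>)\<bar> \<le> E * \<epsilon>\<^sup>2"
    if e: "0 < \<epsilon>" "\<epsilon> \<le> \<epsilon>\<^sub>0" and \<zeta>: "\<zeta> \<in> {-1..1}" for \<epsilon> \<zeta>
  proof -
    define X where "X = surface_radius \<xi> (\<Theta> \<epsilon>) \<zeta>"
    have ee: "\<epsilon> \<le> e0" "\<epsilon> \<le> \<epsilon>\<^sub>1" using e e0(1,2) by (auto simp: \<epsilon>\<^sub>0_def)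
    have X: "\<xi> / 2 < X" "X < 2 * \<xi>" "\<Theta> \<epsilon> (X, \<zeta>) = 0"
      using e0(3)[rule_format, OF e(1) ee(1) \<zeta>] by (auto simp: X_def)
    have XR: "X \<in> {0..R}" "\<xi> \<in> {0..R}" using X xi0 R2 by auto
    have pX: "(X, \<zeta>) \<in> dom_E R" using XR \<zeta> by auto
    have "\<bar>\<theta> X\<bar> \<le> C\<^sub>1 * \<epsilon>" using family_facts(4)[OF e(1) ee(2) pX] X by simp
    moreover have "c * \<bar>X - \<xi>\<bar> \<le> \<bar>\<theta> X\<bar>"
    proof (cases X \<xi> rule: linorder_cases)
      case less
      then show ?thesis using c(2)[rule_format, of X \<xi>] X xi0 theta_xi[OF LE nu1] by (simp add: abs_if)
    next
      case greater
      then show ?thesis using c(2)[rule_format, of \<xi> X] X xi0 theta_xi[OF LE nu1] by (simp add: abs_if)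
    qed simp
    ultimately have "c * \<bar>X - \<xi>\<bar> \<le> C\<^sub>1 * \<epsilon>" by linarith
    then have XK: "\<bar>X - \<xi>\<bar> \<le> K * \<epsilon>" using c(1) by (simp add: K_def field_simps)
    have "K * \<epsilon> \<le> K * (min d1 (min d2 d3) / (2 * K))" using e K by (intro mult_left_mono) (auto simp: \<epsilon>\<^sub>0_def)
    also have "\<dots> = min d1 (min d2 d3) / 2" using K by simp
    also have "\<dots> < min d1 (min d2 d3)"
    proof -
      have "0 < min d1 (min d2 d3)" using Q(2) H(2) P(2) by simp
      then show ?thesis by linarith
    qed
    finally have Xd: "\<bar>X - \<xi>\<bar> < d1" "\<bar>X - \<xi>\<bar> < d2" "\<bar>X - \<xi>\<bar> < d3" using XK by auto
    have t1: "\<bar>\<theta> X + \<mu> / \<xi>\<^sup>2 * (X - \<xi>)\<bar> \<le> Q * K\<^sup>2 * \<epsilon>\<^sup>2"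
    proof -
      have "\<bar>\<theta> X - \<theta> \<xi> - - lane_emden_flux \<nu> \<theta> \<xi> / \<xi>\<^sup>2 * (X - \<xi>)\<bar> \<le> Q * (X - \<xi>)\<^sup>2" using Q(3) Xd(1) by blast
      also have "\<dots> \<le> Q * (K * \<epsilon>)\<^sup>2" using XK Q(1) by (intro mult_left_mono abs_le_square_iff[THEN iffD1]) auto
      finally show ?thesis using theta_xi[OF LE nu1] \<mu>(2) by (simp add: power_mult_distrib mult.assoc)
    qed
    have t2: "\<bar>frak_h \<nu> R \<theta> (X, \<zeta>) - frak_h \<nu> R \<theta> (\<xi>, \<zeta>)\<bar> \<le> L * K * \<epsilon>"
    proof -
      define y where "y = \<zeta>\<^sup>2"
      have y: "0 \<le> y" "y \<le> 1" using \<zeta> by (auto simp: y_def abs_square_le_1 abs_le_iff)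
      have "legendre_P2 \<zeta> \<le> 1" unfolding legendre_P2_def y_def[symmetric] using y by simp
      moreover have "- legendre_P2 \<zeta> \<le> 1" unfolding legendre_P2_def y_def[symmetric] using y by simp
      ultimately have P2: "\<bar>legendre_P2 \<zeta>\<bar> \<le> 1" by simp
      have "frak_h \<nu> R \<theta> (X, \<zeta>) - frak_h \<nu> R \<theta> (\<xi>, \<zeta>) = (h\<^sub>0 X - h\<^sub>0 \<xi>) + ?A * (\<psi>\<^sub>2 X - \<psi>\<^sub>2 \<xi>) * legendre_P2 \<zeta>"
        unfolding frak_h_value[OF XR(1) \<zeta>] frak_h_value[OF XR(2) \<zeta>] by (simp add: algebra_simps)
      also have "\<bar>\<dots>\<bar> \<le> \<bar>h\<^sub>0 X - h\<^sub>0 \<xi>\<bar> + \<bar>?A\<bar> * \<bar>\<psi>\<^sub>2 X - \<psi>\<^sub>2 \<xi>\<bar> * \<bar>legendre_P2 \<zeta>\<bar>"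
        by (rule order_trans[OF abs_triangle_ineq]) (simp add: abs_mult)
      also have "\<dots> \<le> H * \<bar>X - \<xi>\<bar> + \<bar>?A\<bar> * (P * \<bar>X - \<xi>\<bar>) * 1"
        using H(3) P(1,3) Xd P2 by (intro add_mono mult_mono) auto
      also have "\<dots> = L * \<bar>X - \<xi>\<bar>" by (simp add: L_def algebra_simps)
      also have "\<dots> \<le> L * (K * \<epsilon>)" using XK L by (intro mult_left_mono)
      finally show ?thesis by (simp add: mult.assoc)
    qed
    then have t2': "\<bar>\<epsilon> * frak_h \<nu> R \<theta> (X, \<zeta>) - \<epsilon> * frak_h \<nu> R \<theta> (\<xi>, \<zeta>)\<bar> \<le> L * K * \<epsilon>\<^sup>2"
    proof -
      have "\<bar>\<epsilon> * frak_h \<nu> R \<theta> (X, \<zeta>) - \<epsilon> * frak_h \<nu> R \<theta> (\<xi>, \<zeta>)\<bar> = \<epsilon> * \<bar>frak_h \<nu> R \<theta> (X, \<zeta>) - frak_h \<nu> R \<theta> (\<xi>, \<zeta>)\<bar>"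
        using e by (simp add: right_diff_distrib[symmetric] abs_mult)
      also have "\<dots> \<le> \<epsilon> * (L * K * \<epsilon>)" using t2 e by (intro mult_left_mono) auto
      finally show ?thesis by (simp add: power2_eq_square mult_ac)
    qed
    have t3: "\<bar>\<theta> X + \<epsilon> * frak_h \<nu> R \<theta> (X, \<zeta>)\<bar> \<le> C * \<epsilon>\<^sup>2"
      using C(2)[rule_format, OF e(1) ee(2) pX] X(3) by simp
    have "\<bar>\<mu> / \<xi>\<^sup>2 * (X - \<xi>) - \<epsilon> * frak_h \<nu> R \<theta> (\<xi>, \<zeta>)\<bar> \<le> L * K * \<epsilon>\<^sup>2 + C * \<epsilon>\<^sup>2 + Q * K\<^sup>2 * \<epsilon>\<^sup>2"
      using t1 t2' t3 by linarith
    also have "\<dots> = (L * K + C + Q * K\<^sup>2) * \<epsilon>\<^sup>2" by (simp add: algebra_simps)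
    finally have "\<xi>\<^sup>2 / \<mu> * \<bar>\<mu> / \<xi>\<^sup>2 * (X - \<xi>) - \<epsilon> * frak_h \<nu> R \<theta> (\<xi>, \<zeta>)\<bar> \<le> \<xi>\<^sup>2 / \<mu> * ((L * K + C + Q * K\<^sup>2) * \<epsilon>\<^sup>2)"
      using \<mu>(1) by (intro mult_left_mono) auto
    moreover have "\<xi>\<^sup>2 / \<mu> * \<bar>\<mu> / \<xi>\<^sup>2 * (X - \<xi>) - \<epsilon> * frak_h \<nu> R \<theta> (\<xi>, \<zeta>)\<bar>
        = \<bar>\<xi>\<^sup>2 / \<mu> * (\<mu> / \<xi>\<^sup>2 * (X - \<xi>) - \<epsilon> * frak_h \<nu> R \<theta> (\<xi>, \<zeta>))\<bar>"
      using \<mu>(1) by (simp add: abs_mult)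
    moreover have "\<xi>\<^sup>2 / \<mu> * (\<mu> / \<xi>\<^sup>2 * (X - \<xi>) - \<epsilon> * frak_h \<nu> R \<theta> (\<xi>, \<zeta>)) = X - (\<xi> + \<xi>\<^sup>2 / \<mu> * frak_h \<nu> R \<theta> (\<xi>, \<zeta>) * \<epsilon>)"
      using \<mu>(1) xi0 by (simp add: right_diff_distrib)
    ultimately show ?thesis by (simp only: X_def E_def mult.assoc)
  qed
  moreover have "0 < \<epsilon>\<^sub>0" using e0(1) Q(2) H(2) P(2) K by (simp add: \<epsilon>\<^sub>0_def)
  moreover have "0 \<le> E" using \<mu>(1) L K C(1) Q(1) by (simp add: E_def)
  ultimately show ?thesis unfolding \<mu>_def by blast
qed

end

section \<open>Asymptotic statements and oblateness\<close>

lemma eventually_at_right_0I: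
  assumes "0 < (d::real)" "\<And>x. 0 < x \<Longrightarrow> x \<le> d \<Longrightarrow> P x"
  shows "\<forall>\<^sub>F x in at_right 0. P x"
  unfolding eventually_at_right_field using assms by (intro exI[of _ d]) auto

lemma abs_diff_diff_le: "\<bar>a - b\<bar> \<le> c \<Longrightarrow> \<bar>a' - b'\<bar> \<le> c \<Longrightarrow> \<bar>(a - a') - (b - b')\<bar> \<le> 2 * c"
  for a b c :: real
  by linarith

theorem mainTheorem3:
  fixes \<nu> \<xi>\<^sub>1 R\<^sub>0 \<epsilon>\<^sub>1 C\<^sub>1 :: real
    and \<theta> h\<^sub>0 \<psi>\<^sub>2 :: "real \<Rightarrow> real"
    and \<Theta> :: "real \<Rightarrow> real \<times> real \<Rightarrow> real"
  assumes "2 \<le> \<nu>" and "\<nu> < 5"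
    and "lane_emden \<nu> \<theta> \<xi>\<^sub>1"
    and "2 * \<xi>\<^sub>1 \<le> R\<^sub>0"
    and "has_bounded_inverse_E R\<^sub>0 (one_minus_DG \<nu> R\<^sub>0 \<theta>)"
    and "distorted_family \<nu> R\<^sub>0 \<theta> \<epsilon>\<^sub>1 C\<^sub>1 \<Theta>"
    and "is_h0 \<nu> \<theta> h\<^sub>0"
    and "is_psi2 \<nu> \<theta> \<psi>\<^sub>2"
  shows "(\<exists>C. \<forall>\<^sub>F \<epsilon> in at_right 0. \<forall>r\<in>{0..R\<^sub>0}. \<forall>\<zeta>\<in>{-1..1}.
            \<bar>\<Theta> \<epsilon> (r, \<zeta>) - (\<theta> r + \<epsilon> * frak_h \<nu> R\<^sub>0 \<theta> (r, \<zeta>))\<bar> \<le> C * \<epsilon>\<^sup>2) \<and>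
         (\<forall>r\<in>{0..R\<^sub>0}. \<forall>\<zeta>\<in>{-1..1}.
            frak_h \<nu> R\<^sub>0 \<theta> (r, \<zeta>) = h\<^sub>0 r + coeff_A2 \<xi>\<^sub>1 \<psi>\<^sub>2 * \<psi>\<^sub>2 r * legendre_P2 \<zeta>) \<and>
         coeff_A2 \<xi>\<^sub>1 \<psi>\<^sub>2 < 0 \<and>
         (\<forall>r>0. 0 < \<psi>\<^sub>2 r) \<and>
         (\<exists>C. \<forall>\<^sub>F \<epsilon> in at_right 0. \<forall>\<zeta>\<in>{-1..1}.
            \<bar>surface_radius \<xi>\<^sub>1 (\<Theta> \<epsilon>) \<zeta>
               - (\<xi>\<^sub>1 + \<xi>\<^sub>1\<^sup>2 / lane_emden_mass \<nu> \<theta> \<xi>\<^sub>1 * frak_h \<nu> R\<^sub>0 \<theta> (\<xi>\<^sub>1, \<zeta>) * \<epsilon>)\<bar> \<le> C * \<epsilon>\<^sup>2) \<and>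
         (\<forall>s\<in>{1, -1}.
            (\<exists>C. \<forall>\<^sub>F \<epsilon> in at_right 0.
               \<bar>oblateness \<xi>\<^sub>1 (\<Theta> \<epsilon>) s
                  - (- (3/2) * (\<xi>\<^sub>1 / lane_emden_mass \<nu> \<theta> \<xi>\<^sub>1)
                      * coeff_A2 \<xi>\<^sub>1 \<psi>\<^sub>2 * \<psi>\<^sub>2 \<xi>\<^sub>1 * \<epsilon>)\<bar> \<le> C * \<epsilon>\<^sup>2) \<and>
            (\<forall>\<^sub>F \<epsilon> in at_right 0. 0 < oblateness \<xi>\<^sub>1 (\<Theta> \<epsilon>) s))"
proof -
  note setting = assms(1,3-8)
  note nu1 = nu_gt_1[OF assms(1)]
  note xi0 = xi_gt_0[OF setting]
  let ?\<mu> = "lane_emden_mass \<nu> \<theta> \<xi>\<^sub>1" and ?A = "coeff_A2 \<xi>\<^sub>1 \<psi>\<^sub>2" and ?h = "frak_h \<nu> R\<^sub>0 \<theta>"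
  have \<mu>: "0 < ?\<mu>" by (rule lane_emden_mass_pos[OF assms(3) nu1])
  have A: "?A < 0" by (rule coeff_A2_neg[OF assms(1,3) xi_le_R[OF setting] assms(7,8)])
  have psi: "0 < \<psi>\<^sub>2 r" if "0 < r" for r by (rule psi2_pos[OF assms(3) nu1 assms(8) that])
  obtain C where C: "0 \<le> C" "\<forall>\<epsilon>. 0 < \<epsilon> \<longrightarrow> \<epsilon> \<le> \<epsilon>\<^sub>1 \<longrightarrow> (\<forall>p\<in>dom_E R\<^sub>0.
     \<bar>\<Theta> \<epsilon> p - (\<theta> (fst p) + \<epsilon> * ?h p)\<bar> \<le> C * \<epsilon>\<^sup>2)"
    using first_order_expansion[OF setting] by (elim exE conjE)
  have expansion: "\<exists>C. \<forall>\<^sub>F \<epsilon> in at_right 0. \<forall>r\<in>{0..R\<^sub>0}. \<forall>\<zeta>\<in>{-1..1}.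
            \<bar>\<Theta> \<epsilon> (r, \<zeta>) - (\<theta> r + \<epsilon> * ?h (r, \<zeta>))\<bar> \<le> C * \<epsilon>\<^sup>2"
  proof (intro exI[of _ C] eventually_at_right_0I[OF constants_pos(1)[OF setting]] ballI)
    fix \<epsilon> r \<zeta> :: real assume "0 < \<epsilon>" "\<epsilon> \<le> \<epsilon>\<^sub>1" "r \<in> {0..R\<^sub>0}" "\<zeta> \<in> {-1..1}"
    then show "\<bar>\<Theta> \<epsilon> (r, \<zeta>) - (\<theta> r + \<epsilon> * ?h (r, \<zeta>))\<bar> \<le> C * \<epsilon>\<^sup>2"
      using C(2)[rule_format, of \<epsilon> "(r, \<zeta>)"] by simp
  qed
  obtain E e0 where E: "0 \<le> E" "0 < e0" and surf: "\<forall>\<epsilon> \<zeta>. 0 < \<epsilon> \<longrightarrow> \<epsilon> \<le> e0 \<longrightarrow> \<zeta> \<in> {-1..1} \<longrightarrow>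
     \<bar>surface_radius \<xi>\<^sub>1 (\<Theta> \<epsilon>) \<zeta> - (\<xi>\<^sub>1 + \<xi>\<^sub>1\<^sup>2 / ?\<mu> * ?h (\<xi>\<^sub>1, \<zeta>) * \<epsilon>)\<bar> \<le> E * \<epsilon>\<^sup>2"
    using surface_radius_expansion[OF setting] by (elim exE conjE)
  have surface: "\<exists>C. \<forall>\<^sub>F \<epsilon> in at_right 0. \<forall>\<zeta>\<in>{-1..1}.
            \<bar>surface_radius \<xi>\<^sub>1 (\<Theta> \<epsilon>) \<zeta> - (\<xi>\<^sub>1 + \<xi>\<^sub>1\<^sup>2 / ?\<mu> * ?h (\<xi>\<^sub>1, \<zeta>) * \<epsilon>)\<bar> \<le> C * \<epsilon>\<^sup>2"
    by (intro exI[of _ E] eventually_at_right_0I[OF E(2)] ballI surf[rule_format])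
  \<comment> \<open>First-order coefficient of the oblateness, positive because
    \<open>coeff_A2\<close> is negative.\<close>
  define \<kappa> where "\<kappa> = - (3/2) * (\<xi>\<^sub>1 / ?\<mu>) * ?A * \<psi>\<^sub>2 \<xi>\<^sub>1"
  have \<kappa>: "0 < \<kappa>"
    using mult_pos_pos[OF mult_pos_pos[OF divide_pos_pos[OF xi0 \<mu>], of "- ?A"] psi[OF xi0]] A
    by (simp add: \<kappa>_def mult_neg_pos mult_pos_neg divide_neg_pos)
  have obl: "\<bar>oblateness \<xi>\<^sub>1 (\<Theta> \<epsilon>) s - \<kappa> * \<epsilon>\<bar> \<le> 2 * E / \<xi>\<^sub>1 * \<epsilon>\<^sup>2"
    if s: "s \<in> {1, -1}" and e: "0 < \<epsilon>" "\<epsilon> \<le> e0" for s \<epsilon>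
  proof -
    let ?X = "\<lambda>\<zeta>. surface_radius \<xi>\<^sub>1 (\<Theta> \<epsilon>) \<zeta>"
    let ?Y = "\<lambda>\<zeta>. \<xi>\<^sub>1 + \<xi>\<^sub>1\<^sup>2 / ?\<mu> * ?h (\<xi>\<^sub>1, \<zeta>) * \<epsilon>"
    have s1: "s \<in> {-1..1}" using s by auto
    have h: "?h (\<xi>\<^sub>1, \<zeta>) = h\<^sub>0 \<xi>\<^sub>1 + ?A * \<psi>\<^sub>2 \<xi>\<^sub>1 * legendre_P2 \<zeta>" if "\<zeta> \<in> {-1..1}" for \<zeta>
      using frak_h_value[OF setting _ that, of \<xi>\<^sub>1] xi0 xi_le_R[OF setting] by simp
    \<comment> \<open>\<open>h\<^sub>0\<close> cancels between equator and pole, and -3/2 is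
      \<open>legendre_P2 0 - legendre_P2 s\<close>, the same for both poles.\<close>
    have "?h (\<xi>\<^sub>1, 0) - ?h (\<xi>\<^sub>1, s) = - (3/2) * ?A * \<psi>\<^sub>2 \<xi>\<^sub>1"
      using s by (auto simp: h legendre_P2_def)
    moreover have "(?Y 0 - ?Y s) / \<xi>\<^sub>1 = \<xi>\<^sub>1 / ?\<mu> * (?h (\<xi>\<^sub>1, 0) - ?h (\<xi>\<^sub>1, s)) * \<epsilon>"
      using xi0 \<mu> by (simp add: field_simps power2_eq_square)
    ultimately have Y: "(?Y 0 - ?Y s) / \<xi>\<^sub>1 = \<kappa> * \<epsilon>" by (simp add: \<kappa>_def)
    have "\<bar>(?X 0 - ?X s) - (?Y 0 - ?Y s)\<bar> \<le> 2 * (E * \<epsilon>\<^sup>2)"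
      by (rule abs_diff_diff_le) (intro surf[rule_format] e s1; simp)+
    then have "\<bar>(?X 0 - ?X s) - (?Y 0 - ?Y s)\<bar> \<le> 2 * E * \<epsilon>\<^sup>2" by (simp only: mult.assoc)
    then have "\<bar>(?X 0 - ?X s) - (?Y 0 - ?Y s)\<bar> / \<xi>\<^sub>1 \<le> 2 * E * \<epsilon>\<^sup>2 / \<xi>\<^sub>1"
      using xi0 by (intro divide_right_mono) auto
    moreover have "\<bar>(?X 0 - ?X s) - (?Y 0 - ?Y s)\<bar> / \<xi>\<^sub>1 = \<bar>(?X 0 - ?X s) / \<xi>\<^sub>1 - (?Y 0 - ?Y s) / \<xi>\<^sub>1\<bar>"
      using xi0 by (simp only: diff_divide_distrib[symmetric] abs_divide abs_of_pos)
    ultimately show ?thesis unfolding Y oblateness_def by simp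
  qed
  have obl_pos: "\<forall>\<^sub>F \<epsilon> in at_right 0. 0 < oblateness \<xi>\<^sub>1 (\<Theta> \<epsilon>) s" if s: "s \<in> {1, -1}" for s
  proof (rule eventually_at_right_0I)
    \<comment> \<open>The added 1 leaves a surplus \<open>\<epsilon>\<^sup>2\<close>, which makes
      positivity strict, and keeps the divisor nonzero when \<open>E = 0\<close>.\<close>
    let ?K = "2 * E / \<xi>\<^sub>1 + 1"
    have K: "0 < ?K" using E xi0 by (simp add: add_nonneg_pos)
    show "0 < min e0 (\<kappa> / ?K)" using E \<kappa> K by simp
    fix \<epsilon> assume e: "0 < \<epsilon>" "\<epsilon> \<le> min e0 (\<kappa> / ?K)"
    have "\<epsilon> * ?K \<le> \<kappa>" using e K by (simp only: pos_le_divide_eq min.bounded_iff)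
    then have "\<epsilon> * (\<epsilon> * ?K) \<le> \<epsilon> * \<kappa>" using e by (intro mult_left_mono) auto
    moreover have "\<epsilon> * (\<epsilon> * ?K) = 2 * E / \<xi>\<^sub>1 * \<epsilon>\<^sup>2 + \<epsilon>\<^sup>2" by (simp add: algebra_simps power2_eq_square)
    moreover have "0 < \<epsilon>\<^sup>2" using e by simp
    moreover have "\<epsilon> * \<kappa> = \<kappa> * \<epsilon>" by simp
    moreover have "\<bar>oblateness \<xi>\<^sub>1 (\<Theta> \<epsilon>) s - \<kappa> * \<epsilon>\<bar> \<le> 2 * E / \<xi>\<^sub>1 * \<epsilon>\<^sup>2" using obl[OF s e(1)] e(2) by simp
    ultimately show "0 < oblateness \<xi>\<^sub>1 (\<Theta> \<epsilon>) s" by linarith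
  qed
  have oblate: "\<forall>s\<in>{1, -1}. (\<exists>C. \<forall>\<^sub>F \<epsilon> in at_right 0. \<bar>oblateness \<xi>\<^sub>1 (\<Theta> \<epsilon>) s
       - (- (3/2) * (\<xi>\<^sub>1 / ?\<mu>) * ?A * \<psi>\<^sub>2 \<xi>\<^sub>1 * \<epsilon>)\<bar> \<le> C * \<epsilon>\<^sup>2) \<and>
     (\<forall>\<^sub>F \<epsilon> in at_right 0. 0 < oblateness \<xi>\<^sub>1 (\<Theta> \<epsilon>) s)"
  proof (intro ballI conjI obl_pos)
    fix s :: real assume "s \<in> {1, -1}"
    from obl[OF this] show "\<exists>C. \<forall>\<^sub>F \<epsilon> in at_right 0. \<bar>oblateness \<xi>\<^sub>1 (\<Theta> \<epsilon>) s
       - (- (3/2) * (\<xi>\<^sub>1 / ?\<mu>) * ?A * \<psi>\<^sub>2 \<xi>\<^sub>1 * \<epsilon>)\<bar> \<le> C * \<epsilon>\<^sup>2"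
      unfolding \<kappa>_def by (intro exI[of _ "2 * E / \<xi>\<^sub>1"] eventually_at_right_0I[OF E(2)])
  qed
  show ?thesis
    using expansion frak_h_value[OF setting] A psi surface oblate by (intro conjI) simp_all
qed

end
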